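(* Let $Q\in A_\infty(\Delta)$ and write $Q(z)=\sum_{n=2}^\infty (n^3-n)a_n z^{n-2}$. For real $t$ close to $0$ let $f^{tQ}$ be the univalent function on $\Delta$ with $\mathcal S(f^{tQ})=tQ$, $f^{tQ}(0)=0$, $(f^{tQ})'(0)=1$, $(f^{tQ})''(0)=0$. Then $$\frac{d^2}{dt^2}A_S\big(f^{tQ}(\Delta)\big)\Big|_{t=0}=2\pi\sum_{n=2}^\infty n|a_n|^2 .$$
   Context: $\Delta=\{z\in\mathbb C:|z|<1\}$. $A_\infty(\Delta)$ is the Banach space of holomorphic functions $\phi$ on $\Delta$ with $\sup_{z\in\Delta}|\phi(z)(1-|z|^2)^2|<\infty$. $\mathcal S(f)=\frac{f_{zzz}}{f_z}-\frac32\left(\frac{f_{zz}}{f_z}\right)^2$ is the Schwarzian derivative. For $t$ small the solution $f^{tQ}$ of $\mathcal S(f^{tQ})=tQ$ with the stated normalization is univalent on $\Delta$ and has a quasiconformal extension. The spherical area of a domain $\Omega\subset\hat{\mathbb C}$ is $A_S(\Omega)=\iint_\Omega \frac{4\,dx\,dy}{(1+|z|^2)^2}$. *)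

theory Defs
  imports "HOL-Complex_Analysis.Complex_Analysis"
begin

text \<open>The point set of the Riemann sphere: the complex plane together with the point at
  infinity \<^term>\<open>None\<close>.\<close>
type_synonym riemann_sphere = "complex option"

text \<open>The values of a meromorphic function in the sphere. A nicely meromorphic function takes
  the dummy value 0 at its poles; \<open>to_sphere\<close> replaces it by infinity.\<close>
definition to_sphere :: "(complex \<Rightarrow> complex) \<Rightarrow> complex \<Rightarrow> riemann_sphere" where
  "to_sphere f z = (if is_pole f z then None else Some (f z))"

definition univalent_on :: "(complex \<Rightarrow> complex) \<Rightarrow> complex set \<Rightarrow> bool" where
  "univalent_on f D \<longleftrightarrow> f nicely_meromorphic_on D \<and> inj_on (to_sphere f) D"

definition schwarzian :: "(complex \<Rightarrow> complex) \<Rightarrow> complex \<Rightarrow> complex" where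
  "schwarzian f z =
     (deriv ^^ 3) f z / deriv f z - 3 / 2 * ((deriv ^^ 2) f z / deriv f z)\<^sup>2"

definition A_infty :: "(complex \<Rightarrow> complex) set" where
  "A_infty = {\<phi>. \<phi> holomorphic_on ball 0 1 \<and>
     bdd_above ((\<lambda>z. norm (\<phi> z * of_real ((1 - (norm z)\<^sup>2)\<^sup>2))) ` ball 0 1)}"

text \<open>The point at infinity is a null set for the spherical area, so only the finite points
  of \<open>\<Omega>\<close> enter the integral.\<close>
definition spherical_area :: "riemann_sphere set \<Rightarrow> real" where
  "spherical_area \<Omega> =
     set_lebesgue_integral lborel {z. Some z \<in> \<Omega>} (\<lambda>z. 4 / (1 + (norm z)\<^sup>2)\<^sup>2)"

text \<open>\<open>f\<close> is the normalized univalent solution on the unit disc of the equation with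
  Schwarzian derivative \<open>\<phi>\<close>. At a pole of \<open>f\<close> the formula for the Schwarzian is
  meaningless; as the pole is simple, it has a removable singularity there, and the equation
  at the pole follows from the equation at the other points by continuity.\<close>
definition normalized_univalent_solution ::
    "(complex \<Rightarrow> complex) \<Rightarrow> (complex \<Rightarrow> complex) \<Rightarrow> bool" where
  "normalized_univalent_solution \<phi> f \<longleftrightarrow>
     univalent_on f (ball 0 1) \<and>
     (\<forall>z\<in>ball 0 1. \<not> is_pole f z \<longrightarrow> schwarzian f z = \<phi> z) \<and>
     to_sphere f 0 = Some 0 \<and> deriv f 0 = 1 \<and> (deriv ^^ 2) f 0 = 0"

text \<open>\<open>A\<close> is differentiable near \<open>t\<^sub>0\<close>, and its derivative has derivative \<open>D\<close> at \<open>t\<^sub>0\<close>.\<close>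
definition has_second_real_derivative :: "(real \<Rightarrow> real) \<Rightarrow> real \<Rightarrow> real \<Rightarrow> bool" where
  "has_second_real_derivative A D t\<^sub>0 \<longleftrightarrow>
     (\<exists>A'. (\<forall>\<^sub>F t in nhds t\<^sub>0. (A has_real_derivative A' t) (at t)) \<and>
           (A' has_real_derivative D) (at t\<^sub>0))"

end

theory Submission
  imports Defs
begin

text \<open>The solution is $f = u/v$, where $u$ and $v$ solve $w'' = -(t/2) Q w$ with
  $u(0) = 0$, $u'(0) = 1$, $v(0) = 1$, $v'(0) = 0$. As $u'v - uv' = 1$, the spherical area of
  $f(\Delta)$ is the integral of $4/(|u|^2+|v|^2)^2$ over the disc, in which $t$ enters only through
  the power series $u = \sum_k t^k U_k$ and $v = \sum_k t^k V_k$. Comparison with $(1-|z|)^{-\epsilon}$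
  along radii bounds $U_k$, $V_k$ geometrically in $k$ and bounds $|v|$ from below, so that one may
  differentiate twice under the integral. At $t = 0$ the integrand involves $U_1, V_1, U_2, V_2$; the
  latter two and all holomorphic products drop out by rotation invariance, and Parseval's identity
  on smaller discs leaves a positive series whose radial integrals have an elementary primitive.\<close>

section \<open>Change of variables\<close>

text \<open>The obstacle is the boundary. \<open>Q\<close> may grow like (1 - |z|)^(-2), the order
  at which solutions of w'' = -(t/2) Q w can gain or lose a power of 1 - |z|: u and v need not stay
  bounded, and v might tend to 0. Powers of 1 - |z| solve the Euler equation with a potential of
  exactly this order, which is why one small power serves as comparison function both from above and
  from below. Two t-derivatives of the integrand multiply several such powers, so the exponent has
  to be fixed small in advance. The lower bound on v does double duty: it controls the denominators,
  and it shows that f has no pole in the disc, so that the image is a plane domain. Summability of n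
  |a n|^2 is not an input. It follows from integrability of the second t-derivative of the
  integrand, through identities on smaller discs whose weights are nonnegative and bounded by their
  limits. Constants: 12 comes from 12 * 25/576 >= 1/2; a factor 8 leaves room for differentiating a
  geometric series twice; 96 = 8 * 12.\<close>

definition vec2 :: "complex \<Rightarrow> real^2" where
  "vec2 z = (\<chi> i. if i = 1 then Re z else Im z)"

definition complex_of_vec2 :: "real^2 \<Rightarrow> complex" where
  "complex_of_vec2 x = Complex (x $ 1) (x $ 2)"

lemma vec2_complex_of_vec2 [simp]: "vec2 (complex_of_vec2 x) = x"
  by (simp add: vec2_def complex_of_vec2_def vec_eq_iff forall_2)

lemma complex_of_vec2_vec2 [simp]: "complex_of_vec2 (vec2 z) = z"
  by (simp add: vec2_def complex_of_vec2_def)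

lemma bounded_linear_vec2: "bounded_linear vec2"
  unfolding linear_conv_bounded_linear[symmetric]
  by (rule linearI) (auto simp: vec2_def vec_eq_iff)

lemma bounded_linear_complex_of_vec2: "bounded_linear complex_of_vec2"
  unfolding linear_conv_bounded_linear[symmetric]
  by (rule linearI) (auto simp: complex_of_vec2_def complex_eq_iff)

lemma complex_of_vec2_borel [measurable]: "complex_of_vec2 \<in> borel_measurable borel"
  using bounded_linear_complex_of_vec2
  by (intro borel_measurable_continuous_onI linear_continuous_on)

lemma Basis_vec2: "(Basis :: (real^2) set) = {axis 1 1, axis 2 1}"
  by (auto simp: Basis_vec_def UNIV_2)

text \<open>Lebesgue measure is determined by its values on boxes, and the coordinate identification
  matches boxes with boxes of the same sides.\<close>

lemma distr_lborel_complex_of_vec2: "distr lborel borel complex_of_vec2 = lborel"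
proof (rule lborel_eqI[symmetric])
  fix l u :: complex
  assume le: "\<And>b. b \<in> Basis \<Longrightarrow> l \<bullet> b \<le> u \<bullet> b"
  have *: "complex_of_vec2 -` box l u \<inter> space lborel = box (vec2 l) (vec2 u)"
    by (auto simp: box_def Basis_complex_def Basis_vec2 complex_of_vec2_def vec2_def inner_axis)
  have ne: "axis 1 1 \<noteq> (axis 2 1 :: real^2)"
    by (simp add: axis_eq_axis)
  have "emeasure (distr lborel borel complex_of_vec2) (box l u) = emeasure lborel (box (vec2 l) (vec2 u))"
    using * by (subst emeasure_distr) simp_all
  also have "\<dots> = (\<Prod>b\<in>Basis. (vec2 u - vec2 l) \<bullet> b)"
    using le[of 1] le[of \<i>]
    by (intro emeasure_lborel_box) (auto simp: Basis_complex_def Basis_vec2 vec2_def inner_axis)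
  also have "\<dots> = (\<Prod>b\<in>Basis. (u - l) \<bullet> b)"
    using ne by (simp add: Basis_complex_def Basis_vec2 vec2_def inner_axis inner_diff_left)
  finally show "emeasure (distr lborel borel complex_of_vec2) (box l u) = (\<Prod>b\<in>Basis. (u - l) \<bullet> b)" .
qed simp

text \<open>Multiplication by a + ib has the real matrix with rows (a, -b) and (b, a). This is the
  Jacobian of a map with complex derivative \<open>c\<close>.\<close>

lemma det_complex_mult: 
  "det (matrix (\<lambda>x. vec2 (c * complex_of_vec2 x))) = (norm c)\<^sup>2"
  by (simp add: det_2 matrix_def vec2_def complex_of_vec2_def axis_def cmod_power2) (simp add: power2_eq_square)

lemma set_integral_complex_of_vec2:
  fixes F :: "complex \<Rightarrow> real"
  assumes S[measurable]: "S \<in> sets borel" and [measurable]: "F \<in> borel_measurable borel"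
  shows "set_lebesgue_integral lborel S F = 
    set_lebesgue_integral lebesgue (vec2 ` S) (\<lambda>x. F (complex_of_vec2 x))"
  and "set_integrable lborel S F \<longleftrightarrow> (\<lambda>x. F (complex_of_vec2 x)) absolutely_integrable_on (vec2 ` S)"
proof -
  have ind: "indicator (vec2 ` S) x = (indicator S (complex_of_vec2 x) :: real)" for x
    by (auto simp: indicator_def image_iff) (metis vec2_complex_of_vec2)
  have m: "(\<lambda>x. indicator S (complex_of_vec2 x) * F (complex_of_vec2 x)) \<in> borel_measurable borel"
    by measurable
  show "set_lebesgue_integral lborel S F = 
    set_lebesgue_integral lebesgue (vec2 ` S) (\<lambda>x. F (complex_of_vec2 x))"
    unfolding set_lebesgue_integral_def ind
    apply (subst distr_lborel_complex_of_vec2[symmetric])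
    apply (subst integral_distr)
      apply (simp_all add: integral_completion m)
    done
  show "set_integrable lborel S F \<longleftrightarrow> (\<lambda>x. F (complex_of_vec2 x)) absolutely_integrable_on (vec2 ` S)"
    unfolding set_integrable_def ind
    apply (subst distr_lborel_complex_of_vec2[symmetric])
    apply (subst integrable_distr_eq)
      apply (simp_all add: integrable_completion m)
    done
qed

text \<open>The real Jacobian of a holomorphic map is |g'|^2;
  \<open>has_absolute_integral_change_of_variables\<close>, a statement about maps of
  \<open>real^2\<close>, is transported along \<open>vec2\<close>. It is formulated for every Borel
  \<open>F\<close>, so that the area can be rewritten before its integrand is known to be
  integrable.\<close>

lemma set_integral_image_holomorphic:
  fixes F :: "complex \<Rightarrow> real" and g :: "complex \<Rightarrow> complex"
  assumes S: "open S" and g: "g holomorphic_on S" and inj: "inj_on g S"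
    and F[measurable]: "F \<in> borel_measurable borel"
  shows "set_lebesgue_integral lborel (g ` S) F = 
    set_lebesgue_integral lborel S (\<lambda>z. (norm (deriv g z))\<^sup>2 * F (g z))"
proof -
  \<comment> \<open>Extension by 0 gives a Borel function on the whole plane, as
    \<open>set_integral_complex_of_vec2\<close> requires.\<close>
  define G where "G z = (if z \<in> S then (norm (deriv g z))\<^sup>2 * F (g z) else 0)" for z
  have oS: "open (g ` S)"
    using open_mapping_thm3[OF g S inj] .
  have gm: "g \<in> borel_measurable (restrict_space borel S)"
    using holomorphic_on_imp_continuous_on[OF g] by (intro borel_measurable_continuous_on_restrict)
  have dm: "deriv g \<in> borel_measurable (restrict_space borel S)"
    using holomorphic_on_imp_continuous_on[OF holomorphic_deriv[OF g S]]
    by (intro borel_measurable_continuous_on_restrict)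
  have "(\<lambda>z. (norm (deriv g z))\<^sup>2 * F (g z)) \<in> borel_measurable (restrict_space borel S)"
    using gm dm by measurable
  hence "(\<lambda>z. indicator S z *\<^sub>R ((norm (deriv g z))\<^sup>2 * F (g z))) \<in> borel_measurable borel"
    using S by (subst (asm) borel_measurable_restrict_space_iff) auto
  hence G[measurable]: "G \<in> borel_measurable borel"
    by (rule measurable_cong[THEN iffD1, rotated]) (auto simp: G_def)
  define g' where "g' x = vec2 (g (complex_of_vec2 x))" for x
  define D where "D x = (\<lambda>h. vec2 (deriv g (complex_of_vec2 x) * complex_of_vec2 h))" for x
  \<comment> \<open>The change-of-variables theorem takes vector-valued integrands; the real one
    enters as a vector with one component.\<close>
  define H where "H x = (vec (F (complex_of_vec2 x)) :: real^1)" for x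
  have img: "g' ` (vec2 ` S) = vec2 ` (g ` S)"
    by (auto simp: g'_def image_image)
  have injv: "inj vec2" by (metis complex_of_vec2_vec2 injI)
  have cov: "(\<lambda>x. \<bar>det (matrix (D x))\<bar> *\<^sub>R H (g' x)) absolutely_integrable_on (vec2 ` S) \<and>
     integral (vec2 ` S) (\<lambda>x. \<bar>det (matrix (D x))\<bar> *\<^sub>R H (g' x)) = b
     \<longleftrightarrow> H absolutely_integrable_on (g' ` (vec2 ` S)) \<and> integral (g' ` (vec2 ` S)) H = b" for b
  proof (rule has_absolute_integral_change_of_variables)
    have "vec2 ` S = complex_of_vec2 -` S" by (auto simp: image_iff) (metis vec2_complex_of_vec2)
    also have "\<dots> \<in> sets borel"
      using measurable_sets_borel[OF complex_of_vec2_borel, of S] S by auto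
    finally show "vec2 ` S \<in> sets lebesgue" by simp
    show "inj_on g' (vec2 ` S)"
      using inj injv by (auto simp: inj_on_def g'_def)
    fix x assume "x \<in> vec2 ` S"
    hence x: "complex_of_vec2 x \<in> S" by auto
    have "(g has_derivative (\<lambda>h. deriv g (complex_of_vec2 x) * h)) (at (complex_of_vec2 x))"
      using holomorphic_derivI[OF g S x] by (simp add: has_field_derivative_def)
    then show "(g' has_derivative D x) (at x within vec2 ` S)"
      unfolding g'_def D_def
      by (intro bounded_linear.has_derivative[OF bounded_linear_vec2]
        has_derivative_compose[of complex_of_vec2 complex_of_vec2 x _ g "\<lambda>h. deriv g (complex_of_vec2 x) * h"]
        bounded_linear_imp_has_derivative bounded_linear_complex_of_vec2)
  qed
  have eq1: "\<bar>det (matrix (D x))\<bar> *\<^sub>R H (g' x) = vec (G (complex_of_vec2 x))" if "x \<in> vec2 ` S" for x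
    using that by (auto simp: D_def H_def g'_def G_def det_complex_mult vec_eq_iff)
  have cov': "(\<lambda>x. vec (G (complex_of_vec2 x)) :: real^1) absolutely_integrable_on (vec2 ` S) \<and>
     integral (vec2 ` S) (\<lambda>x. vec (G (complex_of_vec2 x)) :: real^1) = b
     \<longleftrightarrow> H absolutely_integrable_on (vec2 ` (g ` S)) \<and> integral (vec2 ` (g ` S)) H = b" for b
  proof -
    have "(\<lambda>x. \<bar>det (matrix (D x))\<bar> *\<^sub>R H (g' x)) absolutely_integrable_on (vec2 ` S) \<longleftrightarrow>
        (\<lambda>x. vec (G (complex_of_vec2 x)) :: real^1) absolutely_integrable_on (vec2 ` S)"
      by (rule set_integrable_cong) (use eq1 in auto)
    moreover have "integral (vec2 ` S) (\<lambda>x. \<bar>det (matrix (D x))\<bar> *\<^sub>R H (g' x)) =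
        integral (vec2 ` S) (\<lambda>x. vec (G (complex_of_vec2 x)) :: real^1)"
      by (rule Henstock_Kurzweil_Integration.integral_cong) (rule eq1)
    ultimately show ?thesis
      using cov[of b] unfolding img by simp
  qed
  let ?G = "\<lambda>x. G (complex_of_vec2 x)" and ?F = "\<lambda>x. F (complex_of_vec2 x)"
  have "?G absolutely_integrable_on (vec2 ` S) \<and> integral (vec2 ` S) ?G = b
     \<longleftrightarrow> ?F absolutely_integrable_on (vec2 ` (g ` S)) \<and> integral (vec2 ` (g ` S)) ?F = b" for b
    using cov'[of "vec b"] unfolding H_def absolutely_integrable_on_1_iff integral_on_1_eq
    by (simp add: vec_eq_iff)
  hence *: "?G absolutely_integrable_on (vec2 ` S) \<longleftrightarrow> ?F absolutely_integrable_on (vec2 ` (g ` S))"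
    "?G absolutely_integrable_on (vec2 ` S) \<Longrightarrow> integral (vec2 ` S) ?G = integral (vec2 ` (g ` S)) ?F"
    by blast+
  have "set_lebesgue_integral lborel (g ` S) F = set_lebesgue_integral lborel S G"
  proof (cases "?G absolutely_integrable_on (vec2 ` S)")
    case True
    with * show ?thesis
      using oS S by (simp add: set_integral_complex_of_vec2 set_lebesgue_integral_eq_integral)
  next
    \<comment> \<open>Neither side is integrable, so both integrals have the default value
      0.\<close>
    case False
    hence "\<not> set_integrable lborel S G" "\<not> set_integrable lborel (g ` S) F"
      using * set_integral_complex_of_vec2(2)[of S G] set_integral_complex_of_vec2(2)[of "g`S" F] S oS by auto
    thus ?thesis
      by (simp add: set_lebesgue_integral_def set_integrable_def not_integrable_integral_eq)
  qed
  also have "\<dots> = set_lebesgue_integral lborel S (\<lambda>z. (norm (deriv g z))\<^sup>2 * F (g z))"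
    using S by (intro set_lebesgue_integral_cong) (auto simp: G_def)
  finally show ?thesis .
qed

section \<open>Integration over the unit disc\<close>

text \<open>Restricting the space, instead of multiplying by an indicator, means that measurability
  and bounds need checking only where |z| < 1, and that the measure is finite.\<close>

definition disc :: "complex measure" where
  "disc = restrict_space lborel (ball 0 1)"

lemma space_disc [simp]: "space disc = ball 0 1"
  by (simp add: disc_def space_restrict_space)

lemma borel_measurable_discI: "f \<in> borel_measurable borel \<Longrightarrow> f \<in> borel_measurable disc"
  unfolding disc_def by (intro measurable_restrict_space1) simp

lemma borel_measurable_disc_continuous: 
  "continuous_on (ball 0 1) f \<Longrightarrow> f \<in> borel_measurable disc"
  using borel_measurable_continuous_on_restrict[of "ball 0 1" f]
  by (simp add: disc_def measurable_cong_sets[OF sets_restrict_space_cong[OF sets_lborel] refl])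

lemma finite_measure_disc: "finite_measure disc"
  by (rule finite_measureI) (simp add: disc_def emeasure_restrict_space space_restrict_space emeasure_ball)

lemma integral_disc: "integral\<^sup>L disc f = set_lebesgue_integral lborel (ball 0 1) f"
  for f :: "complex \<Rightarrow> 'b :: {banach, second_countable_topology}"
  unfolding disc_def set_lebesgue_integral_def by (subst integral_restrict_space) auto

text \<open>This is polar integration with s = r^2, as r dr = ds / 2. It holds because the ring x <
  |z|^2 < 1 has area pi (1 - x) for 0 <= x < 1, and a finite measure is determined by half-lines.
  The variable s makes |z|^(2n) the monomial s^n.\<close>

lemma distr_disc_norm_power2:
  "distr disc borel (\<lambda>z. (norm z)\<^sup>2) = density lborel (\<lambda>s. ennreal pi * indicator {0<..<1::real} s)"
    (is "?M = ?N")
proof -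
  have [measurable]: "(\<lambda>z. (norm z)\<^sup>2) \<in> borel_measurable disc"
    by (intro borel_measurable_discI) measurable
  have M: "emeasure ?M {x<..} = emeasure lborel ({z. x < (norm z)\<^sup>2} \<inter> ball (0::complex) 1)" for x
  proof -
    have "emeasure ?M {x<..} = emeasure disc ({z. x < (norm z)\<^sup>2} \<inter> ball 0 1)"
      by (subst emeasure_distr) (auto intro!: arg_cong2[where f = emeasure])
    also have "\<dots> = emeasure lborel ({z. x < (norm z)\<^sup>2} \<inter> ball (0::complex) 1)"
      unfolding disc_def by (subst emeasure_restrict_space) auto
    finally show ?thesis .
  qed
  have N: "emeasure ?N {x<..} = ennreal pi * emeasure lborel ({x<..} \<inter> {0<..<1})" for x
    by (subst emeasure_density)
       (auto simp: nn_integral_cmult mult.assoc indicator_inter_arith[symmetric] Int_commute)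
  have ball: "emeasure lborel (ball (0::complex) 1) = ennreal pi"
    by (simp add: emeasure_ball unit_ball_vol_2)
  have eq: "emeasure ?M {x<..} = emeasure ?N {x<..}" for x
  proof -
    consider "x < 0" | "0 \<le> x" "x < 1" | "x \<ge> 1" by linarith
    thus ?thesis
    proof cases
      case 1
      have "{z. x < (norm z)\<^sup>2} = (UNIV :: complex set)"
        using 1 by (auto intro: less_le_trans)
      moreover have "{x<..} \<inter> {0<..<1} = {0<..<1::real}" using 1 by auto
      ultimately show ?thesis using ball unfolding M N by simp
    next
      case 2
      have "{z. x < (norm z)\<^sup>2} \<inter> ball (0::complex) 1 = ball 0 1 - cball 0 (sqrt x)"
      proof (rule set_eqI)
        fix z :: complex
        have "norm z \<le> sqrt x \<longleftrightarrow> (norm z)\<^sup>2 \<le> x"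
          using real_sqrt_le_iff[of "(norm z)\<^sup>2" x] by simp
        thus "z \<in> {z. x < (norm z)\<^sup>2} \<inter> ball 0 1 \<longleftrightarrow> z \<in> ball 0 1 - cball 0 (sqrt x)"
          by (simp only: mem_Collect_eq Int_iff Diff_iff mem_cball_0 not_le[symmetric]) blast
      qed
      also have "emeasure lborel \<dots> = ennreal pi - ennreal (pi * x)"
      proof (subst emeasure_Diff)
        have "sqrt x < 1" using 2 by simp
        thus "cball (0::complex) (sqrt x) \<subseteq> ball 0 1"
          by (auto simp: subset_iff simp del: real_sqrt_lt_1_iff elim!: le_less_trans)
      qed (use 2 in \<open>auto simp: ball emeasure_cball unit_ball_vol_2\<close>)
      also have "\<dots> = ennreal (pi * (1 - x))"
        using 2 by (simp add: ennreal_minus right_diff_distrib)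
      finally have "emeasure ?M {x<..} = ennreal (pi * (1 - x))" using M by simp
      moreover have "{x<..} \<inter> {0<..<1} = {x<..<1::real}" using 2 by auto
      ultimately show ?thesis using 2 unfolding N by (simp add: ennreal_mult)
    next
      case 3
      have "norm z < 1 \<Longrightarrow> (norm z)\<^sup>2 < 1" for z :: complex
        by (simp add: power_less_one_iff abs_square_less_1)
      hence "{z. x < (norm z)\<^sup>2} \<inter> ball (0::complex) 1 = {}" using 3 by force
      moreover have "{x<..} \<inter> {0<..<1} = ({} :: real set)" using 3 by auto
      ultimately show ?thesis unfolding M N by simp
    qed
  qed
  show ?thesis
  proof (rule measure_eqI_lessThan)
    show "emeasure ?M {x<..} < \<infinity>" for x
    proof -
      have "emeasure ?M {x<..} \<le> emeasure lborel (ball (0::complex) 1)"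
        unfolding M by (intro emeasure_mono) auto
      also have "\<dots> < \<infinity>" by (simp add: ball)
      finally show ?thesis .
    qed
  qed (use eq in simp_all)
qed

lemma
  fixes h :: "real \<Rightarrow> real"
  assumes [measurable]: "h \<in> borel_measurable borel"
  shows integrable_disc_radial: 
      "integrable disc (\<lambda>z. h ((norm z)\<^sup>2)) \<longleftrightarrow> set_integrable lborel {0<..<1} h"
    and integral_disc_radial: 
      "integral\<^sup>L disc (\<lambda>z. h ((norm z)\<^sup>2)) = pi * set_lebesgue_integral lborel {0<..<1} h"
proof -
  have [measurable]: "(\<lambda>z. (norm z)\<^sup>2) \<in> borel_measurable disc"
    by (intro borel_measurable_discI) measurable
  have d: "ennreal pi * indicator {0<..<1::real} s = ennreal (pi * indicator {0<..<1} s)" for s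
    by (auto simp: indicator_def)
  have "integrable disc (\<lambda>z. h ((norm z)\<^sup>2)) \<longleftrightarrow> integrable (distr disc borel (\<lambda>z. (norm z)\<^sup>2)) h"
    by (subst integrable_distr_eq) auto
  also have "\<dots> \<longleftrightarrow> integrable lborel (\<lambda>s. pi * (indicator {0<..<1} s *\<^sub>R h s))"
    unfolding distr_disc_norm_power2 d
    by (subst integrable_density) (auto simp: mult.assoc)
  also have "\<dots> \<longleftrightarrow> set_integrable lborel {0<..<1} h"
    unfolding set_integrable_def integrable_mult_left_iff by simp
  finally show "integrable disc (\<lambda>z. h ((norm z)\<^sup>2)) \<longleftrightarrow> set_integrable lborel {0<..<1} h" .
  have "integral\<^sup>L disc (\<lambda>z. h ((norm z)\<^sup>2)) = integral\<^sup>L (distr disc borel (\<lambda>z. (norm z)\<^sup>2)) h"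
    by (subst integral_distr) auto
  also have "\<dots> = integral\<^sup>L lborel (\<lambda>s. pi * (indicator {0<..<1} s *\<^sub>R h s))"
    unfolding distr_disc_norm_power2 d
    by (subst integral_density) (auto simp: mult.assoc)
  also have "\<dots> = pi * set_lebesgue_integral lborel {0<..<1} h"
    unfolding set_lebesgue_integral_def Bochner_Integration.integral_mult_right_zero ..
  finally show "integral\<^sup>L disc (\<lambda>z. h ((norm z)\<^sup>2)) = pi * set_lebesgue_integral lborel {0<..<1} h" .
qed

lemma integral_disc_rotate:
  fixes F :: "complex \<Rightarrow> real"
  assumes F: "F \<in> borel_measurable borel" and c: "norm c = 1"
  shows "integral\<^sup>L disc (\<lambda>z. F (c * z)) = integral\<^sup>L disc F"
proof -
  have [simp]: "c \<noteq> 0" using c by auto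
  have img: "(*) c ` ball 0 1 = ball 0 1"
  proof (intro set_eqI iffI)
    fix z assume "z \<in> ball (0::complex) 1"
    hence "z / c \<in> ball 0 1" "z = c * (z / c)" using c by (auto simp: norm_divide)
    thus "z \<in> (*) c ` ball 0 1" by blast
  qed (auto simp: norm_mult c)
  have "set_lebesgue_integral lborel ((*) c ` ball 0 1) F =
    set_lebesgue_integral lborel (ball 0 1) (\<lambda>z. (norm (deriv ((*) c) z))\<^sup>2 * F (c * z))"
    by (rule set_integral_image_holomorphic) (auto intro!: holomorphic_intros F inj_onI)
  thus ?thesis unfolding img integral_disc by (simp add: c)
qed

text \<open>Rotation by the angle pi / (m - n) preserves the integral but changes the sign of the
  integrand, so the integral equals its own negative.\<close>

lemma integral_disc_monomials_orthogonal:
  fixes w :: "real \<Rightarrow> real"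
  assumes [measurable]: "w \<in> borel_measurable borel" and mn: "m \<noteq> n"
    and int: "integrable disc (\<lambda>z::complex. of_real (w ((norm z)\<^sup>2)) * z ^ m * cnj z ^ n)"
  shows "integral\<^sup>L disc (\<lambda>z::complex. of_real (w ((norm z)\<^sup>2)) * z ^ m * cnj z ^ n) = 0"
proof -
  let ?F = "\<lambda>z::complex. complex_of_real (w ((norm z)\<^sup>2)) * z ^ m * cnj z ^ n"
  define \<theta> where "\<theta> = pi / (real m - real n)"
  have "cis \<theta> ^ m * cnj (cis \<theta>) ^ n = cis (real m * \<theta> - real n * \<theta>)"
    by (simp only: cis_cnj Complex.DeMoivre cis_mult) (simp add: algebra_simps)
  also have "real m * \<theta> - real n * \<theta> = pi"
    using mn unfolding left_diff_distrib[symmetric] \<theta>_def by simp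
  finally have k: "cis \<theta> ^ m * cnj (cis \<theta>) ^ n = -1" by simp
  have F: "?F (cis \<theta> * z) = - ?F z" for z
  proof -
    have "?F (cis \<theta> * z) = (cis \<theta> ^ m * cnj (cis \<theta>) ^ n) * ?F z"
      by (simp add: norm_mult power_mult_distrib)
    thus ?thesis unfolding k by simp
  qed
  have Fm: "?F \<in> borel_measurable borel"
  proof (intro borel_measurable_times borel_measurable_power)
    show "(\<lambda>z::complex. complex_of_real (w ((norm z)\<^sup>2))) \<in> borel_measurable borel" by measurable
  qed (auto intro!: borel_measurable_continuous_onI continuous_intros)
  have *: "integral\<^sup>L disc G = 0"
    if "G \<in> borel_measurable borel" "\<And>z. G (cis \<theta> * z) = - G z" for G :: "complex \<Rightarrow> real"
    using integral_disc_rotate[OF that(1), of "cis \<theta>"] by (simp add: that(2))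
  have "integral\<^sup>L disc (\<lambda>z. Re (?F z)) = 0"
    by (rule *[OF measurable_compose[OF Fm]]) 
       (simp_all only: F uminus_complex.simps borel_measurable_Re)
  moreover have "integral\<^sup>L disc (\<lambda>z. Im (?F z)) = 0"
    by (rule *[OF measurable_compose[OF Fm]]) 
       (simp_all only: F uminus_complex.simps borel_measurable_Im)
  ultimately show ?thesis unfolding integral_Re[OF int] integral_Im[OF int]
    by (simp only: complex_eq_iff zero_complex.simps)
qed

text \<open>The weight lives on |z| <= \<rho> < 1, where the partial sums of both series are
  uniformly bounded. Dominated convergence then carries the identity over from polynomials, for
  which only the diagonal terms survive.\<close>

lemma disc_parseval:
  fixes w :: "real \<Rightarrow> real" and b c :: "nat \<Rightarrow> complex"
  assumes w[measurable]: "w \<in> borel_measurable borel"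
    and C: "\<And>s. \<bar>w s\<bar> \<le> C" and \<rho>: "0 \<le> \<rho>" "\<rho> < 1" and w0: "\<And>s. s > \<rho>\<^sup>2 \<Longrightarrow> w s = 0"
    and g: "\<And>z. norm z < 1 \<Longrightarrow> (\<lambda>n. b n * z ^ n) sums g z"
    and h: "\<And>z. norm z < 1 \<Longrightarrow> (\<lambda>n. c n * z ^ n) sums h z"
  shows "integrable disc (\<lambda>z. of_real (w ((norm z)\<^sup>2)) * g z * cnj (h z))"
    and "(\<lambda>n. b n * cnj (c n) * of_real (integral\<^sup>L disc (\<lambda>z. w ((norm z)\<^sup>2) * ((norm z)\<^sup>2) ^ n))) sums
      integral\<^sup>L disc (\<lambda>z. of_real (w ((norm z)\<^sup>2)) * g z * cnj (h z))"
proof -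
  interpret finite_measure disc by (rule finite_measure_disc)
  define G where "G N z = (\<Sum>n<N. b n * z ^ n)" for N z
  define H where "H N z = (\<Sum>n<N. c n * z ^ n)" for N z
  define W where "W = (\<lambda>z::complex. complex_of_real (w ((norm z)\<^sup>2)))"
  have bnd: "\<exists>B\<ge>0. \<forall>N z. norm z \<le> \<rho> \<longrightarrow> norm (\<Sum>n<N. b n * z ^ n) \<le> B"
    if "\<And>z. norm z < 1 \<Longrightarrow> (\<lambda>n. b n * z ^ n) sums g z" for b and g :: "complex \<Rightarrow> complex"
  proof -
    \<comment> \<open>Convergence at the intermediate point (1 + \<rho>) / 2 gives absolute
      convergence at \<rho>.\<close>
    have "norm ((1 + \<rho>) / 2 :: real) < 1" using \<rho> by simp
    hence "summable (\<lambda>n. b n * (of_real ((1 + \<rho>) / 2)) ^ n)"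
      by (intro sums_summable[OF that]) (simp only: norm_of_real real_norm_def)
    hence sm: "summable (\<lambda>n. norm (b n * of_real \<rho> ^ n))"
      by (rule powser_insidea) (use \<rho> in \<open>simp only: norm_of_real real_norm_def\<close>, simp)
    show ?thesis
    proof (intro exI[of _ "\<Sum>n. norm (b n * of_real \<rho> ^ n)"] conjI allI impI suminf_nonneg sm)
      fix N and z :: complex assume z: "norm z \<le> \<rho>"
      have "norm (\<Sum>n<N. b n * z ^ n) \<le> (\<Sum>n<N. norm (b n * of_real \<rho> ^ n))"
        using \<rho> z by (intro sum_norm_le) (auto simp: norm_mult norm_power intro!: mult_left_mono power_mono)
      also have "\<dots> \<le> (\<Sum>n. norm (b n * of_real \<rho> ^ n))"
        by (intro sum_le_suminf sm) auto
      finally show "norm (\<Sum>n<N. b n * z ^ n) \<le> (\<Sum>n. norm (b n * of_real \<rho> ^ n))" .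
    qed auto
  qed
  obtain B1 where B1: "B1 \<ge> 0" "\<And>N z. norm z \<le> \<rho> \<Longrightarrow> norm (G N z) \<le> B1"
    using bnd[OF g] unfolding G_def by blast
  obtain B2 where B2: "B2 \<ge> 0" "\<And>N z. norm z \<le> \<rho> \<Longrightarrow> norm (H N z) \<le> B2"
    using bnd[OF h] unfolding H_def by blast
  have C0: "C \<ge> 0" using C[of 0] by simp
  have wz: "w ((norm z)\<^sup>2) = 0" if "norm z > \<rho>" for z :: complex
    using that \<rho> by (intro w0 power_strict_mono) auto
  have Wm: "W \<in> borel_measurable disc"
    unfolding W_def by (rule borel_measurable_discI) measurable
  have Gm: "G N \<in> borel_measurable disc" and Hm: "H N \<in> borel_measurable disc" for N
    by (auto intro!: borel_measurable_disc_continuous continuous_intros simp: G_def H_def)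
  have gm: "g \<in> borel_measurable disc"
    by (rule borel_measurable_LIMSEQ_metric[OF Gm]) (use g in \<open>auto simp: sums_def G_def\<close>)
  have hm: "h \<in> borel_measurable disc"
    by (rule borel_measurable_LIMSEQ_metric[OF Hm]) (use h in \<open>auto simp: sums_def H_def\<close>)
  have cm: "cnj \<in> borel_measurable borel"
    by (intro borel_measurable_continuous_onI continuous_intros)
  have meas1: "(\<lambda>z. W z * g z * cnj (h z)) \<in> borel_measurable disc"
    using Wm gm measurable_compose[OF hm cm] by (intro borel_measurable_times)
  have meas2: "(\<lambda>z. W z * G N z * cnj (H N z)) \<in> borel_measurable disc" for N
    using Wm Gm measurable_compose[OF Hm cm] by (intro borel_measurable_times)
  have lim: "AE z in disc. (\<lambda>N. W z * G N z * cnj (H N z)) \<longlonglongrightarrow> W z * g z * cnj (h z)"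
    using g h by (intro AE_I2 tendsto_intros) (auto simp: G_def H_def sums_def)
  have bd: "AE z in disc. norm (W z * G N z * cnj (H N z)) \<le> C * B1 * B2" for N
  proof (rule AE_I2)
    fix z assume "z \<in> space disc"
    show "norm (W z * G N z * cnj (H N z)) \<le> C * B1 * B2"
    proof (cases "norm z \<le> \<rho>")
      case True
      thus ?thesis using C C0 B1 B2 by (auto simp: norm_mult W_def intro!: mult_mono)
    next
      case False
      thus ?thesis using wz[of z] C0 B1 B2 by (simp add: W_def)
    qed
  qed
  note dom = meas1 meas2 integrable_const[of "C * B1 * B2"] lim bd
  show "integrable disc (\<lambda>z. of_real (w ((norm z)\<^sup>2)) * g z * cnj (h z))"
    using integrable_dominated_convergence[OF dom] by (simp add: W_def)
  have intmn: "integrable disc (\<lambda>z. W z * z ^ m * cnj z ^ n)" for m n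
  proof (rule integrable_const_bound[where B = C])
    show "(\<lambda>z. W z * z ^ m * cnj z ^ n) \<in> borel_measurable disc"
      by (intro borel_measurable_times Wm borel_measurable_power borel_measurable_disc_continuous continuous_intros)
    show "AE z in disc. norm (W z * z ^ m * cnj z ^ n) \<le> C"
    proof (rule AE_I2)
      fix z assume "z \<in> space disc"
      hence "norm z ^ m * norm z ^ n \<le> 1 * 1" 
        by (intro mult_mono power_le_one) auto
      hence "\<bar>w ((norm z)\<^sup>2)\<bar> * (norm z ^ m * norm z ^ n) \<le> C * 1"
        using C C0 by (intro mult_mono) auto
      thus "norm (W z * z ^ m * cnj z ^ n) \<le> C"
        by (simp add: W_def norm_mult norm_power mult.assoc)
    qed
  qed
  have "integral\<^sup>L disc (\<lambda>z. W z * G N z * cnj (H N z)) = 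
     (\<Sum>n<N. b n * cnj (c n) * of_real (integral\<^sup>L disc (\<lambda>z. w ((norm z)\<^sup>2) * ((norm z)\<^sup>2) ^ n)))" for N
  proof -
    have "(\<lambda>z. W z * G N z * cnj (H N z)) = 
      (\<lambda>z. \<Sum>m<N. \<Sum>n<N. (b m * cnj (c n)) * (W z * z ^ m * cnj z ^ n))"
      by (simp add: G_def H_def sum_distrib_left sum_distrib_right mult_ac)
    hence "integral\<^sup>L disc (\<lambda>z. W z * G N z * cnj (H N z)) =
       (\<Sum>m<N. \<Sum>n<N. (b m * cnj (c n)) * integral\<^sup>L disc (\<lambda>z. W z * z ^ m * cnj z ^ n))"
      by (simp add: Bochner_Integration.integral_sum Bochner_Integration.integrable_sum intmn)
    also have "\<dots> = (\<Sum>m<N. \<Sum>n<N. if m = n then (b n * cnj (c n)) * integral\<^sup>L disc (\<lambda>z. W z * z ^ n * cnj z ^ n) else 0)"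
      using integral_disc_monomials_orthogonal[OF w] intmn unfolding W_def
      by (intro sum.cong refl) auto
    also have "\<dots> = (\<Sum>n<N. (b n * cnj (c n)) * integral\<^sup>L disc (\<lambda>z. W z * z ^ n * cnj z ^ n))"
      by simp
    also have "(\<lambda>n z. W z * z ^ n * cnj z ^ n) = (\<lambda>n z. of_real (w ((norm z)\<^sup>2) * ((norm z)\<^sup>2) ^ n))"
      by (intro ext) (simp add: W_def power_mult_distrib[symmetric] complex_norm_square[unfolded of_real_power] mult.assoc)
    finally show ?thesis unfolding integral_complex_of_real .
  qed
  moreover have "(\<lambda>N. integral\<^sup>L disc (\<lambda>z. W z * G N z * cnj (H N z))) \<longlonglongrightarrow> 
      integral\<^sup>L disc (\<lambda>z. W z * g z * cnj (h z))"
    by (rule integral_dominated_convergence[OF dom])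
  ultimately show "(\<lambda>n. b n * cnj (c n) * of_real (integral\<^sup>L disc (\<lambda>z. w ((norm z)\<^sup>2) * ((norm z)\<^sup>2) ^ n))) sums
      integral\<^sup>L disc (\<lambda>z. of_real (w ((norm z)\<^sup>2)) * g z * cnj (h z))"
    unfolding sums_def W_def by simp
qed

section \<open>Differentiation under the integral sign\<close>

lemma has_real_derivative_integral:
  fixes F F' :: "real \<Rightarrow> 'a \<Rightarrow> real"
  assumes t0: "a < t0" "t0 < b"
    and int: "\<And>t. a < t \<Longrightarrow> t < b \<Longrightarrow> integrable M (F t)"
    and meas: "F' t0 \<in> borel_measurable M"
    and der: "\<And>t z. a < t \<Longrightarrow> t < b \<Longrightarrow> z \<in> space M \<Longrightarrow> ((\<lambda>t. F t z) has_real_derivative F' t z) (at t)"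
    and w: "integrable M w" 
    and bound: "\<And>t z. a < t \<Longrightarrow> t < b \<Longrightarrow> z \<in> space M \<Longrightarrow> \<bar>F' t z\<bar> \<le> w z"
  shows "((\<lambda>t. integral\<^sup>L M (F t)) has_real_derivative integral\<^sup>L M (F' t0)) (at t0)"
    and "integrable M (F' t0)"
proof -
  show "integrable M (F' t0)"
    by (rule Bochner_Integration.integrable_bound[OF w meas])
       (use bound[OF t0] in \<open>force intro!: AE_I2\<close>)
  have "((\<lambda>t. (integral\<^sup>L M (F t) - integral\<^sup>L M (F t0)) / (t - t0)) \<longlongrightarrow> integral\<^sup>L M (F' t0)) (at t0)"
    unfolding tendsto_at_iff_sequentially comp_def
  proof (intro allI impI)
    fix X :: "nat \<Rightarrow> real"
    assume X0: "\<forall>i. X i \<in> UNIV - {t0}" and X: "X \<longlonglongrightarrow> t0"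
    \<comment> \<open>The first N terms may leave the interval on which the hypotheses hold; the
      limit ignores them.\<close>
    have "eventually (\<lambda>i. X i \<in> {a<..<b}) sequentially"
      using X t0 by (intro topological_tendstoD) auto
    then obtain N where N: "\<And>i. i \<ge> N \<Longrightarrow> a < X i \<and> X i < b"
      by (auto simp: eventually_sequentially)
    have eq: "(integral\<^sup>L M (F (X (i + N))) - integral\<^sup>L M (F t0)) / (X (i + N) - t0) = 
       integral\<^sup>L M (\<lambda>z. (F (X (i + N)) z - F t0 z) / (X (i + N) - t0))" for i
      using N[of "i + N"] t0 int by simp
    have "(\<lambda>i. integral\<^sup>L M (\<lambda>z. (F (X (i + N)) z - F t0 z) / (X (i + N) - t0))) \<longlonglongrightarrow> integral\<^sup>L M (F' t0)"
    proof (rule integral_dominated_convergence[where w = w])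
      show "(\<lambda>z. (F (X (i + N)) z - F t0 z) / (X (i + N) - t0)) \<in> borel_measurable M" for i
        using int[of "X (i + N)"] int[OF t0] N[of "i + N"] by (intro borel_measurable_divide borel_measurable_diff) auto
      show "AE z in M. (\<lambda>i. (F (X (i + N)) z - F t0 z) / (X (i + N) - t0)) \<longlonglongrightarrow> F' t0 z"
      proof (rule AE_I2)
        fix z assume "z \<in> space M"
        hence "((\<lambda>t. (F t z - F t0 z) / (t - t0)) \<longlongrightarrow> F' t0 z) (at t0)"
          using der[OF t0] by (simp add: has_field_derivative_iff)
        hence "(\<lambda>i. (F (X i) z - F t0 z) / (X i - t0)) \<longlonglongrightarrow> F' t0 z"
          using X0 X unfolding tendsto_at_iff_sequentially comp_def by blast
        thus "(\<lambda>i. (F (X (i + N)) z - F t0 z) / (X (i + N) - t0)) \<longlonglongrightarrow> F' t0 z"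
          by (rule LIMSEQ_ignore_initial_segment)
      qed
      show "AE z in M. norm ((F (X (i + N)) z - F t0 z) / (X (i + N) - t0)) \<le> w z" for i
      proof (rule AE_I2)
        fix z assume z: "z \<in> space M"
        have ne: "X (i + N) \<noteq> t0" using X0 by auto
        \<comment> \<open>By the mean value inequality in t, the bound on the derivative also
          dominates the difference quotients.\<close>
        have "norm (F (X (i + N)) z - F t0 z) \<le> w z * norm (X (i + N) - t0)"
        proof (rule field_differentiable_bound[of "{a<..<b}" "\<lambda>t. F t z" "\<lambda>t. F' t z"])
          show "((\<lambda>t. F t z) has_field_derivative F' t z) (at t within {a<..<b})" if "t \<in> {a<..<b}" for t
            using der that z by (auto intro: has_field_derivative_at_within)
        qed (use N[of "i + N"] t0 bound z in auto)
        thus "norm ((F (X (i + N)) z - F t0 z) / (X (i + N) - t0)) \<le> w z"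
          using ne by (simp add: norm_divide divide_simps)
      qed
    qed (use meas w in auto)
    hence "(\<lambda>i. (integral\<^sup>L M (F (X (i + N))) - integral\<^sup>L M (F t0)) / (X (i + N) - t0)) \<longlonglongrightarrow> integral\<^sup>L M (F' t0)"
      by (simp only: eq)
    thus "(\<lambda>i. (integral\<^sup>L M (F (X i)) - integral\<^sup>L M (F t0)) / (X i - t0)) \<longlonglongrightarrow> integral\<^sup>L M (F' t0)"
      by (rule LIMSEQ_offset)
  qed
  thus "((\<lambda>t. integral\<^sup>L M (F t)) has_real_derivative integral\<^sup>L M (F' t0)) (at t0)"
    by (simp add: has_field_derivative_iff)
qed

section \<open>Growth of solutions of the linear equation\<close>

text \<open>The mean value inequality on the ray from 0 to z, with \<open>B\<close> as majorant.
  Applied first to the derivative and then to the function, it handles a second order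
  equation.\<close>

lemma radial_growth_bound:
  fixes w w' :: "complex \<Rightarrow> complex" and B B' :: "real \<Rightarrow> real"
  assumes w: "\<And>z. norm z < 1 \<Longrightarrow> (w has_field_derivative w' z) (at z)"
    and B: "\<And>r. 0 \<le> r \<Longrightarrow> r < 1 \<Longrightarrow> (B has_real_derivative B' r) (at r)"
    and bound: "\<And>z. norm z < 1 \<Longrightarrow> norm (w' z) \<le> B' (norm z)"
    and z: "norm z < 1"
  shows "norm (w z - w 0) \<le> B (norm z) - B 0"
proof (cases "z = 0")
  case False
  define u where "u = sgn z"
  have u: "norm u = 1" using False by (simp add: u_def norm_sgn)
  have zu: "z = of_real (norm z) * u" using False by (simp add: u_def sgn_eq)
  have dw: "((\<lambda>r. w (of_real r * u)) has_vector_derivative w' (of_real r * u) * u) (at r)"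
    if "0 \<le> r" "r < 1" for r
  proof -
    have "norm (of_real r * u) < 1" using that u by (simp add: norm_mult)
    hence "(w has_field_derivative w' (of_real r * u)) (at (of_real r * u))" by (rule w)
    moreover have "((\<lambda>r. of_real r * u) has_vector_derivative u) (at r)"
      by (auto intro!: derivative_eq_intros)
    ultimately show ?thesis
      using field_vector_diff_chain_at[of "\<lambda>r. of_real r * u" u r w "w' (of_real r * u)"]
      by (simp add: comp_def mult.commute[of u])
  qed
  have "norm (w (of_real (norm z) * u) - w (of_real 0 * u)) \<le> B (norm z) - B 0"
  proof (rule differentiable_bound_general)
    show "continuous_on {0..norm z} (\<lambda>r. w (of_real r * u))"
      using z by (intro continuous_at_imp_continuous_on ballI has_vector_derivative_continuous[OF dw]) auto
    show "continuous_on {0..norm z} B"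
      using z by (intro continuous_at_imp_continuous_on ballI DERIV_isCont[OF B]) auto
    fix x assume x: "0 < x" "x < norm z"
    show "((\<lambda>r. w (of_real r * u)) has_vector_derivative w' (of_real x * u) * u) (at x)"
      using dw x z by simp
    show "(B has_vector_derivative B' x) (at x)"
      using B[of x] x z by (simp add: has_real_derivative_iff_has_vector_derivative)
    show "norm (w' (of_real x * u) * u) \<le> B' x"
      using bound[of "of_real x * u"] x z u by (simp add: norm_mult)
  qed (use False in auto)
  thus ?thesis using zu by simp
qed simp

text \<open>The weight \<open>(1 - r) powr -1/24\<close>; the exponent is chosen so that its twelfth power, the
  largest one occurring below, is still integrable over the disc.\<close>

definition wt :: "real \<Rightarrow> real" where "wt r = (1 - r) powr (- 1 / 24)"

lemma wt_ge_1: "0 \<le> r \<Longrightarrow> r < 1 \<Longrightarrow> 1 \<le> wt r"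
  unfolding wt_def using powr_mono2'[of "-1/24" "1 - r" 1] by simp

lemma wt_0 [simp]: "wt 0 = 1"
  by (simp add: wt_def)

text \<open>These are the first and second derivatives of \<open>wt\<close>; 25/576 is 1/24 *
  25/24.\<close>

definition wt1 :: "real \<Rightarrow> real" where "wt1 r = 1 / 24 * (1 - r) powr (- 25 / 24)"
definition wt2 :: "real \<Rightarrow> real" where "wt2 r = 25 / 576 * (1 - r) powr (- 49 / 24)"

lemma DERIV_powr_one_minus:
  assumes "r < 1"
  shows "((\<lambda>r. (1 - r) powr a) has_real_derivative (- a * (1 - r) powr (a - 1))) (at r)"
  using DERIV_fun_powr[of "\<lambda>r. 1 - r" "-1" r a] assms
  by (auto intro!: derivative_eq_intros)

lemma DERIV_wt: "r < 1 \<Longrightarrow> (wt has_real_derivative wt1 r) (at r)"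
  using DERIV_powr_one_minus[of r "-1/24"] by (simp add: wt_def[abs_def] wt1_def)

lemma DERIV_wt1: "r < 1 \<Longrightarrow> (wt1 has_real_derivative wt2 r) (at r)"
  using DERIV_cmult[OF DERIV_powr_one_minus[of r "-25/24"], of "1/24"]
  by (simp add: wt1_def[abs_def] wt2_def)

text \<open>An Euler equation for \<open>wt\<close>, with a potential of the same order as the bound
  on \<open>Q\<close>. Hence integrating \<open>Q\<close> times \<open>wt\<close> twice gives back
  at most a multiple of \<open>wt\<close>.\<close>

lemma wt2_eq: 
  assumes "r < 1"
  shows "wt2 r = 25 / 576 * wt r / (1 - r)\<^sup>2"
proof -
  have "(1 - r) powr (- 1 / 24 - 2) = (1 - r) powr (- 1 / 24) / (1 - r) powr 2"
    by (rule powr_diff)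
  thus ?thesis using assms by (simp add: wt2_def wt_def)
qed

lemma wt1_0: "0 \<le> wt1 0" by (simp add: wt1_def)

section \<open>Coefficients of the expansion in t\<close>

lemma primitive_ball:
  assumes "h holomorphic_on ball 0 1"
  obtains g where "\<And>z. norm z < 1 \<Longrightarrow> (g has_field_derivative h z) (at z)" "g 0 = (0 :: complex)"
proof -
  obtain g where g: "\<And>x. x \<in> ball 0 1 \<Longrightarrow> (g has_field_derivative h x) (at x within ball 0 1)"
    using holomorphic_convex_primitive'[OF convex_ball open_ball assms] by blast
  have "((\<lambda>z. g z - g 0) has_field_derivative h z) (at z)" if "norm z < 1" for z
  proof -
    have "(g has_field_derivative h z) (at z)"
      using g[of z] that at_within_open[of z "ball 0 1"] by simp
    from DERIV_diff[OF this DERIV_const[of "g 0"]] show ?thesis by simp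
  qed
  thus ?thesis by (intro that[of "\<lambda>z. g z - g 0"]) auto
qed

lemma holomorphic_on_ballI:
  "(\<And>z. norm z < 1 \<Longrightarrow> (g has_field_derivative g' z) (at z)) \<Longrightarrow> g holomorphic_on ball (0::complex) 1"
  by (meson holomorphic_on_open open_ball mem_ball_0)

text \<open>Comparing powers of t in w'' = -(t/2) Q w gives V_(k+1)'' = -(Q/2) V_k. The disc is
  convex, so two successive primitives exist, and both are chosen to vanish at 0.\<close>

lemma ode_coefficients_exist:
  fixes v0 v1 Q :: "complex \<Rightarrow> complex"
  assumes Q: "Q holomorphic_on ball 0 1"
    and V0: "\<And>z. norm z < 1 \<Longrightarrow> (v0 has_field_derivative v1 z) (at z)"
  obtains V V' :: "nat \<Rightarrow> complex \<Rightarrow> complex" where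
    "V 0 = v0" "V' 0 = v1"
    "\<And>k z. norm z < 1 \<Longrightarrow> (V k has_field_derivative V' k z) (at z)"
    "\<And>k z. norm z < 1 \<Longrightarrow> (V' (Suc k) has_field_derivative (- Q z / 2 * V k z)) (at z)"
    "\<And>k. V (Suc k) 0 = 0" "\<And>k. V' (Suc k) 0 = 0"
proof -
  \<comment> \<open>Dependent choice runs over pairs of a coefficient and its z-derivative;
    \<open>R\<close> is the passage from coefficient k to k + 1.\<close>
  define P where "P = (\<lambda>p :: (complex \<Rightarrow> complex) \<times> (complex \<Rightarrow> complex). 
     \<forall>z. norm z < 1 \<longrightarrow> (fst p has_field_derivative snd p z) (at z))"
  define R where "R = (\<lambda>(p :: (complex \<Rightarrow> complex) \<times> (complex \<Rightarrow> complex)) (q :: (complex \<Rightarrow> complex) \<times> (complex \<Rightarrow> complex)). 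
     (\<forall>z. norm z < 1 \<longrightarrow> (snd q has_field_derivative (- Q z / 2 * fst p z)) (at z)) \<and> fst q 0 = 0 \<and> snd q 0 = 0)"
  have "\<exists>f. \<forall>n. (P (f n) \<and> (n = 0 \<longrightarrow> f n = (v0, v1))) \<and> R (f n) (f (Suc n))"
  proof (rule dependent_nat_choice)
    show "\<exists>x. P x \<and> (0 = 0 \<longrightarrow> x = (v0, v1))" using V0 by (auto simp: P_def)
    fix x :: "(complex \<Rightarrow> complex) \<times> (complex \<Rightarrow> complex)" and n :: nat
    assume "P x \<and> (n = 0 \<longrightarrow> x = (v0, v1))"
    hence "fst x holomorphic_on ball 0 1" by (auto simp: P_def intro: holomorphic_on_ballI)
    hence "(\<lambda>z. - Q z / 2 * fst x z) holomorphic_on ball 0 1" by (intro holomorphic_intros Q) auto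
    from primitive_ball[OF this] obtain g' where 
      g': "\<And>z. norm z < 1 \<Longrightarrow> (g' has_field_derivative (- Q z / 2 * fst x z)) (at z)" "g' 0 = 0"
      by blast
    have "g' holomorphic_on ball 0 1" using g'(1) by (rule holomorphic_on_ballI)
    from primitive_ball[OF this] obtain g where 
      g: "\<And>z. norm z < 1 \<Longrightarrow> (g has_field_derivative g' z) (at z)" "g 0 = 0"
      by blast
    show "\<exists>y. (P y \<and> (Suc n = 0 \<longrightarrow> y = (v0, v1))) \<and> R x y"
      using g g' by (intro exI[of _ "(g, g')"]) (auto simp: P_def R_def)
  qed
  then obtain f where f: "\<And>n. P (f n)" "f 0 = (v0, v1)" "\<And>n. R (f n) (f (Suc n))" by auto
  show ?thesis
    by (rule that[of "\<lambda>n. fst (f n)" "\<lambda>n. snd (f n)"]) (use f in \<open>auto simp: P_def R_def\<close>)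
qed

text \<open>Induction on k: by \<open>wt2_eq\<close> a bound by \<open>wt\<close> on V_k becomes a
  bound by \<open>wt2\<close> on V_(k+1)'', and two radial integrations lead back to
  \<open>wt\<close>. The boundary terms at 0 have the favourable sign and are dropped.\<close>

lemma ode_coefficients_bound:
  fixes Q :: "complex \<Rightarrow> complex"
  assumes M: "M \<ge> 0" "\<And>z. norm z < 1 \<Longrightarrow> norm (Q z) \<le> M / (1 - norm z)\<^sup>2"
    and V: "\<And>k z. norm z < 1 \<Longrightarrow> (V k has_field_derivative V' k z) (at z)"
    and V': "\<And>k z. norm z < 1 \<Longrightarrow> (V' (Suc k) has_field_derivative (- Q z / 2 * V k z)) (at z)"
    and 0: "\<And>k. V (Suc k) 0 = 0" "\<And>k. V' (Suc k) 0 = 0"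
    and base: "\<And>z. norm z < 1 \<Longrightarrow> norm (V 0 z) \<le> 1"
    and z: "norm z < 1"
  shows "norm (V k z) \<le> (12 * M) ^ k * wt (norm z)"
    and "norm (V' (Suc k) z) \<le> (12 * M) ^ Suc k * wt1 (norm z)"
proof -
  define K where "K = 12 * M"
  have K: "K \<ge> 0" using M by (simp add: K_def)
  have step1: "norm (V' (Suc k) z) \<le> K ^ Suc k * wt1 (norm z)"
    if IH: "\<And>z. norm z < 1 \<Longrightarrow> norm (V k z) \<le> K ^ k * wt (norm z)" and z: "norm z < 1" for k z
  proof -
    have "norm (V' (Suc k) z - V' (Suc k) 0) \<le> K ^ Suc k * wt1 (norm z) - K ^ Suc k * wt1 0"
    proof (rule radial_growth_bound[OF V' _ _ z])
      show "((\<lambda>r. K ^ Suc k * wt1 r) has_real_derivative (K ^ Suc k * wt2 r)) (at r)" if "r < 1" for r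
        using DERIV_wt1[OF that] by (rule DERIV_cmult)
      fix z :: complex assume z: "norm z < 1"
      have "norm (- Q z / 2 * V k z) = norm (Q z) * norm (V k z) / 2" by (simp add: norm_mult)
      also have "\<dots> \<le> (M / (1 - norm z)\<^sup>2) * (K ^ k * wt (norm z)) / 2"
        using M(2)[OF z] IH[OF z] M(1) by (intro divide_right_mono mult_mono) auto
      also have "\<dots> \<le> K ^ Suc k * wt2 (norm z)"
      proof -
        define X where "X = K ^ k * M * (wt (norm z) / (1 - norm z)\<^sup>2)"
        have "(M / (1 - norm z)\<^sup>2) * (K ^ k * wt (norm z)) / 2 = 1/2 * X"
          by (simp add: X_def mult_ac)
        \<comment> \<open>Origin of the constant 12: K * 25/576 = M * 300/576 has to be at least
          M/2.\<close>
        also have "\<dots> \<le> 300/576 * X"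
          using K M by (intro mult_right_mono) (simp_all add: X_def wt_def)
        also have "\<dots> = K ^ Suc k * wt2 (norm z)"
          unfolding wt2_eq[OF z] by (simp add: K_def X_def)
        finally show ?thesis .
      qed
      finally show "norm (- Q z / 2 * V k z) \<le> K ^ Suc k * wt2 (norm z)" .
    qed auto
    moreover have "0 \<le> K ^ Suc k * wt1 0" using K wt1_0 by simp
    ultimately show ?thesis using 0 by simp
  qed
  have main: "norm (V k z) \<le> K ^ k * wt (norm z)" if "norm z < 1" for k z
    using that
  proof (induction k arbitrary: z)
    case 0
    thus ?case using base[of z] wt_ge_1[of "norm z"] by simp
  next
    case (Suc k)
    have "norm (V (Suc k) z - V (Suc k) 0) \<le> K ^ Suc k * wt (norm z) - K ^ Suc k * wt 0"
    proof (rule radial_growth_bound[OF V _ _ Suc.prems])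
      show "((\<lambda>r. K ^ Suc k * wt r) has_real_derivative (K ^ Suc k * wt1 r)) (at r)" if "r < 1" for r
        using DERIV_wt[OF that] by (rule DERIV_cmult)
    qed (use step1 Suc.IH in auto)
    moreover have "0 \<le> K ^ Suc k * wt 0" using K by simp
    ultimately show ?case using 0 by simp
  qed
  show "norm (V k z) \<le> (12 * M) ^ k * wt (norm z)" using main z by (simp add: K_def)
  show "norm (V' (Suc k) z) \<le> (12 * M) ^ Suc k * wt1 (norm z)" using step1 main z by (simp add: K_def)
qed

text \<open>At |t| <= 1/(8K) the series has ratio 1/8. The factors produced by one or two
  differentiations are at most 2^k and 2 * 4^k, so the ratio stays at most 1/2 and all three sums
  are bounded by twice their leading constant.\<close>

lemma geometric_power_series_bounds:
  fixes c :: "nat \<Rightarrow> complex"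
  assumes K: "K > 0" and c: "\<And>k. norm (c k) \<le> K ^ k * B" and t: "norm t \<le> 1 / (8 * K)"
  shows "summable (\<lambda>k. c k * t ^ k)"
    and "norm (\<Sum>k. c k * t ^ k) \<le> 2 * B"
    and "norm (\<Sum>k. diffs c k * t ^ k) \<le> 2 * K * B"
    and "norm (\<Sum>k. diffs (diffs c) k * t ^ k) \<le> 4 * K\<^sup>2 * B"
    and "((\<lambda>t. \<Sum>k. c k * t ^ k) has_field_derivative (\<Sum>k. diffs c k * t ^ k)) (at t)"
    and "((\<lambda>t. \<Sum>k. diffs c k * t ^ k) has_field_derivative (\<Sum>k. diffs (diffs c) k * t ^ k)) (at t)"
proof -
  have B: "B \<ge> 0" using order_trans[OF norm_ge_zero c[of 0]] by simp
  have sm: "summable (\<lambda>k. d k)" "norm (\<Sum>k. d k) \<le> 2 * C" if "\<And>k. norm (d k) \<le> C * (1/2) ^ k" 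
    for d :: "nat \<Rightarrow> complex" and C
  proof -
    have s: "(\<lambda>k. C * (1/2) ^ k) sums (C * 2)"
      using geometric_sums[of "1/2 :: real"] by (intro sums_mult) simp
    show "summable d" by (rule summable_comparison_test'[OF sums_summable[OF s]]) (use that in auto)
    show "norm (\<Sum>k. d k) \<le> 2 * C"
      using norm_suminf_le[OF that sums_summable[OF s]] s by (simp add: sums_iff)
  qed
  have tk: "norm t ^ k \<le> (1 / (8 * K)) ^ k" for k using t by (intro power_mono) auto
  have p1: "real (Suc k) \<le> 2 ^ k" for k by (induction k) auto
  have p2: "real (Suc k) * real (Suc (Suc k)) \<le> 2 * 4 ^ k" for k 
  proof -
    have "real (Suc k) * real (Suc (Suc k)) \<le> 2 ^ k * 2 ^ Suc k" by (intro mult_mono p1) auto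
    thus ?thesis by (simp add: power_mult_distrib[symmetric] mult.left_commute)
  qed
  have b0: "norm (c k * t ^ k) \<le> B * (1/2) ^ k" for k
  proof -
    have "norm (c k * t ^ k) \<le> (K ^ k * B) * (1 / (8 * K)) ^ k"
      using c[of k] tk[of k] K B by (simp only: norm_mult norm_power) (intro mult_mono; simp)
    also have "\<dots> = B * (1/8) ^ k" using K by (simp add: power_divide power_mult_distrib)
    also have "\<dots> \<le> B * (1/2) ^ k" using B by (intro mult_left_mono power_mono) auto
    finally show ?thesis .
  qed
  show "summable (\<lambda>k. c k * t ^ k)" "norm (\<Sum>k. c k * t ^ k) \<le> 2 * B" using sm[OF b0] by auto
  have b1: "norm (diffs c k * t ^ k) \<le> (K * B) * (1/2) ^ k" for k
  proof -
    have "norm (diffs c k * t ^ k) = real (Suc k) * norm (c (Suc k)) * norm t ^ k"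
      unfolding diffs_def norm_mult norm_power norm_of_nat ..
    also have "\<dots> \<le> 2 ^ k * (K ^ Suc k * B) * (1 / (8 * K)) ^ k"
      using c[of "Suc k"] tk[of k] K B p1[of k] by (intro mult_mono; simp)
    also have "\<dots> = (K * B) * (2 * K * (1 / (8 * K))) ^ k"
      by (simp only: power_mult_distrib power_Suc mult_ac)
    also have "\<dots> = (K * B) * (1/4) ^ k" using K by simp
    also have "\<dots> \<le> (K * B) * (1/2) ^ k" using B K by (intro mult_left_mono power_mono) auto
    finally show ?thesis .
  qed
  show "norm (\<Sum>k. diffs c k * t ^ k) \<le> 2 * K * B" using sm(2)[OF b1] by simp
  have b2: "norm (diffs (diffs c) k * t ^ k) \<le> (2 * K\<^sup>2 * B) * (1/2) ^ k" for k
  proof -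
    have "norm (diffs (diffs c) k * t ^ k) = (real (Suc k) * real (Suc (Suc k))) * norm (c (Suc (Suc k))) * norm t ^ k"
      unfolding diffs_def norm_mult norm_power norm_of_nat by (simp only: mult_ac)
    also have "\<dots> \<le> (2 * 4 ^ k) * (K ^ Suc (Suc k) * B) * (1 / (8 * K)) ^ k"
      using K B by (intro mult_mono[OF mult_mono[OF p2 c] tk]) auto
    also have "\<dots> = (2 * K\<^sup>2 * B) * (4 * K * (1 / (8 * K))) ^ k"
      by (simp only: power_mult_distrib power_Suc power2_eq_square mult_ac)
    also have "\<dots> = (2 * K\<^sup>2 * B) * (1/2) ^ k" using K by simp
    finally show ?thesis .
  qed
  show "norm (\<Sum>k. diffs (diffs c) k * t ^ k) \<le> 4 * K\<^sup>2 * B" using sm(2)[OF b2] by simp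
  \<comment> \<open>Termwise differentiation needs convergence strictly beyond t. The radii 1/(8K) <
    1/(4K) < 1/(2K) provide this once for each of the two derivatives.\<close>
  have s: "summable (\<lambda>k. c k * of_real (1 / (2 * K)) ^ k)"
  proof (rule sm(1)[of _ B])
    fix k
    have "norm (c k * of_real (1 / (2 * K)) ^ k) \<le> (K ^ k * B) * (1 / (2 * K)) ^ k"
      using c[of k] K B unfolding norm_mult norm_power norm_of_real by (intro mult_mono; simp)
    also have "\<dots> = B * (1/2) ^ k" using K by (simp add: power_divide power_mult_distrib)
    finally show "norm (c k * of_real (1 / (2 * K)) ^ k) \<le> B * (1/2) ^ k" .
  qed
  have s': "summable (\<lambda>k. diffs c k * of_real (1 / (4 * K)) ^ k)"
    by (rule termdiff_converges[where K = "1 / (2 * K)"]) 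
       (use K in \<open>auto intro!: powser_inside[OF s] simp: norm_divide norm_mult field_simps\<close>)
  have tlt: "norm t < norm (complex_of_real (1 / (4 * K)))" using t K by (simp add: field_simps norm_divide norm_mult)
  have tlt': "norm t < norm (complex_of_real (1 / (2 * K)))" using t K by (simp add: field_simps norm_divide norm_mult)
  show "((\<lambda>t. \<Sum>k. c k * t ^ k) has_field_derivative (\<Sum>k. diffs c k * t ^ k)) (at t)"
    by (rule termdiffs_strong[OF s tlt'])
  show "((\<lambda>t. \<Sum>k. diffs c k * t ^ k) has_field_derivative (\<Sum>k. diffs (diffs c) k * t ^ k)) (at t)"
    by (rule termdiffs_strong[OF s' tlt])
qed

lemma wt1_eq: 
  assumes "r < 1"
  shows "wt1 r = wt r / (24 * (1 - r))"
proof -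
  have "(1 - r) powr (- 1 / 24 - 1) = (1 - r) powr (- 1 / 24) / (1 - r) powr 1"
    by (rule powr_diff)
  thus ?thesis using assms by (simp add: wt1_def wt_def)
qed

text \<open>Termwise differentiation in z at fixed t. On a ball of radius \<rho> between |z| and 1
  the monotone majorant \<open>C\<close> is at most \<open>C \<rho>\<close>, so the series of
  derivatives passes the Weierstrass test with ratio 1/8.\<close>

lemma power_series_parameter_DERIV:
  fixes f f' :: "nat \<Rightarrow> complex \<Rightarrow> complex"
  assumes K: "K > 0" and t: "norm t \<le> 1 / (8 * K)"
    and f: "\<And>k z. norm z < 1 \<Longrightarrow> (f k has_field_derivative f' k z) (at z)"
    and f': "\<And>k z. norm z < 1 \<Longrightarrow> norm (f' k z) \<le> K ^ k * C (norm z)"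
    and C: "\<And>r s. 0 \<le> r \<Longrightarrow> r \<le> s \<Longrightarrow> s < 1 \<Longrightarrow> C r \<le> C s"
    and sm: "summable (\<lambda>k. f k 0 * t ^ k)"
    and z: "norm z < 1"
  shows "((\<lambda>z. \<Sum>k. f k z * t ^ k) has_field_derivative (\<Sum>k. f' k z * t ^ k)) (at z)"
proof -
  define \<rho> where "\<rho> = (1 + norm z) / 2"
  have \<rho>: "0 < \<rho>" "norm z < \<rho>" "\<rho> < 1" using z by (auto simp: \<rho>_def add_pos_nonneg)
  have "0 \<le> norm (f' 0 z)" by simp
  also have "\<dots> \<le> C \<rho>" using f'[OF z, of 0] C[of "norm z" \<rho>] \<rho> by auto
  finally have C0: "0 \<le> C \<rho>" .
  show ?thesis
  proof (rule has_field_derivative_series'(2)[of "ball 0 \<rho>" "\<lambda>k z. f k z * t ^ k" "\<lambda>k z. f' k z * t ^ k" 0])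
    show "((\<lambda>z. f k z * t ^ k) has_field_derivative f' k z * t ^ k) (at z within ball 0 \<rho>)"
      if "z \<in> ball 0 \<rho>" for k z
      using DERIV_cmult_right[OF has_field_derivative_at_within[OF f[of z k]]] that \<rho> by auto
    show "uniformly_convergent_on (ball 0 \<rho>) (\<lambda>n z. \<Sum>k<n. f' k z * t ^ k)"
    proof (rule Weierstrass_m_test'[where M = "\<lambda>k. C \<rho> * (1 / 8) ^ k"])
      show "summable (\<lambda>k. C \<rho> * (1 / 8) ^ k :: real)" by (intro summable_mult summable_geometric) auto
      show "norm (f' k z * t ^ k) \<le> C \<rho> * (1 / 8) ^ k" if z: "z \<in> ball 0 \<rho>" for k z
      proof -
        have "norm (f' k z * t ^ k) = norm (f' k z) * norm t ^ k" by (simp add: norm_mult norm_power)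
        also have "\<dots> \<le> (K ^ k * C \<rho>) * (1 / (8 * K)) ^ k"
        proof (intro mult_mono power_mono t)
          have "norm (f' k z) \<le> K ^ k * C (norm z)" using f'[of z k] z \<rho> by simp
          also have "\<dots> \<le> K ^ k * C \<rho>" using C[of "norm z" \<rho>] z \<rho> K by (intro mult_left_mono) auto
          finally show "norm (f' k z) \<le> K ^ k * C \<rho>" .
        qed (use K C0 in auto)
        also have "\<dots> = C \<rho> * (K * (1 / (8 * K))) ^ k" by (simp only: power_mult_distrib mult_ac)
        also have "\<dots> = C \<rho> * (1 / 8) ^ k" using K by simp
        finally show "norm (f' k z * t ^ k) \<le> C \<rho> * (1 / 8) ^ k" .
      qed
    qed
  qed (use \<rho> sm in auto)
qed

section \<open>Lower bound for solutions along radii\<close>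

lemma has_real_derivative_inner:
  fixes f g :: "real \<Rightarrow> 'a :: real_inner"
  assumes "(f has_vector_derivative f') (at r)" "(g has_vector_derivative g') (at r)"
  shows "((\<lambda>r. f r \<bullet> g r) has_real_derivative (f r \<bullet> g' + f' \<bullet> g r)) (at r)"
  using bounded_bilinear.has_vector_derivative[OF bounded_bilinear_inner assms]
  by (simp add: has_real_derivative_iff_has_vector_derivative)

text \<open>A differential inequality along the ray through z confines the decay rate of |v|. It is
  phrased with the squares \<open>x r \<bullet> x r\<close> and \<open>y r \<bullet> y r\<close>:
  they are differentiable everywhere, and no division by |v| occurs, whose nonvanishing is part of
  what is to be shown.\<close>

lemma ode_lower_bound:
  fixes v v' q :: "complex \<Rightarrow> complex"
  assumes v: "\<And>z. norm z < 1 \<Longrightarrow> (v has_field_derivative v' z) (at z)"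
    and v': "\<And>z. norm z < 1 \<Longrightarrow> (v' has_field_derivative (q z * v z)) (at z)"
    and q: "\<And>z. norm z < 1 \<Longrightarrow> norm (q z) \<le> 1 / (48 * (1 - norm z)\<^sup>2)"
    and init: "v 0 = 1" "v' 0 = 0"
    and z: "norm z < 1"
  shows "1 \<le> wt (norm z) * norm (v z)"
proof (cases "z = 0")
  case True
  thus ?thesis by (simp add: init)
next
  case False
  define u where "u = sgn z"
  have u: "norm u = 1" using False by (simp add: u_def norm_sgn)
  have zu: "z = of_real (norm z) * u" using False by (simp add: u_def sgn_eq)
  define x where "x r = v (of_real r * u)" for r
  define y where "y r = v' (of_real r * u) * u" for r
  define p where "p r = q (of_real r * u) * x r * u * u" for r
  have ray: "((\<lambda>r. of_real r * u) has_vector_derivative u) (at r)" for r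
    by (auto intro!: derivative_eq_intros)
  have nr: "norm (of_real r * u) = r" if "0 \<le> r" for r using that u by (simp add: norm_mult)
  have dx: "(x has_vector_derivative y r) (at r)" if r: "0 \<le> r" "r < 1" for r
    using field_vector_diff_chain_at[OF ray v[of "of_real r * u"]] r nr[OF r(1)]
    unfolding x_def[abs_def] y_def comp_def by (simp only: mult.commute[of u])
  have dy: "(y has_vector_derivative p r) (at r)" if r: "0 \<le> r" "r < 1" for r
  proof -
    have "((\<lambda>r. v' (of_real r * u)) has_vector_derivative (u * (q (of_real r * u) * v (of_real r * u)))) (at r)"
      using field_vector_diff_chain_at[OF ray v'[of "of_real r * u"]] r nr[OF r(1)] unfolding comp_def by simp
    hence "(y has_vector_derivative (u * (q (of_real r * u) * v (of_real r * u))) * u) (at r)"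
      unfolding y_def[abs_def] by (rule has_vector_derivative_mult_left)
    thus ?thesis by (simp add: p_def x_def mult_ac)
  qed
  note inner = has_real_derivative_inner
  \<comment> \<open>\<open>G\<close> is nondecreasing along the ray, which gives \<open>(1 - r) |v'| \<le> |v| / 24\<close>. Hence \<open>|v|\<close> decays
    no faster than \<open>1 / wt\<close>.\<close>
  define G where "G r = (x r \<bullet> x r) * inverse (1 - r) / 576 - (1 - r) * (y r \<bullet> y r)" for r
  define G' where "G' r = (2 * (x r \<bullet> y r) * inverse (1 - r) + (x r \<bullet> x r) * (inverse (1 - r))\<^sup>2) / 576
     + y r \<bullet> y r - 2 * (1 - r) * (y r \<bullet> p r)" for r
  have dG: "(G has_real_derivative G' r) (at r)" if r: "0 \<le> r" "r < 1" for r
  proof -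
    have "((\<lambda>r. inverse (1 - r)) has_real_derivative (inverse (1 - r))\<^sup>2) (at r)"
      using r by (auto intro!: derivative_eq_intros simp: power2_eq_square)
    from DERIV_diff[OF DERIV_cdivide[OF DERIV_mult[OF inner[OF dx[OF r] dx[OF r]] this], of 576]
        DERIV_mult[OF DERIV_diff[OF DERIV_const[of 1] DERIV_ident] inner[OF dy[OF r] dy[OF r]]]]
    show ?thesis
      unfolding G_def[abs_def] G'_def
      by (rule DERIV_cong) (simp add: inner_commute[of "y r" "x r"] inner_commute[of "p r" "y r"] algebra_simps)
  qed
  have key: "(1 - r)\<^sup>2 * (y r \<bullet> y r) \<le> (x r \<bullet> x r) / 576" if r: "0 \<le> r" "r < 1" for r
  proof -
    have "G 0 \<le> G r"
    proof (rule DERIV_nonneg_imp_nondecreasing[OF r(1)])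
      fix s assume s: "0 \<le> s" "s \<le> r"
      hence s1: "s < 1" using r by simp
      define X Y where "X = norm (x s)" and "Y = (1 - s) * norm (y s)"
      have XY: "X \<ge> 0" "Y \<ge> 0" using s1 by (auto simp: X_def Y_def)
      have p: "norm (p s) \<le> X / (48 * (1 - s)\<^sup>2)"
      proof -
        have "norm (q (of_real s * u)) * X \<le> 1 / (48 * (1 - s)\<^sup>2) * X"
          using q[of "of_real s * u"] nr[OF s(1)] s1 XY by (intro mult_right_mono) auto
        thus ?thesis using u by (simp add: p_def norm_mult X_def)
      qed
      have a1: "- (X * Y) \<le> (1 - s) * (x s \<bullet> y s)"
      proof -
        have "\<bar>x s \<bullet> y s\<bar> \<le> norm (x s) * norm (y s)" by (rule Cauchy_Schwarz_ineq2)
        hence "(1 - s) * \<bar>x s \<bullet> y s\<bar> \<le> (1 - s) * (norm (x s) * norm (y s))"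
          using s1 by (intro mult_left_mono) auto
        also have "\<dots> = X * Y" by (simp add: X_def Y_def)
        finally have "\<bar>(1 - s) * (x s \<bullet> y s)\<bar> \<le> X * Y" using s1 by (simp add: abs_mult)
        thus ?thesis by linarith
      qed
      have a2: "(1 - s) ^ 3 * (y s \<bullet> p s) \<le> X * Y / 48"
      proof -
        have "y s \<bullet> p s \<le> norm (y s) * norm (p s)" by (rule norm_cauchy_schwarz)
        also have "\<dots> \<le> norm (y s) * (X / (48 * (1 - s)\<^sup>2))" using p by (intro mult_left_mono) auto
        finally have "(1 - s) ^ 3 * (y s \<bullet> p s) \<le> (1 - s) ^ 3 * (norm (y s) * (X / (48 * (1 - s)\<^sup>2)))"
          using s1 by (intro mult_left_mono) auto
        also have "\<dots> = X * Y / 48"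
        proof -
          have "d ^ 3 * (n * (X / (48 * d\<^sup>2))) = X * (d * n) / 48" if "d \<noteq> 0" for d n :: real
            using that by (simp add: power3_eq_cube power2_eq_square)
          from this[of "1 - s"] show ?thesis using s1 by (simp add: Y_def)
        qed
        finally show ?thesis .
      qed
      have "(1 - s)\<^sup>2 * G' s = 2 * ((1 - s) * (x s \<bullet> y s)) / 576 + X\<^sup>2 / 576 + Y\<^sup>2 - 2 * ((1 - s) ^ 3 * (y s \<bullet> p s))"
      proof -
        have "(1 - s) * inverse (1 - s) = 1" using s1 by simp
        moreover have "(1 - s)\<^sup>2 * G' s = (2 * ((1 - s) * (x s \<bullet> y s)) * ((1 - s) * inverse (1 - s))
          + (x s \<bullet> x s) * ((1 - s) * inverse (1 - s))\<^sup>2) / 576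
          + (1 - s)\<^sup>2 * (y s \<bullet> y s) - 2 * ((1 - s) ^ 3 * (y s \<bullet> p s))"
        proof -
          have "d\<^sup>2 * ((2 * a * i + b * i\<^sup>2) / 576 + c - 2 * d * e) = 
            (2 * (d * a) * (d * i) + b * (d * i)\<^sup>2) / 576 + d\<^sup>2 * c - 2 * (d ^ 3 * e)" for a b c d e i :: real
            by (simp add: field_simps power2_eq_square power3_eq_cube)
          thus ?thesis unfolding G'_def .
        qed
        ultimately show ?thesis
          by (simp add: X_def Y_def power2_norm_eq_inner power_mult_distrib add_divide_distrib)
      qed
      also have "\<dots> \<ge> 2 * (- (X * Y)) / 576 + X\<^sup>2 / 576 + Y\<^sup>2 - 2 * (X * Y / 48)"
        using a1 a2 by linarith
      \<comment> \<open>The cross terms add up to -(26/576) X Y, while the square absorbs (48/576) X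
        Y. The bound 1/48 on (1 - |z|)^2 |q| thus leaves a surplus of 22/576.\<close>
      also have "2 * (- (X * Y)) / 576 + X\<^sup>2 / 576 + Y\<^sup>2 - 2 * (X * Y / 48) = (X / 24 - Y)\<^sup>2 + 22 / 576 * (X * Y)"
        by (simp add: power2_eq_square field_simps)
      also have "\<dots> \<ge> 0" using XY by simp
      finally have "0 \<le> (1 - s)\<^sup>2 * G' s" by simp
      hence "0 \<le> G' s" using s1 by (simp add: zero_le_mult_iff)
      thus "\<exists>y. (G has_real_derivative y) (at s) \<and> 0 \<le> y" using dG[OF s(1) s1] by blast
    qed
    moreover have "0 \<le> G 0" by (simp add: G_def y_def init)
    ultimately have "(1 - r) * (y r \<bullet> y r) \<le> (x r \<bullet> x r) * inverse (1 - r) / 576"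
      by (simp add: G_def)
    hence "(1 - r) * ((1 - r) * (y r \<bullet> y r)) \<le> (1 - r) * ((x r \<bullet> x r) * inverse (1 - r) / 576)"
      using r by (intro mult_left_mono) auto
    also have "\<dots> = (x r \<bullet> x r) / 576"
    proof -
      have "d * (b * inverse d / 576) = b / 576" if "d \<noteq> 0" for b d :: real
        using that by simp
      thus ?thesis using r by simp
    qed
    finally show ?thesis unfolding power2_eq_square mult.assoc .
  qed
  \<comment> \<open>The logarithmic derivative of \<open>wt\<close> is 1 / (24 (1 - r)), exactly the
    rate of decay that \<open>key\<close> allows for |v|; therefore \<open>L\<close> cannot
    decrease.\<close>
  define L where "L r = (x r \<bullet> x r) * (wt r)\<^sup>2" for r
  have r: "0 \<le> norm z" "norm z < 1" using z by auto
  have "L 0 \<le> L (norm z)"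
  proof (rule DERIV_nonneg_imp_nondecreasing[OF r(1)])
    fix s assume s: "0 \<le> s" "s \<le> norm z"
    hence s1: "s < 1" using z by simp
    have "((1 - s) * norm (y s))\<^sup>2 \<le> (norm (x s) / 24)\<^sup>2"
      using key[OF s(1) s1] by (simp add: power_mult_distrib power_divide power2_norm_eq_inner)
    hence "(1 - s) * norm (y s) \<le> norm (x s) / 24" by (rule power2_le_imp_le) simp
    hence "norm (x s) * ((1 - s) * norm (y s)) \<le> norm (x s) * (norm (x s) / 24)"
      by (intro mult_left_mono) auto
    hence a: "(1 - s) * (norm (x s) * norm (y s)) \<le> (x s \<bullet> x s) / 24"
      by (simp add: power2_norm_eq_inner[symmetric] power2_eq_square mult_ac)
    have "- (norm (x s) * norm (y s)) \<le> x s \<bullet> y s"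
      using Cauchy_Schwarz_ineq2[of "x s" "y s"] by linarith
    hence "(1 - s) * (- (norm (x s) * norm (y s))) \<le> (1 - s) * (x s \<bullet> y s)"
      using s1 by (intro mult_left_mono) auto
    with a have b: "0 \<le> (1 - s) * (x s \<bullet> y s) + (x s \<bullet> x s) / 24" by simp
    have "((x s \<bullet> y s) * 2) * (wt s)\<^sup>2 + (x s \<bullet> x s) * (2 * wt s * wt1 s) = 
       2 * (wt s)\<^sup>2 / (1 - s) * ((1 - s) * (x s \<bullet> y s) + (x s \<bullet> x s) / 24)"
    proof -
      have "(a * 2) * w\<^sup>2 + b * (2 * w * (w / (24 * d))) = 2 * w\<^sup>2 / d * (d * a + b / 24)"
        if "d \<noteq> 0" for a b d w :: real
        using that by (simp add: field_simps power2_eq_square)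
      moreover have "1 - s \<noteq> 0" using s1 by simp
      ultimately show ?thesis unfolding wt1_eq[OF s1] by blast
    qed
    also have "\<dots> \<ge> 0" using b s1 by (intro mult_nonneg_nonneg) auto
    finally have nn: "0 \<le> ((x s \<bullet> y s) * 2) * (wt s)\<^sup>2 + (x s \<bullet> x s) * (2 * wt s * wt1 s)" .
    have "(L has_real_derivative (((x s \<bullet> y s) * 2) * (wt s)\<^sup>2 + (x s \<bullet> x s) * (2 * wt s * wt1 s))) (at s)"
      unfolding L_def[abs_def]
      by (auto intro!: derivative_eq_intros inner[OF dx[OF s(1) s1] dx[OF s(1) s1]] DERIV_wt[OF s1]
          simp: inner_commute[of "y s" "x s"])
    thus "\<exists>y. (L has_real_derivative y) (at s) \<and> 0 \<le> y" using nn by blast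
  qed
  moreover have "L 0 = 1" by (simp add: L_def x_def init)
  moreover have "L (norm z) = (wt (norm z) * norm (v z))\<^sup>2"
    unfolding L_def x_def zu[symmetric] by (simp add: power2_norm_eq_inner power_mult_distrib)
  ultimately have "1\<^sup>2 \<le> (wt (norm z) * norm (v z))\<^sup>2" by simp
  thus ?thesis by (rule power2_le_imp_le) (simp add: wt_def)
qed

lemma
  assumes "0 \<le> r" "r \<le> s" "s < 1"
  shows wt1_mono: "wt1 r \<le> wt1 s" and wt2_mono: "wt2 r \<le> wt2 s"
  using assms by (auto simp: wt1_def wt2_def intro!: powr_mono2')

text \<open>To be used twice, with initial terms 1 (for v) and z (for u). Both are affine, hence
  solve w'' = 0, and are bounded by 1 on the disc together with their derivatives.\<close>

locale ode_series =
  fixes Q :: "complex \<Rightarrow> complex" and M :: real and V V' :: "nat \<Rightarrow> complex \<Rightarrow> complex"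
  assumes holQ: "Q holomorphic_on ball 0 1" and M_pos: "M > 0"
    and Q_bound: "\<And>z. norm z < 1 \<Longrightarrow> norm (Q z) \<le> M / (1 - norm z)\<^sup>2"
    and DERIV_V: "\<And>k z. norm z < 1 \<Longrightarrow> (V k has_field_derivative V' k z) (at z)"
    and DERIV_V': "\<And>k z. norm z < 1 \<Longrightarrow> (V' (Suc k) has_field_derivative (- Q z / 2 * V k z)) (at z)"
    and V_init: "\<And>k. V (Suc k) 0 = 0" "\<And>k. V' (Suc k) 0 = 0"
    and V_0: "\<And>z. norm z < 1 \<Longrightarrow> norm (V 0 z) \<le> 1"
    and DERIV_V'_0: "\<And>z. norm z < 1 \<Longrightarrow> (V' 0 has_field_derivative 0) (at z)"
    and V'_0: "\<And>z. norm z < 1 \<Longrightarrow> norm (V' 0 z) \<le> 1"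
begin

text \<open>A prime denotes the derivative in \<open>z\<close>, the suffixes 1 and 2 the derivatives in \<open>t\<close>.\<close>

definition "sol t z = (\<Sum>k. V k z * t ^ k)"
definition "sol' t z = (\<Sum>k. V' k z * t ^ k)"
definition "sol1 t z = (\<Sum>k. diffs (\<lambda>k. V k z) k * t ^ k)"
definition "sol2 t z = (\<Sum>k. diffs (diffs (\<lambda>k. V k z)) k * t ^ k)"

lemma V_bound: "norm z < 1 \<Longrightarrow> norm (V k z) \<le> (12 * M) ^ k * wt (norm z)"
  using M_pos by (intro ode_coefficients_bound(1)[OF _ Q_bound DERIV_V DERIV_V' V_init V_0]) auto

text \<open>The summand 1 accommodates k = 0, where \<open>V' 0\<close> may have modulus 1 while
  \<open>wt1 0\<close> is 1/24.\<close>

lemma V'_bound: 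
  assumes z: "norm z < 1"
  shows "norm (V' k z) \<le> (12 * M) ^ k * (1 + wt1 (norm z))"
proof (cases k)
  case 0
  thus ?thesis using V'_0[OF z] by (simp add: wt1_def add_increasing2)
next
  case (Suc j)
  have "norm (V' (Suc j) z) \<le> (12 * M) ^ Suc j * wt1 (norm z)"
    using M_pos z by (intro ode_coefficients_bound(2)[OF _ Q_bound DERIV_V DERIV_V' V_init V_0]) auto
  also have "\<dots> \<le> (12 * M) ^ Suc j * (1 + wt1 (norm z))"
    using M_pos by (intro mult_left_mono) auto
  finally show ?thesis by (simp only: Suc)
qed

text \<open>The radius 1/(96 M) is 1/(8 K) for the growth constant K = 12 M of the
  coefficients.\<close>

context
  fixes t :: complex
  assumes t: "norm t \<le> 1 / (96 * M)"
begin

lemma t_small: "norm t \<le> 1 / (8 * (12 * M))" using t by simp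

lemma K_pos: "12 * M > 0" using M_pos by simp

lemmas bounds = geometric_power_series_bounds[OF K_pos V_bound t_small]

lemma sol_bound: "norm z < 1 \<Longrightarrow> norm (sol t z) \<le> 2 * wt (norm z)"
  unfolding sol_def by (rule bounds)
lemma sol1_bound: "norm z < 1 \<Longrightarrow> norm (sol1 t z) \<le> 24 * M * wt (norm z)"
  using bounds(3)[of z] unfolding sol1_def by simp
lemma sol2_bound: "norm z < 1 \<Longrightarrow> norm (sol2 t z) \<le> 576 * M\<^sup>2 * wt (norm z)"
  using bounds(4)[of z] unfolding sol2_def by (simp add: power_mult_distrib)

lemma DERIV_sol_t: "norm z < 1 \<Longrightarrow> ((\<lambda>t. sol t z) has_field_derivative sol1 t z) (at t)"
  unfolding sol_def sol1_def by (rule bounds)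
lemma DERIV_sol1_t: "norm z < 1 \<Longrightarrow> ((\<lambda>t. sol1 t z) has_field_derivative sol2 t z) (at t)"
  unfolding sol2_def sol1_def by (rule bounds)

lemma summable_sol: "norm z < 1 \<Longrightarrow> summable (\<lambda>k. V k z * t ^ k)"
  by (rule bounds)
lemma summable_sol': "norm z < 1 \<Longrightarrow> summable (\<lambda>k. V' k z * t ^ k)"
  by (rule geometric_power_series_bounds(1)[OF K_pos V'_bound t_small])

lemma DERIV_sol: "norm z < 1 \<Longrightarrow> (sol t has_field_derivative sol' t z) (at z)"
  unfolding sol_def[abs_def] sol'_def
  by (rule power_series_parameter_DERIV[where C = "\<lambda>r. 1 + wt1 r", OF K_pos t_small DERIV_V V'_bound _ summable_sol])
     (auto intro: wt1_mono)

lemma DERIV_sol': 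
  assumes z: "norm z < 1"
  shows "(sol' t has_field_derivative (- t / 2 * Q z * sol t z)) (at z)"
proof -
  \<comment> \<open>\<open>W k\<close> is the second z-derivative of coefficient k. It involves
    coefficient k - 1, and this shift of index produces the factor t in the equation; for k = 0 it
    is 0.\<close>
  define W where "W k z = (case k of 0 \<Rightarrow> 0 | Suc j \<Rightarrow> - Q z / 2 * V j z)" for k z
  have "(sol' t has_field_derivative (\<Sum>k. W k z * t ^ k)) (at z)"
    unfolding sol'_def[abs_def]
  proof (rule power_series_parameter_DERIV[where C = wt2, OF K_pos t_small _ _ _ summable_sol' z])
    show "(V' k has_field_derivative W k z) (at z)" if "norm z < 1" for k z
      using DERIV_V'_0[OF that] DERIV_V'[OF that] by (cases k) (auto simp: W_def)
    show "norm (W k z) \<le> (12 * M) ^ k * wt2 (norm z)" if z: "norm z < 1" for k z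
    proof (cases k)
      case 0
      thus ?thesis by (simp add: W_def wt2_def)
    next
      case (Suc j)
      have "norm (W k z) = norm (Q z) * norm (V j z) / 2" by (simp add: W_def Suc norm_mult)
      also have "\<dots> \<le> (M / (1 - norm z)\<^sup>2) * ((12 * M) ^ j * wt (norm z)) / 2"
        using Q_bound[OF z] V_bound[OF z, of j] M_pos by (intro divide_right_mono mult_mono) auto
      also have "\<dots> = (12 * M) ^ k * (24 / 25 * wt2 (norm z))"
        unfolding wt2_eq[OF z] by (simp add: Suc mult_ac)
      also have "\<dots> \<le> (12 * M) ^ k * wt2 (norm z)"
        using M_pos by (intro mult_left_mono) (auto simp: wt2_def)
      finally show ?thesis .
    qed
  qed (auto intro: wt2_mono)
  moreover have "(\<lambda>j. - Q z / 2 * t * (V j z * t ^ j)) sums (- Q z / 2 * t * sol t z)"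
    unfolding sol_def by (intro sums_mult summable_sums summable_sol z)
  hence "(\<lambda>j. W (Suc j) z * t ^ Suc j) sums (- t / 2 * Q z * sol t z)"
    by (simp add: W_def mult_ac)
  hence "(\<lambda>k. W k z * t ^ k) sums (- t / 2 * Q z * sol t z)"
    by (subst (asm) sums_Suc_iff) (simp add: W_def)
  ultimately show ?thesis by (simp add: sums_iff)
qed

lemma sol_at_0: "sol t 0 = V 0 0"
proof -
  have "(\<lambda>k. V k 0 * t ^ k) = (\<lambda>k. if k = 0 then V 0 0 else 0)"
    by (rule ext) (metis V_init(1) mult_zero_left not0_implies_Suc power_0 mult.right_neutral)
  thus ?thesis using sums_single[of 0 "\<lambda>_. V 0 0"] by (simp add: sol_def sums_iff)
qed

lemma sol'_at_0: "sol' t 0 = V' 0 0"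
proof -
  have "(\<lambda>k. V' k 0 * t ^ k) = (\<lambda>k. if k = 0 then V' 0 0 else 0)"
    by (rule ext) (metis V_init(2) mult_zero_left not0_implies_Suc power_0 mult.right_neutral)
  thus ?thesis using sums_single[of 0 "\<lambda>_. V' 0 0"] by (simp add: sol'_def sums_iff)
qed

end

lemma sol_t0: "sol 0 z = V 0 z" "sol1 0 z = V 1 z" "sol2 0 z = 2 * V 2 z"
  unfolding sol_def sol1_def sol2_def by (simp_all add: powser_zero diffs_def numeral_2_eq_2)

text \<open>For these t the potential -(t/2) Q is at most a quarter of what
  \<open>ode_lower_bound\<close> admits.\<close>

lemma sol_lower_bound:
  assumes t: "norm t \<le> 1 / (96 * M)" and init: "V 0 0 = 1" "V' 0 0 = 0" and z: "norm z < 1"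
  shows "1 \<le> wt (norm z) * norm (sol t z)"
proof (rule ode_lower_bound[where q = "\<lambda>z. - t / 2 * Q z", OF DERIV_sol[OF t] DERIV_sol'[OF t] _ _ _ z])
  fix z :: complex assume z: "norm z < 1"
  have "norm (- t / 2 * Q z) = norm t / 2 * norm (Q z)" by (simp add: norm_mult)
  also have "\<dots> \<le> (1 / (96 * M)) / 2 * (M / (1 - norm z)\<^sup>2)"
    using t Q_bound[OF z] M_pos by (intro mult_mono divide_right_mono) auto
  also have "\<dots> = 1 / (192 * (1 - norm z)\<^sup>2)" using M_pos by simp
  also have "\<dots> \<le> 1 / (48 * (1 - norm z)\<^sup>2)" 
    using z by (intro divide_left_mono mult_right_mono mult_pos_pos) auto
  finally show "norm (- t / 2 * Q z) \<le> 1 / (48 * (1 - norm z)\<^sup>2)" .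
qed (use sol_at_0[OF t] sol'_at_0[OF t] init in auto)

end

section \<open>Solutions of the Schwarzian equation as quotients\<close>

lemma DERIV_zero_on_ball:
  fixes h :: "complex \<Rightarrow> complex"
  assumes "\<And>z. z \<in> ball c r \<Longrightarrow> (h has_field_derivative 0) (at z)" and "z \<in> ball c r"
  shows "h z = h c"
proof -
  have "\<exists>k. \<forall>z\<in>ball c r. h z = k"
    by (rule has_field_derivative_zero_constant) (use assms in \<open>auto intro: has_field_derivative_at_within\<close>)
  moreover have "c \<in> ball c r" using assms(2) by (metis centre_in_ball dist_self empty_iff ball_eq_empty not_le)
  ultimately show ?thesis using assms(2) by metis
qed

text \<open>The Schwarzian and the 2-jet at 0 determine f. Three first order steps show this: f''/f'
  = -2 v'/v, then f' = 1/v^2 = (u/v)', then f = u/v. A small ball is used because there f is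
  holomorphic with nonvanishing derivative.\<close>

lemma schwarzian_unique_local:
  fixes f u v u' v' \<phi> :: "complex \<Rightarrow> complex"
  assumes r: "r > 0"
    and u: "\<And>z. z \<in> ball 0 r \<Longrightarrow> (u has_field_derivative u' z) (at z)"
    and v: "\<And>z. z \<in> ball 0 r \<Longrightarrow> (v has_field_derivative v' z) (at z)"
    and u': "\<And>z. z \<in> ball 0 r \<Longrightarrow> (u' has_field_derivative (- \<phi> z / 2 * u z)) (at z)"
    and v': "\<And>z. z \<in> ball 0 r \<Longrightarrow> (v' has_field_derivative (- \<phi> z / 2 * v z)) (at z)"
    and init: "u 0 = 0" "u' 0 = 1" "v 0 = 1" "v' 0 = 0"
    and v_nz: "\<And>z. z \<in> ball 0 r \<Longrightarrow> v z \<noteq> 0"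
    and f: "f holomorphic_on ball 0 r" and f_nz: "\<And>z. z \<in> ball 0 r \<Longrightarrow> deriv f z \<noteq> 0"
    and S: "\<And>z. z \<in> ball 0 r \<Longrightarrow> schwarzian f z = \<phi> z"
    and f0: "f 0 = 0" "deriv f 0 = 1" "deriv (deriv f) 0 = 0"
    and z: "z \<in> ball 0 r"
  shows "f z = u z / v z"
proof -
  have [simp]: "0 \<in> ball 0 r" using r by simp
  have wronskian: "u' z * v z - u z * v' z = 1" if z: "z \<in> ball 0 r" for z
  proof -
    have "u' z * v z - u z * v' z = u' 0 * v 0 - u 0 * v' 0"
      by (rule DERIV_zero_on_ball[OF _ z, of "\<lambda>z. u' z * v z - u z * v' z"])
         (auto intro!: derivative_eq_intros u v u' v')
    thus ?thesis by (simp add: init)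
  qed
  have f1: "deriv f holomorphic_on ball 0 r" using f by (intro holomorphic_deriv) auto
  have f2: "deriv (deriv f) holomorphic_on ball 0 r" by (rule holomorphic_deriv[OF f1 open_ball])
  have df: "(f has_field_derivative deriv f z) (at z)" 
    and df1: "(deriv f has_field_derivative deriv (deriv f) z) (at z)"
    and df2: "(deriv (deriv f) has_field_derivative deriv (deriv (deriv f)) z) (at z)" 
    if "z \<in> ball 0 r" for z
    by (rule holomorphic_derivI[OF f open_ball that] holomorphic_derivI[OF f1 open_ball that]
        holomorphic_derivI[OF f2 open_ball that])+
  \<comment> \<open>\<open>f''/f'\<close> and \<open>g''/g'\<close> for \<open>g = u / v\<close> satisfy the same Riccati equation.\<close>
  define q where "q z = deriv (deriv f) z / deriv f z" for z
  define p where "p z = -2 * v' z / v z" for z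
  have dq: "(q has_field_derivative (\<phi> z + (q z)\<^sup>2 / 2)) (at z)" if z: "z \<in> ball 0 r" for z
  proof -
    have "\<phi> z = deriv (deriv (deriv f)) z / deriv f z - 3 / 2 * (q z)\<^sup>2"
      using S[OF z] by (simp add: schwarzian_def q_def numeral_3_eq_3 numeral_2_eq_2)
    hence eq: "\<phi> z + (q z)\<^sup>2 / 2 = (deriv (deriv (deriv f)) z * deriv f z - deriv (deriv f) z * deriv (deriv f) z) / (deriv f z * deriv f z)"
    proof -
      have "\<phi> z + (q z)\<^sup>2 / 2 = deriv (deriv (deriv f)) z / deriv f z - (q z)\<^sup>2"
        unfolding \<open>\<phi> z = _\<close> by simp
      thus ?thesis using f_nz[OF z] by (simp add: q_def field_simps power2_eq_square)
    qed
    show ?thesis unfolding q_def[abs_def] eq[unfolded q_def]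
      by (rule DERIV_divide[OF df2[OF z] df1[OF z] f_nz[OF z]])
  qed
  have dp: "(p has_field_derivative (\<phi> z + (p z)\<^sup>2 / 2)) (at z)" if z: "z \<in> ball 0 r" for z
  proof -
    have eq: "\<phi> z + (p z)\<^sup>2 / 2 = ((-2 * (- \<phi> z / 2 * v z)) * v z - (-2 * v' z) * v' z) / (v z * v z)"
      using v_nz[OF z] by (simp add: p_def field_simps power2_eq_square)
    show ?thesis unfolding p_def[abs_def] eq[unfolded p_def]
      by (rule DERIV_divide[OF DERIV_cmult[OF v'[OF z]] v[OF z] v_nz[OF z]])
  qed
  have hol: "q holomorphic_on ball 0 r" "p holomorphic_on ball 0 r"
    using dq dp by (meson holomorphic_on_open open_ball)+
  \<comment> \<open>Subtracting the two Riccati equations gives (q - p)' = (q - p) (q + p) / 2, a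
    linear equation with integrating factor \<open>exp (- P z)\<close>. As q - p vanishes at 0, it
    vanishes identically.\<close>
  have "(\<lambda>z. (q z + p z) / 2) holomorphic_on ball 0 r" by (intro holomorphic_intros hol) auto
  then obtain P where P: "\<And>z. z \<in> ball 0 r \<Longrightarrow> (P has_field_derivative (q z + p z) / 2) (at z within ball 0 r)"
    using holomorphic_convex_primitive'[OF convex_ball open_ball] by blast
  have P: "(P has_field_derivative (q z + p z) / 2) (at z)" if "z \<in> ball 0 r" for z
    using P[OF that] at_within_open[OF that] by simp
  have qp: "q z = p z" if z: "z \<in> ball 0 r" for z
  proof -
    have "(q z - p z) * exp (- P z) = (q 0 - p 0) * exp (- P 0)"
    proof (rule DERIV_zero_on_ball[OF _ z, of "\<lambda>z. (q z - p z) * exp (- P z)"])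
      fix z assume z: "z \<in> ball (0::complex) r"
      show "((\<lambda>z. (q z - p z) * exp (- P z)) has_field_derivative 0) (at z)"
        by (rule derivative_eq_intros dq[OF z] dp[OF z] P[OF z] refl)+ 
           (simp add: field_simps power2_eq_square)
    qed
    also have "\<dots> = 0" by (simp add: q_def p_def f0 init)
    finally show ?thesis by simp
  qed
  \<comment> \<open>The equality of \<open>q\<close> and \<open>p\<close> says that f' and v^(-2)
    have the same logarithmic derivative.\<close>
  have f1v: "deriv f z * (v z)\<^sup>2 = 1" if z: "z \<in> ball 0 r" for z
  proof -
    have "deriv f z * (v z)\<^sup>2 = deriv f 0 * (v 0)\<^sup>2"
    proof (rule DERIV_zero_on_ball[OF _ z, of "\<lambda>z. deriv f z * (v z)\<^sup>2"])
      fix z assume z: "z \<in> ball (0::complex) r"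
      have "deriv (deriv f) z * v z = - 2 * v' z * deriv f z"
        using qp[OF z] v_nz[OF z] f_nz[OF z] by (simp add: q_def p_def field_simps)
      hence *: "deriv (deriv f) z * (v z)\<^sup>2 = - 2 * v' z * deriv f z * v z" by (simp add: power2_eq_square mult.assoc[symmetric])
      show "((\<lambda>z. deriv f z * (v z)\<^sup>2) has_field_derivative 0) (at z)"
        by (rule derivative_eq_intros df1[OF z] v[OF z] refl)+ (simp add: *)
    qed
    thus ?thesis by (simp add: f0 init)
  qed
  have "f z - u z / v z = f 0 - u 0 / v 0"
  proof (rule DERIV_zero_on_ball[OF _ z, of "\<lambda>z. f z - u z / v z"])
    fix z assume z: "z \<in> ball (0::complex) r"
    have "((\<lambda>z. f z - u z / v z) has_field_derivative (deriv f z - (u' z * v z - u z * v' z) / (v z * v z))) (at z)"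
      by (intro DERIV_diff DERIV_divide df u v v_nz z)
    also have "deriv f z - (u' z * v z - u z * v' z) / (v z * v z) = 0"
      unfolding wronskian[OF z] using f1v[OF z] v_nz[OF z] by (simp add: field_simps power2_eq_square)
    finally show "((\<lambda>z. f z - u z / v z) has_field_derivative 0) (at z)" .
  qed
  thus ?thesis by (simp add: f0 init)
qed

text \<open>The identity theorem yields equality on a punctured neighbourhood of each point. This
  transfers the absence of poles from g to f, and a nicely meromorphic function is continuous where
  it has no pole, so the values agree as well.\<close>

lemma nicely_meromorphic_eq_holomorphic:
  assumes f: "f nicely_meromorphic_on A" and g: "g holomorphic_on A"
    and A: "open A" "connected A" "z0 \<in> A" and ev: "eventually (\<lambda>z. f z = g z) (at z0)"
    and z: "z \<in> A"
  shows "\<not> is_pole f z" "f z = g z"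
proof -
  have g': "g analytic_on A" using g A by (simp add: analytic_on_open)
  have "(\<lambda>z. f z - g z) meromorphic_on A"
    using f analytic_on_imp_meromorphic_on[OF g'] by (intro meromorphic_on_diff) (auto simp: nicely_meromorphic_on_def)
  from meromorphic_imp_constant_or_avoid[OF this A(1,2), of 0]
  have "\<forall>x\<in>A. eventually (\<lambda>z. f z - g z = 0) (at x)"
  proof
    assume "\<forall>\<^sub>\<approx>z\<in>A. f z - g z \<noteq> 0"
    hence "eventually (\<lambda>z. f z - g z \<noteq> 0) (at z0)" using A by (simp add: eventually_cosparse_open_eq)
    with ev have "eventually (\<lambda>z. False) (at z0)" by eventually_elim auto
    thus ?thesis by simp
  qed (use A in \<open>simp add: eventually_cosparse_open_eq\<close>)
  hence ev: "eventually (\<lambda>z. f z = g z) (at z)" using z by simp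
  have ga: "g analytic_on {z}" using g' z by (auto intro: analytic_on_subset)
  have "is_pole f z \<longleftrightarrow> is_pole g z" by (rule is_pole_cong) (use ev in auto)
  moreover have "\<not> is_pole g z" using ga by (rule analytic_at_imp_no_pole)
  ultimately show np: "\<not> is_pole f z" by simp
  with f z have "f \<midarrow>z\<rightarrow> f z" by (auto simp: nicely_meromorphic_on_def)
  hence "g \<midarrow>z\<rightarrow> f z" using tendsto_cong[OF ev] by simp
  moreover have "g \<midarrow>z\<rightarrow> g z" using ga by (intro isContD analytic_at_imp_isCont)
  ultimately show "f z = g z" by (rule LIM_unique)
qed

text \<open>Local uniqueness near 0 is propagated by the identity theorem. As v has no zero, the
  quotient is holomorphic, so f has no pole and the image avoids infinity.\<close>

lemma normalized_univalent_solution_eq_quotient: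
  fixes f u v u' v' \<phi> :: "complex \<Rightarrow> complex"
  assumes f: "normalized_univalent_solution \<phi> f"
    and u: "\<And>z. norm z < 1 \<Longrightarrow> (u has_field_derivative u' z) (at z)"
    and v: "\<And>z. norm z < 1 \<Longrightarrow> (v has_field_derivative v' z) (at z)"
    and u': "\<And>z. norm z < 1 \<Longrightarrow> (u' has_field_derivative (- \<phi> z / 2 * u z)) (at z)"
    and v': "\<And>z. norm z < 1 \<Longrightarrow> (v' has_field_derivative (- \<phi> z / 2 * v z)) (at z)"
    and init: "u 0 = 0" "u' 0 = 1" "v 0 = 1" "v' 0 = 0"
    and v_nz: "\<And>z. norm z < 1 \<Longrightarrow> v z \<noteq> 0"
    and z: "norm z < 1"
  shows "to_sphere f z = Some (u z / v z)"
proof -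
  have nm: "f nicely_meromorphic_on ball 0 1" and f0: "f 0 = 0" "\<not> is_pole f 0" "deriv f 0 = 1" "deriv (deriv f) 0 = 0"
    and S: "\<And>z. z \<in> ball 0 1 \<Longrightarrow> \<not> is_pole f z \<Longrightarrow> schwarzian f z = \<phi> z"
    using f by (auto simp: normalized_univalent_solution_def univalent_on_def to_sphere_def numeral_2_eq_2 split: if_splits)
  have "f analytic_on {0}" using nicely_meromorphic_on_imp_analytic_at[OF nm _ f0(2)] by simp
  then obtain s where s: "s > 0" "f holomorphic_on ball 0 s"
    by (auto simp: analytic_on_def)
  have "deriv f holomorphic_on ball 0 s" using s by (intro holomorphic_deriv) auto
  hence "continuous (at 0) (deriv f)"
    using s by (metis continuous_on_eq_continuous_at holomorphic_on_imp_continuous_on open_ball centre_in_ball)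
  from continuous_at_avoid[OF this, of 0] f0(3)
  obtain e where e: "e > 0" "\<And>z. z \<in> ball 0 e \<Longrightarrow> deriv f z \<noteq> 0"
    by auto
  define r where "r = min 1 (min s e)"
  have r: "r > 0" "r \<le> 1" "r \<le> s" "r \<le> e" using s e by (auto simp: r_def)
  have local: "f z = u z / v z" if z: "z \<in> ball 0 r" for z
  proof (rule schwarzian_unique_local[of r u u' v v' \<phi> f z])
    show "f holomorphic_on ball 0 r" using s(2) r by (rule_tac holomorphic_on_subset) auto
    show "schwarzian f z = \<phi> z" if z: "z \<in> ball 0 r" for z
    proof (rule S)
      have "f analytic_on ball 0 s" using s(2) by (simp add: analytic_on_open)
      hence "f analytic_on {z}" using z r by (rule_tac analytic_on_subset) auto
      thus "\<not> is_pole f z" by (rule analytic_at_imp_no_pole)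
    qed (use z r in auto)
  qed (use r z e f0 init u v u' v' v_nz in auto)
  have hol: "(\<lambda>z. u z / v z) holomorphic_on ball 0 1"
  proof (rule holomorphic_on_divide)
    show "u holomorphic_on ball 0 1" using u by (meson holomorphic_on_open open_ball mem_ball_0)
    show "v holomorphic_on ball 0 1" using v by (meson holomorphic_on_open open_ball mem_ball_0)
  qed (use v_nz in auto)
  have "eventually (\<lambda>z. z \<in> ball 0 r) (at 0)" using r by (intro eventually_at_in_open') auto
  hence "eventually (\<lambda>z. f z = u z / v z) (at 0)" by eventually_elim (rule local)
  from nicely_meromorphic_eq_holomorphic[OF nm hol open_ball _ _ this, of z] z
  show ?thesis by (simp add: to_sphere_def)
qed

text \<open>The equation w'' = -(\<phi>/2) w has no first order term, so the Wronskian u' v - u v'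
  keeps its value 1 at the origin.\<close>

lemma quotient_wronskian_deriv:
  fixes u v u' v' \<phi> :: "complex \<Rightarrow> complex"
  assumes u: "\<And>z. norm z < 1 \<Longrightarrow> (u has_field_derivative u' z) (at z)"
    and v: "\<And>z. norm z < 1 \<Longrightarrow> (v has_field_derivative v' z) (at z)"
    and u': "\<And>z. norm z < 1 \<Longrightarrow> (u' has_field_derivative (- \<phi> z / 2 * u z)) (at z)"
    and v': "\<And>z. norm z < 1 \<Longrightarrow> (v' has_field_derivative (- \<phi> z / 2 * v z)) (at z)"
    and init: "u 0 = 0" "u' 0 = 1" "v 0 = 1" "v' 0 = 0"
    and v_nz: "v z \<noteq> 0" and z: "norm z < 1"
  shows "((\<lambda>z. u z / v z) has_field_derivative 1 / (v z)\<^sup>2) (at z)"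
proof -
  have "z \<in> ball 0 1" using z by simp
  hence "u' z * v z - u z * v' z = u' 0 * v 0 - u 0 * v' 0"
    by (rule DERIV_zero_on_ball[rotated, of _ _ _ "\<lambda>z. u' z * v z - u z * v' z"])
       (auto intro!: derivative_eq_intros u v u' v')
  with DERIV_divide[OF u[OF z] v[OF z] v_nz] show ?thesis
    by (simp add: init power2_eq_square)
qed

section \<open>Power series and radial weights\<close>

lemma has_fps_expansion_of_sums:
  fixes q :: "nat \<Rightarrow> complex"
  assumes "\<And>z. norm z < 1 \<Longrightarrow> (\<lambda>n. q n * z ^ n) sums F z"
  shows "F has_fps_expansion Abs_fps q"
  unfolding has_fps_expansion_def
proof
  have "1 \<le> fps_conv_radius (Abs_fps q)"
    unfolding fps_conv_radius_def
  proof (rule conv_radius_geI_ex')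
    fix r :: real assume "0 < r" "ereal r < 1"
    thus "summable (\<lambda>n. fps_nth (Abs_fps q) n * of_real r ^ n)"
      using assms[of "of_real r"] by (simp add: sums_iff)
  qed
  thus "0 < fps_conv_radius (Abs_fps q)" using less_le_trans[of 0 "1::ereal"] by simp
  have "eventually (\<lambda>z. z \<in> ball (0::complex) 1) (nhds 0)" by (intro eventually_nhds_in_open) auto
  thus "eventually (\<lambda>z. eval_fps (Abs_fps q) z = F z) (nhds 0)"
    by eventually_elim (use assms in \<open>simp add: eval_fps_def sums_iff\<close>)
qed

lemma holomorphic_sums_disc:
  fixes F :: "complex \<Rightarrow> complex"
  assumes "F holomorphic_on ball 0 1"
  obtains c where "\<And>z. norm z < 1 \<Longrightarrow> (\<lambda>n. c n * z ^ n) sums F z" "c 0 = F 0" "c 1 = deriv F 0"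
  using holomorphic_power_series[OF assms] 
  by (intro that[of "\<lambda>n. (deriv ^^ n) F 0 / fact n"]) auto

text \<open>Two formal derivatives multiply the coefficient of z^n by n (n - 1), and power series
  expansions are unique.\<close>

lemma ode_step_coefficients:
  fixes v v' h q :: "_ \<Rightarrow> complex"
  assumes v: "\<And>z. norm z < 1 \<Longrightarrow> (v has_field_derivative v' z) (at z)"
    and v': "\<And>z. norm z < 1 \<Longrightarrow> (v' has_field_derivative h z) (at z)"
    and init: "v 0 = 0" "v' 0 = 0"
    and q: "\<And>z. norm z < 1 \<Longrightarrow> (\<lambda>n. q n * z ^ n) sums h z"
    and z: "norm z < 1"
  shows "(\<lambda>n. (if n < 2 then 0 else q (n - 2) / (of_nat n * (of_nat n - 1))) * z ^ n) sums v z"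
proof -
  have hol: "v holomorphic_on ball 0 1" using v by (meson holomorphic_on_open open_ball mem_ball_0)
  from holomorphic_sums_disc[OF hol] obtain c where 
    c: "\<And>z. norm z < 1 \<Longrightarrow> (\<lambda>n. c n * z ^ n) sums v z" "c 0 = v 0" "c 1 = deriv v 0" by blast
  have ev: "eventually (\<lambda>z. z \<in> ball (0::complex) 1) (nhds 0)" by (intro eventually_nhds_in_open) auto
  have "deriv v has_fps_expansion fps_deriv (Abs_fps c)"
    by (intro has_fps_expansion_deriv has_fps_expansion_of_sums c)
  moreover have "eventually (\<lambda>z. deriv v z = v' z) (nhds 0)"
    using ev by eventually_elim (use v in \<open>auto intro: DERIV_imp_deriv\<close>)
  ultimately have "v' has_fps_expansion fps_deriv (Abs_fps c)"
    using has_fps_expansion_cong by blast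
  hence "deriv v' has_fps_expansion fps_deriv (fps_deriv (Abs_fps c))"
    by (intro has_fps_expansion_deriv)
  moreover have "eventually (\<lambda>z. deriv v' z = h z) (nhds 0)"
    using ev by eventually_elim (use v' in \<open>auto intro: DERIV_imp_deriv\<close>)
  ultimately have "h has_fps_expansion fps_deriv (fps_deriv (Abs_fps c))"
    using has_fps_expansion_cong by blast
  moreover have "h has_fps_expansion Abs_fps q" by (rule has_fps_expansion_of_sums[OF q])
  ultimately have eq: "fps_deriv (fps_deriv (Abs_fps c)) = Abs_fps q" by (rule fps_expansion_unique_complex)
  have "q n = of_nat (Suc n) * (of_nat (Suc (Suc n)) * c (Suc (Suc n)))" for n
    using arg_cong[OF eq, of "\<lambda>F. fps_nth F n"] by simp
  hence "c (Suc (Suc n)) = q n / (of_nat (Suc (Suc n)) * (of_nat (Suc (Suc n)) - 1))" for n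
    by (simp add: field_simps del: of_nat_Suc) (simp add: algebra_simps)
  moreover have "c 0 = 0" "c (Suc 0) = 0" 
    using c(2,3) init DERIV_imp_deriv[OF v[of 0]] by auto
  ultimately have "c = (\<lambda>n. if n < 2 then 0 else q (n - 2) / (of_nat n * (of_nat n - 1)))"
  proof (intro ext)
    fix n
    assume c2: "\<And>n. c (Suc (Suc n)) = q n / (of_nat (Suc (Suc n)) * (of_nat (Suc (Suc n)) - 1))"
      and c01: "c 0 = 0" "c (Suc 0) = 0"
    consider "n = 0" | "n = Suc 0" | m where "n = Suc (Suc m)" by (metis not0_implies_Suc)
    thus "c n = (if n < 2 then 0 else q (n - 2) / (of_nat n * (of_nat n - 1)))"
      by cases (use c01 c2 in \<open>simp_all del: of_nat_Suc\<close>)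
  qed
  thus ?thesis using c(1)[OF z] by simp
qed

text \<open>Used to write U_1 and U_2 as z times a holomorphic function: then z \<bullet> (z w) =
  |z|^2 Re w separates a radial factor from the real part of a holomorphic one.\<close>

lemma sums_divide_by_z:
  fixes c :: "nat \<Rightarrow> complex"
  assumes c: "\<And>z. norm z < 1 \<Longrightarrow> (\<lambda>n. c n * z ^ n) sums F z" and "c 0 = 0"
  obtains g where "\<And>z. norm z < 1 \<Longrightarrow> (\<lambda>n. c (Suc n) * z ^ n) sums g z" "\<And>z. norm z < 1 \<Longrightarrow> F z = z * g z"
proof (rule that)
  define g where "g z = (if z = 0 then c 1 else F z / z)" for z
  fix z :: complex assume z: "norm z < 1"
  have *: "(\<lambda>n. c (Suc n) * z ^ Suc n) sums F z"
    using c[OF z] assms(2) by (subst sums_Suc_iff) simp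
  show "(\<lambda>n. c (Suc n) * z ^ n) sums g z"
  proof (cases "z = 0")
    case True
    thus ?thesis using powser_sums_zero[of "\<lambda>n. c (Suc n)"] by (simp add: g_def)
  next
    case False
    from sums_divide[OF *, of z] show ?thesis using False by (simp add: g_def)
  qed
  show "F z = z * g z"
    using c[of 0] powser_sums_zero[of c] assms(2) by (auto simp: g_def sums_iff)
qed

text \<open>The mean value property, obtained as Parseval's identity against the constant function 1
  with coefficients \<open>d\<close>: only the constant term H(0) = 0 could contribute.\<close>

lemma integral_disc_radial_holomorphic:
  fixes w :: "real \<Rightarrow> real" and H :: "complex \<Rightarrow> complex"
  assumes w: "w \<in> borel_measurable borel"
    and C: "\<And>s. \<bar>w s\<bar> \<le> C" and \<rho>: "0 \<le> \<rho>" "\<rho> < 1" and w0: "\<And>s. s > \<rho>\<^sup>2 \<Longrightarrow> w s = 0"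
    and H: "H holomorphic_on ball 0 1" "H 0 = 0"
  shows "integrable disc (\<lambda>z. w ((norm z)\<^sup>2) * Re (H z))"
    and "integral\<^sup>L disc (\<lambda>z. w ((norm z)\<^sup>2) * Re (H z)) = 0"
proof -
  from holomorphic_sums_disc[OF H(1)] obtain c where 
    c: "\<And>z. norm z < 1 \<Longrightarrow> (\<lambda>n. c n * z ^ n) sums H z" "c 0 = H 0" by blast
  define d where "d n = (if n = 0 then 1 else 0 :: complex)" for n :: nat
  have d: "(\<lambda>n. d n * z ^ n) sums 1" for z
  proof -
    have "(\<lambda>n. d n * z ^ n) = (\<lambda>n. if n = 0 then 1 else 0)" by (auto simp: d_def)
    thus ?thesis using sums_single[of 0 "\<lambda>_. 1::complex"] by simp
  qed
  note pars = disc_parseval[OF w C \<rho> w0 c(1) d]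
  have int: "integrable disc (\<lambda>z. of_real (w ((norm z)\<^sup>2)) * H z)"
    using pars(1) by simp
  have "(\<lambda>n. c n * cnj (d n) * of_real (integral\<^sup>L disc (\<lambda>z. w ((norm z)\<^sup>2) * ((norm z)\<^sup>2) ^ n))) = (\<lambda>n. 0)"
    using c(2) H(2) by (auto simp: d_def)
  hence I: "integral\<^sup>L disc (\<lambda>z. of_real (w ((norm z)\<^sup>2)) * H z) = 0"
    using pars(2) by (simp add: sums_iff)
  show "integrable disc (\<lambda>z. w ((norm z)\<^sup>2) * Re (H z))"
    using integrable_Re[OF int] by simp
  show "integral\<^sup>L disc (\<lambda>z. w ((norm z)\<^sup>2) * Re (H z)) = 0"
    using integral_Re[OF int] I by simp
qed

lemma integral_disc_radial_FTC:
  fixes F f :: "real \<Rightarrow> real"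
  assumes r: "0 \<le> r" "r < 1" 
    and F: "\<And>s. 0 \<le> s \<Longrightarrow> s \<le> r \<Longrightarrow> (F has_real_derivative f s) (at s)"
    and f: "continuous_on {0..r} f"
  shows "integral\<^sup>L disc (\<lambda>z. indicator {0..r} ((norm z)\<^sup>2) * f ((norm z)\<^sup>2)) = pi * (F r - F 0)"
proof -
  have m: "(\<lambda>s. indicator {0..r} s * f s) \<in> borel_measurable borel"
    using borel_measurable_continuous_on_indicator[OF _ f] by simp
  have "integral\<^sup>L disc (\<lambda>z. indicator {0..r} ((norm z)\<^sup>2) * f ((norm z)\<^sup>2)) =
      pi * set_lebesgue_integral lborel {0<..<1} (\<lambda>s. indicator {0..r} s * f s)"
    by (rule integral_disc_radial[OF m])
  also have "set_lebesgue_integral lborel {0<..<1} (\<lambda>s. indicator {0..r} s * f s) =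
      integral\<^sup>L lborel (\<lambda>s. indicator {0..r} s *\<^sub>R f s)"
    unfolding set_lebesgue_integral_def
  proof (rule integral_cong_AE)
    \<comment> \<open>The two sides differ at most at s = 0.\<close>
    show "AE s in lborel. indicator {0<..<1} s *\<^sub>R (indicator {0..r} s * f s) = indicator {0..r} s *\<^sub>R f s"
      using AE_lborel_singleton[of 0] by eventually_elim (use r in \<open>auto simp: indicator_def\<close>)
  qed (use m in auto)
  also have "\<dots> = F r - F 0"
    by (rule integral_FTC_atLeastAtMost[OF r(1) _ f])
       (use F in \<open>auto simp: has_real_derivative_iff_has_vector_derivative intro: has_vector_derivative_at_within\<close>)
  finally show ?thesis .
qed

text \<open>Each partial sum of \<open>b n * L n\<close> is a limit of partial sums bounded by
  \<open>T k\<close>, hence at most \<open>D\<close>; this already gives summability. The reverse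
  inequality uses \<open>G n k \<le> L n\<close>. Monotonicity in k is replaced by this
  bound.\<close>

lemma sums_from_limits:
  fixes b L :: "nat \<Rightarrow> real" and G :: "nat \<Rightarrow> nat \<Rightarrow> real"
  assumes b: "\<And>n. 0 \<le> b n" and G: "\<And>n k. 0 \<le> G n k" "\<And>n k. G n k \<le> L n"
    and lim: "\<And>n. (\<lambda>k. G n k) \<longlonglongrightarrow> L n"
    and T: "\<And>k. (\<lambda>n. b n * G n k) sums T k" "T \<longlonglongrightarrow> D"
  shows "(\<lambda>n. b n * L n) sums D"
proof -
  have L: "0 \<le> L n" for n using G(1)[of n 0] G(2)[of n 0] by linarith
  have part: "(\<Sum>n<N. b n * L n) \<le> D" for N
  proof (rule LIMSEQ_le[OF _ T(2)])
    show "(\<lambda>k. \<Sum>n<N. b n * G n k) \<longlonglongrightarrow> (\<Sum>n<N. b n * L n)"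
      by (intro tendsto_intros lim)
    show "\<exists>N'. \<forall>k\<ge>N'. (\<Sum>n<N. b n * G n k) \<le> T k"
    proof (intro exI allI impI)
      fix k
      have "(\<Sum>n<N. b n * G n k) \<le> (\<Sum>n. b n * G n k)"
        by (intro sum_le_suminf sums_summable[OF T(1)] mult_nonneg_nonneg b G) auto
      thus "(\<Sum>n<N. b n * G n k) \<le> T k" using sums_unique[OF T(1)] by simp
    qed
  qed
  have sm: "summable (\<lambda>n. b n * L n)"
    by (rule summableI_nonneg_bounded[OF mult_nonneg_nonneg[OF b L] part])
  have "T k \<le> (\<Sum>n. b n * L n)" for k
    unfolding sums_unique[OF T(1)]
    by (intro suminf_le sums_summable[OF T(1)] sm mult_left_mono G b)
  hence "D \<le> (\<Sum>n. b n * L n)" by (intro LIMSEQ_le_const2[OF T(2)]) auto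
  moreover have "(\<Sum>n. b n * L n) \<le> D" by (rule suminf_le_const[OF sm part])
  ultimately show ?thesis using sm by (simp add: sums_iff)
qed

text \<open>The primitive, vanishing at 0, of the density in \<open>s = |z|\<^sup>2\<close> that multiplies \<open>\<pi> |a n|\<^sup>2\<close> in
  the second variation of the area.\<close>

definition area_weight :: "nat \<Rightarrow> real \<Rightarrow> real" where
  "area_weight n s = 8 * s ^ Suc n * ((real n + 1) + (real n - 1) * s) / (1 + s) ^ 3"

text \<open>The quotient rule leaves a common factor (1 + s)^2, which cancels. The remaining
  quadratic in s is the one that the weights of |V_1|^2, |U_1|^2 and their mixed product produce in
  \<open>truncated_second_variation\<close>.\<close>

lemma DERIV_area_weight:
  assumes "s \<ge> 0"
  shows "(area_weight n has_real_derivative 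
    8 * ((real n + 1)\<^sup>2 + (2 * (real n)\<^sup>2 - 4) * s + (real n - 1)\<^sup>2 * s\<^sup>2) / (1 + s) ^ 4 * s ^ n) (at s)"
proof -
  define m where "m = real n"
  have s: "1 + s \<noteq> 0" using assms by simp
  have "(area_weight n has_real_derivative 
     ((8 * (real (Suc n) * s ^ n) * ((m + 1) + (m - 1) * s) + 8 * s ^ Suc n * (m - 1)) * (1 + s) ^ 3 
       - (8 * s ^ Suc n * ((m + 1) + (m - 1) * s)) * (3 * (1 + s)\<^sup>2)) / ((1 + s) ^ 3 * (1 + s) ^ 3)) (at s)"
    unfolding area_weight_def[abs_def] m_def
    by (rule derivative_eq_intros refl | use s in simp)+
  also have "((8 * (real (Suc n) * s ^ n) * ((m + 1) + (m - 1) * s) + 8 * s ^ Suc n * (m - 1)) * (1 + s) ^ 3 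
       - (8 * s ^ Suc n * ((m + 1) + (m - 1) * s)) * (3 * (1 + s)\<^sup>2)) / ((1 + s) ^ 3 * (1 + s) ^ 3)
     = 8 * s ^ n * ((1 + s)\<^sup>2 * (((m + 1) * ((m + 1) + (m - 1) * s) + s * (m - 1)) * (1 + s) 
       - 3 * s * ((m + 1) + (m - 1) * s))) / ((1 + s)\<^sup>2 * (1 + s) ^ 4)"
  proof -
    have "(1 + s) ^ 3 * (1 + s) ^ 3 = (1 + s)\<^sup>2 * (1 + s) ^ 4"
      by (simp flip: power_add)
    moreover have "real (Suc n) = m + 1" by (simp add: m_def)
    ultimately show ?thesis by (simp add: power3_eq_cube power2_eq_square algebra_simps)
  qed
  also have "\<dots> = 8 * s ^ n * (((m + 1) * ((m + 1) + (m - 1) * s) + s * (m - 1)) * (1 + s) 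
       - 3 * s * ((m + 1) + (m - 1) * s)) / (1 + s) ^ 4"
  proof -
    have "k * (d * X) / (d * e) = k * X / e" if "d \<noteq> 0" for k d X e :: real
      using that by simp
    thus ?thesis using s by (metis power_eq_0_iff)
  qed
  also have "((m + 1) * ((m + 1) + (m - 1) * s) + s * (m - 1)) * (1 + s) - 3 * s * ((m + 1) + (m - 1) * s)
     = (m + 1)\<^sup>2 + (2 * m\<^sup>2 - 4) * s + (m - 1)\<^sup>2 * s\<^sup>2"
    by (simp add: power2_eq_square algebra_simps)
  finally show ?thesis by (simp add: m_def mult_ac)
qed

text \<open>The upper bound is the value at s = 1, as \<open>sums_from_limits\<close> needs. It
  follows from 2 s <= 1 + s, cubed, together with s^(n+1) <= s^3, which is where n >= 2
  enters.\<close>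

lemma area_weight_bounds:
  assumes s: "0 \<le> s" "s \<le> 1" and n: "n \<ge> 2"
  shows "0 \<le> area_weight n s" "area_weight n s \<le> 2 * real n"
proof -
  show "0 \<le> area_weight n s" using s n by (simp add: area_weight_def)
  have "(2 * s) ^ 3 \<le> (1 + s) ^ 3" using s by (intro power_mono) auto
  hence "8 * s ^ 3 \<le> (1 + s) ^ 3" by (simp add: power_mult_distrib)
  moreover have "s ^ Suc n \<le> s ^ 3" using s n by (intro power_decreasing) auto
  ultimately have "8 * s ^ Suc n \<le> (1 + s) ^ 3" by linarith
  moreover have "(real n + 1) + (real n - 1) * s \<le> 2 * real n"
  proof -
    have "(real n - 1) * s \<le> (real n - 1) * 1" using s n by (intro mult_left_mono) auto
    moreover have "real n + 1 + p \<le> 2 * real n" if "p \<le> (real n - 1) * 1" for p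
      using that by simp
    ultimately show ?thesis by blast
  qed
  ultimately have "8 * s ^ Suc n * ((real n + 1) + (real n - 1) * s) \<le> (1 + s) ^ 3 * (2 * real n)"
    using s n by (intro mult_mono) auto
  thus "area_weight n s \<le> 2 * real n" using s by (simp add: area_weight_def divide_le_eq mult.commute)
qed

section \<open>The area as a function of the parameter\<close>

text \<open>The twelfth power is (1 - r)^(-1/2). Since 1 - r^2 <= 2 (1 - r), it is at most sqrt 2 /
  sqrt (1 - s) with s = r^2, and 1 / sqrt (1 - s) has the primitive -2 sqrt (1 - s), continuous up
  to s = 1.\<close>

lemma integrable_wt: "integrable disc (\<lambda>z. wt (norm z) ^ 12)"
proof -
  interpret finite_measure disc by (rule finite_measure_disc)
  have "set_integrable lborel (einterval (ereal 0) (ereal 1)) (\<lambda>s. 1 / sqrt (1 - s))"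
  proof (rule interval_integral_FTC_nonneg)
    show "((\<lambda>s. - 2 * sqrt (1 - s)) has_real_derivative (1 / sqrt (1 - x))) (at x)" if "ereal x < ereal 1" for x
      using that by (auto intro!: derivative_eq_intros simp: divide_simps)
    show "isCont (\<lambda>s. 1 / sqrt (1 - s)) x" if "ereal x < ereal 1" for x
      using that by (intro continuous_intros) auto
    have c: "isCont (\<lambda>s. - 2 * sqrt (1 - s)) x" for x by (intro continuous_intros)
    show "(((\<lambda>s. - 2 * sqrt (1 - s)) \<circ> real_of_ereal) \<longlongrightarrow> - 2 * sqrt (1 - 0)) (at_right (ereal 0))"
      unfolding ereal_tendsto_simps1(2) using c[of 0] by (simp add: isCont_def filterlim_at_split)
    show "(((\<lambda>s. - 2 * sqrt (1 - s)) \<circ> real_of_ereal) \<longlongrightarrow> - 2 * sqrt (1 - 1)) (at_left (ereal 1))"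
      unfolding ereal_tendsto_simps1(1) using c[of 1] by (simp add: isCont_def filterlim_at_split)
  qed auto
  hence "integrable disc (\<lambda>z. 1 / sqrt (1 - (norm z)\<^sup>2))"
    by (subst integrable_disc_radial) (auto simp: einterval_eq)
  hence "integrable disc (\<lambda>z. sqrt 2 * (1 / sqrt (1 - (norm z)\<^sup>2)))"
    by (rule integrable_mult_right)
  thus ?thesis
  proof (rule Bochner_Integration.integrable_bound)
    show "(\<lambda>z. wt (norm z) ^ 12) \<in> borel_measurable disc"
      unfolding wt_def by (intro borel_measurable_discI) measurable
    show "AE z in disc. norm (wt (norm z) ^ 12) \<le> norm (sqrt 2 * (1 / sqrt (1 - (norm z)\<^sup>2)))"
    proof (rule AE_I2)
      fix z assume "z \<in> space disc"
      define r where "r = norm z"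
      have r: "0 \<le> r" "r < 1" using \<open>z \<in> space disc\<close> by (auto simp: r_def)
      have "wt r ^ 12 = (1 - r) powr (- (1 / 2))"
        using r by (simp add: wt_def powr_power)
      also have "\<dots> = 1 / sqrt (1 - r)"
        using r by (simp only: powr_minus_divide) (simp add: powr_half_sqrt)
      also have "\<dots> = sqrt 2 / sqrt (2 * (1 - r))"
        by (simp only: real_sqrt_mult) simp
      also have "\<dots> \<le> sqrt 2 / sqrt (1 - r\<^sup>2)"
      proof (intro divide_left_mono real_sqrt_le_mono mult_pos_pos)
        have "0 \<le> (1 - r)\<^sup>2" by simp
        thus "1 - r\<^sup>2 \<le> 2 * (1 - r)" by (simp add: power2_eq_square algebra_simps)
        show "0 < sqrt (1 - r\<^sup>2)" using r by (simp add: power_less_one_iff abs_square_less_1)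
      qed (use r in auto)
      finally have "wt r ^ 12 \<le> sqrt 2 / sqrt (1 - r\<^sup>2)" .
      moreover have "0 \<le> wt r ^ 12" by (simp add: wt_def)
      moreover have "0 \<le> sqrt (1 - r\<^sup>2)" using r by (simp add: power_le_one)
      ultimately show "norm (wt (norm z) ^ 12) \<le> norm (sqrt 2 * (1 / sqrt (1 - (norm z)\<^sup>2)))"
        by (simp add: r_def)
    qed
  qed
qed

locale schwarzian_pair = v: ode_series Q M V V' + u: ode_series Q M U U'
  for Q :: "complex \<Rightarrow> complex" and M :: real and V V' U U' :: "nat \<Rightarrow> complex \<Rightarrow> complex" +
  assumes init: "V 0 = (\<lambda>_. 1)" "V' 0 = (\<lambda>_. 0)" "U 0 = (\<lambda>z. z)" "U' 0 = (\<lambda>_. 1)"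
begin

text \<open>\<open>N0\<close> is |v|^2 + |u|^2 for real t, and \<open>I0\<close> is the spherical
  density pulled back by u/v. The digit counts derivatives in t.\<close>

definition "N0 t z = v.sol (of_real t) z \<bullet> v.sol (of_real t) z + u.sol (of_real t) z \<bullet> u.sol (of_real t) z"
definition "N1 t z = 2 * (v.sol (of_real t) z \<bullet> v.sol1 (of_real t) z + u.sol (of_real t) z \<bullet> u.sol1 (of_real t) z)"
definition "N2 t z = 2 * (v.sol1 (of_real t) z \<bullet> v.sol1 (of_real t) z + v.sol (of_real t) z \<bullet> v.sol2 (of_real t) z
   + u.sol1 (of_real t) z \<bullet> u.sol1 (of_real t) z + u.sol (of_real t) z \<bullet> u.sol2 (of_real t) z)"
definition "I0 t z = 4 / (N0 t z)\<^sup>2"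
definition "I1 t z = - 8 * N1 t z / (N0 t z) ^ 3"
definition "I2 t z = - 8 * N2 t z / (N0 t z) ^ 3 + 24 * (N1 t z)\<^sup>2 / (N0 t z) ^ 4"

lemma measurable_series:
  "(\<lambda>z. v.sol t z) \<in> borel_measurable disc" "(\<lambda>z. v.sol1 t z) \<in> borel_measurable disc"
  "(\<lambda>z. v.sol2 t z) \<in> borel_measurable disc" "(\<lambda>z. u.sol t z) \<in> borel_measurable disc"
  "(\<lambda>z. u.sol1 t z) \<in> borel_measurable disc" "(\<lambda>z. u.sol2 t z) \<in> borel_measurable disc"
proof -
  have [measurable]: "(\<lambda>z. V k z) \<in> borel_measurable disc" "(\<lambda>z. U k z) \<in> borel_measurable disc" for k
    using v.DERIV_V[of _ k] u.DERIV_V[of _ k]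
    by (auto intro!: borel_measurable_disc_continuous continuous_at_imp_continuous_on DERIV_isCont)
  show "(\<lambda>z. v.sol t z) \<in> borel_measurable disc" "(\<lambda>z. v.sol1 t z) \<in> borel_measurable disc"
    "(\<lambda>z. v.sol2 t z) \<in> borel_measurable disc" "(\<lambda>z. u.sol t z) \<in> borel_measurable disc"
    "(\<lambda>z. u.sol1 t z) \<in> borel_measurable disc" "(\<lambda>z. u.sol2 t z) \<in> borel_measurable disc"
    unfolding v.sol_def v.sol1_def v.sol2_def u.sol_def u.sol1_def u.sol2_def diffs_def
    by measurable
qed

lemma measurable_I:
  "I0 t \<in> borel_measurable disc" "I1 t \<in> borel_measurable disc" "I2 t \<in> borel_measurable disc"
proof -
  note [measurable] = measurable_series
  have [measurable]: "N0 t \<in> borel_measurable disc" "N1 t \<in> borel_measurable disc" "N2 t \<in> borel_measurable disc"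
    unfolding N0_def[abs_def] N1_def[abs_def] N2_def[abs_def] by measurable
  show "I0 t \<in> borel_measurable disc" "I1 t \<in> borel_measurable disc" "I2 t \<in> borel_measurable disc"
    unfolding I0_def[abs_def] I1_def[abs_def] I2_def[abs_def] by measurable
qed

context
  fixes t :: real
  assumes t: "\<bar>t\<bar> < 1 / (96 * M)"
begin

lemma norm_t: "norm (complex_of_real t) \<le> 1 / (96 * M)" using t by simp

lemma N0_lower:
  assumes z: "norm z < 1"
  shows "1 \<le> (wt (norm z))\<^sup>2 * N0 t z"
proof -
  have "1 \<le> wt (norm z) * norm (v.sol (of_real t) z)"
    by (rule v.sol_lower_bound[OF norm_t]) (use init z in auto)
  hence "1\<^sup>2 \<le> (wt (norm z) * norm (v.sol (of_real t) z))\<^sup>2" by (intro power_mono) auto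
  also have "\<dots> = (wt (norm z))\<^sup>2 * (v.sol (of_real t) z \<bullet> v.sol (of_real t) z)"
    by (simp add: power_mult_distrib power2_norm_eq_inner)
  also have "\<dots> \<le> (wt (norm z))\<^sup>2 * N0 t z"
    by (intro mult_left_mono) (auto simp: N0_def)
  finally show ?thesis by simp
qed

lemma N0_pos: "norm z < 1 \<Longrightarrow> 0 < N0 t z"
  using N0_lower[of z] by (smt (verit) mult_nonneg_nonpos zero_le_power2)

lemma DERIV_N0: "norm z < 1 \<Longrightarrow> ((\<lambda>t. N0 t z) has_real_derivative N1 t z) (at t)"
  unfolding N0_def[abs_def] N1_def
  by (rule DERIV_cong[OF DERIV_add[OF 
      has_real_derivative_inner[OF has_vector_derivative_real_field[OF v.DERIV_sol_t[OF norm_t]]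
                                   has_vector_derivative_real_field[OF v.DERIV_sol_t[OF norm_t]]]
      has_real_derivative_inner[OF has_vector_derivative_real_field[OF u.DERIV_sol_t[OF norm_t]]
                                   has_vector_derivative_real_field[OF u.DERIV_sol_t[OF norm_t]]]]])
     (auto simp: inner_commute)

lemma DERIV_N1: "norm z < 1 \<Longrightarrow> ((\<lambda>t. N1 t z) has_real_derivative N2 t z) (at t)"
  unfolding N1_def[abs_def] N2_def
  by (rule DERIV_cong[OF DERIV_cmult[OF DERIV_add[OF 
      has_real_derivative_inner[OF has_vector_derivative_real_field[OF v.DERIV_sol_t[OF norm_t]]
                                   has_vector_derivative_real_field[OF v.DERIV_sol1_t[OF norm_t]]]
      has_real_derivative_inner[OF has_vector_derivative_real_field[OF u.DERIV_sol_t[OF norm_t]]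
                                   has_vector_derivative_real_field[OF u.DERIV_sol1_t[OF norm_t]]]]]])
     (auto simp: inner_commute)

lemma DERIV_I0: 
  assumes z: "norm z < 1"
  shows "((\<lambda>t. I0 t z) has_real_derivative I1 t z) (at t)"
  unfolding I0_def[abs_def] I1_def using N0_pos[OF z]
  by (auto intro!: derivative_eq_intros DERIV_N0[OF z] simp: divide_simps power2_eq_square power3_eq_cube)

lemma DERIV_I1: 
  assumes z: "norm z < 1"
  shows "((\<lambda>t. I1 t z) has_real_derivative I2 t z) (at t)"
proof -
  have nz: "N0 t z \<noteq> 0" using N0_pos[OF z] by simp
  have "((\<lambda>t. I1 t z) has_real_derivative ((- 8 * N2 t z) * N0 t z ^ 3 - (- 8 * N1 t z) * (3 * N0 t z ^ 2 * N1 t z)) / (N0 t z ^ 3 * N0 t z ^ 3)) (at t)"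
    unfolding I1_def[abs_def]
    by (rule derivative_eq_intros DERIV_N0[OF z] DERIV_N1[OF z] refl | use nz in simp)+
  also have "((- 8 * N2 t z) * N0 t z ^ 3 - (- 8 * N1 t z) * (3 * N0 t z ^ 2 * N1 t z)) / (N0 t z ^ 3 * N0 t z ^ 3) = I2 t z"
    unfolding I2_def using nz by (simp add: field_simps power2_eq_square power3_eq_cube power4_eq_xxxx)
  finally show ?thesis .
qed

lemma inner_bound:
  fixes x y :: complex
  assumes "norm x \<le> a * w" "norm y \<le> b * w"
  shows "\<bar>x \<bullet> y\<bar> \<le> a * b * w\<^sup>2"
proof -
  have "\<bar>x \<bullet> y\<bar> \<le> norm x * norm y" by (rule Cauchy_Schwarz_ineq2)
  also have "\<dots> \<le> (a * w) * (b * w)"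
    using assms order_trans[OF norm_ge_zero assms(1)] by (intro mult_mono) auto
  finally show ?thesis by (simp add: power2_eq_square mult_ac)
qed

lemma N1_bound:
  assumes z: "norm z < 1"
  shows "\<bar>N1 t z\<bar> \<le> 192 * M * (wt (norm z))\<^sup>2"
proof -
  have "\<bar>2 * (a + b)\<bar> \<le> 4 * A" if "\<bar>a\<bar> \<le> A" "\<bar>b\<bar> \<le> A" for a b A :: real
    using that by (simp add: abs_le_iff)
  from this[OF inner_bound[OF v.sol_bound[OF norm_t z] v.sol1_bound[OF norm_t z]]
    inner_bound[OF u.sol_bound[OF norm_t z] u.sol1_bound[OF norm_t z]]]
  show ?thesis by (simp add: N1_def)
qed

lemma N2_bound:
  assumes z: "norm z < 1"
  shows "\<bar>N2 t z\<bar> \<le> 6912 * M\<^sup>2 * (wt (norm z))\<^sup>2"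
proof -
  define X where "X = M\<^sup>2 * (wt (norm z))\<^sup>2"
  have "\<bar>v.sol1 (of_real t) z \<bullet> v.sol1 (of_real t) z\<bar> \<le> 576 * X" "\<bar>u.sol1 (of_real t) z \<bullet> u.sol1 (of_real t) z\<bar> \<le> 576 * X"
    "\<bar>v.sol (of_real t) z \<bullet> v.sol2 (of_real t) z\<bar> \<le> 1152 * X" "\<bar>u.sol (of_real t) z \<bullet> u.sol2 (of_real t) z\<bar> \<le> 1152 * X"
    using inner_bound[OF v.sol1_bound[OF norm_t z] v.sol1_bound[OF norm_t z]]
      inner_bound[OF u.sol1_bound[OF norm_t z] u.sol1_bound[OF norm_t z]]
      inner_bound[OF v.sol_bound[OF norm_t z] v.sol2_bound[OF norm_t z]]
      inner_bound[OF u.sol_bound[OF norm_t z] u.sol2_bound[OF norm_t z]]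
    by (simp_all add: X_def power2_eq_square mult_ac)
  moreover have "\<bar>2 * (a + c + b + d)\<bar> \<le> 6912 * X"
    if "\<bar>a\<bar> \<le> 576 * X" "\<bar>b\<bar> \<le> 576 * X" "\<bar>c\<bar> \<le> 1152 * X" "\<bar>d\<bar> \<le> 1152 * X" for a b c d
    using that by (simp add: abs_le_iff)
  ultimately have "\<bar>N2 t z\<bar> \<le> 6912 * X" unfolding N2_def by blast
  thus ?thesis by (simp add: X_def)
qed

lemma inverse_N0_bound:
  assumes z: "norm z < 1"
  shows "inverse (N0 t z) ^ k \<le> wt (norm z) ^ (2 * k)"
proof -
  have "inverse (N0 t z) \<le> (wt (norm z))\<^sup>2"
    using N0_lower[OF z] N0_pos[OF z] by (simp add: inverse_eq_divide divide_le_eq mult.commute)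
  hence "inverse (N0 t z) ^ k \<le> ((wt (norm z))\<^sup>2) ^ k"
    using N0_pos[OF z] by (intro power_mono) auto
  thus ?thesis by (simp add: power_mult)
qed

lemma wt_power_mono: "norm z < 1 \<Longrightarrow> j \<le> k \<Longrightarrow> wt (norm z) ^ j \<le> wt (norm z) ^ k" for z :: complex
  by (intro power_increasing wt_ge_1) auto

text \<open>Each of \<open>N1\<close>, \<open>N2\<close> and 1 / \<open>N0\<close> costs two powers
  of \<open>wt\<close>. The worst term is \<open>N1\<close>^2 / \<open>N0\<close>^4, with 4 + 8 = 12
  of them; this is the origin of the exponent 12.\<close>

lemma I_bounds:
  assumes z: "norm z < 1"
  shows "\<bar>I0 t z\<bar> \<le> 4 * wt (norm z) ^ 12"
    and "\<bar>I1 t z\<bar> \<le> (1536 * M) * wt (norm z) ^ 12"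
    and "\<bar>I2 t z\<bar> \<le> (8 * 6912 * M\<^sup>2 + 24 * (192 * M)\<^sup>2) * wt (norm z) ^ 12"
proof -
  define W where "W = wt (norm z)"
  have W: "W ^ j \<le> W ^ 12" if "j \<le> 12" for j unfolding W_def by (rule wt_power_mono[OF z that])
  have W0: "0 \<le> W" by (simp add: W_def wt_def)
  have M: "M > 0" by (rule v.M_pos)
  have inv: "inverse (N0 t z) ^ k \<le> W ^ (2 * k)" for k unfolding W_def by (rule inverse_N0_bound[OF z])
  have "\<bar>I0 t z\<bar> = 4 * inverse (N0 t z) ^ 2" 
    using N0_pos[OF z] by (simp add: I0_def divide_inverse power_inverse)
  also have "\<dots> \<le> 4 * W ^ 12" using inv[of 2] W[of 4] by simp
  finally show "\<bar>I0 t z\<bar> \<le> 4 * wt (norm z) ^ 12" by (simp add: W_def)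
  have "\<bar>I1 t z\<bar> = 8 * (\<bar>N1 t z\<bar> * inverse (N0 t z) ^ 3)" 
    using N0_pos[OF z] by (simp add: I1_def divide_inverse power_inverse abs_mult)
  also have "\<bar>N1 t z\<bar> * inverse (N0 t z) ^ 3 \<le> (192 * M * W\<^sup>2) * W ^ 6"
    using N1_bound[OF z] inv[of 3] M less_imp_le[OF N0_pos[OF z]] by (intro mult_mono) (auto simp: W_def)
  also have "\<dots> = 192 * M * W ^ 8" by (simp flip: power_add)
  also have "\<dots> \<le> 192 * M * W ^ 12" using M W[of 8] by (intro mult_left_mono) auto
  finally show "\<bar>I1 t z\<bar> \<le> (1536 * M) * wt (norm z) ^ 12" by (simp add: W_def)
  have "\<bar>I2 t z\<bar> \<le> \<bar>- 8 * N2 t z / (N0 t z) ^ 3\<bar> + \<bar>24 * (N1 t z)\<^sup>2 / (N0 t z) ^ 4\<bar>"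
    unfolding I2_def by (rule abs_triangle_ineq)
  also have "\<dots> = 8 * (\<bar>N2 t z\<bar> * inverse (N0 t z) ^ 3) + 24 * (\<bar>N1 t z\<bar>\<^sup>2 * inverse (N0 t z) ^ 4)" 
    using N0_pos[OF z] by (simp add: divide_inverse power_inverse abs_mult)
  also have "\<dots> \<le> 8 * ((6912 * M\<^sup>2 * W\<^sup>2) * W ^ 6) + 24 * ((192 * M * W\<^sup>2)\<^sup>2 * W ^ 8)"
  proof (intro add_mono mult_left_mono mult_mono power_mono)
    show "inverse (N0 t z) ^ 3 \<le> W ^ 6" using inv[of 3] by simp
    show "inverse (N0 t z) ^ 4 \<le> W ^ 8" using inv[of 4] by simp
  qed (use N1_bound[OF z] N2_bound[OF z] M less_imp_le[OF N0_pos[OF z]] in \<open>auto simp: W_def\<close>)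
  also have "\<dots> = 8 * 6912 * M\<^sup>2 * W ^ 8 + 24 * (192 * M)\<^sup>2 * W ^ 12"
    by (simp add: power_mult_distrib flip: power_add power_mult)
  also have "\<dots> \<le> 8 * 6912 * M\<^sup>2 * W ^ 12 + 24 * (192 * M)\<^sup>2 * W ^ 12"
    using W[of 8] by (intro add_mono mult_left_mono) auto
  also have "\<dots> = (8 * 6912 * M\<^sup>2 + 24 * (192 * M)\<^sup>2) * W ^ 12" by (simp only: ring_distribs)
  finally show "\<bar>I2 t z\<bar> \<le> (8 * 6912 * M\<^sup>2 + 24 * (192 * M)\<^sup>2) * wt (norm z) ^ 12" by (simp add: W_def)
qed

text \<open>The quotient g inherits injectivity from the univalence of f, so the change of variables
  applies. Because g' = 1/v^2, the factor |v|^(-4) clears the denominators |v|^2 in 1 +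
  |u/v|^2.\<close>

lemma area_formula:
  assumes f: "normalized_univalent_solution (\<lambda>z. of_real t * Q z) f"
  shows "spherical_area (to_sphere f ` ball 0 1) = integral\<^sup>L disc (I0 t)"
proof -
  define vv where "vv = v.sol (of_real t)"
  define uu where "uu = u.sol (of_real t)"
  have v_nz: "vv z \<noteq> 0" if "norm z < 1" for z
    using v.sol_lower_bound[OF norm_t _ _ that] init by (auto simp: vv_def)
  have d: "\<And>z. norm z < 1 \<Longrightarrow> (uu has_field_derivative u.sol' (of_real t) z) (at z)"
    "\<And>z. norm z < 1 \<Longrightarrow> (vv has_field_derivative v.sol' (of_real t) z) (at z)"
    "\<And>z. norm z < 1 \<Longrightarrow> (u.sol' (of_real t) has_field_derivative (- (of_real t * Q z) / 2 * uu z)) (at z)"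
    "\<And>z. norm z < 1 \<Longrightarrow> (v.sol' (of_real t) has_field_derivative (- (of_real t * Q z) / 2 * vv z)) (at z)"
    using u.DERIV_sol[OF norm_t] v.DERIV_sol[OF norm_t] u.DERIV_sol'[OF norm_t] v.DERIV_sol'[OF norm_t]
    by (simp_all add: uu_def vv_def)
  have i: "uu 0 = 0" "u.sol' (of_real t) 0 = 1" "vv 0 = 1" "v.sol' (of_real t) 0 = 0"
    using u.sol_at_0[OF norm_t] u.sol'_at_0[OF norm_t] v.sol_at_0[OF norm_t] v.sol'_at_0[OF norm_t] init
    by (simp_all add: uu_def vv_def)
  define g where "g z = uu z / vv z" for z
  have fg: "to_sphere f z = Some (g z)" if "z \<in> ball 0 1" for z
    unfolding g_def by (rule normalized_univalent_solution_eq_quotient[OF f d i v_nz]) (use that in auto)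
  have dg: "(g has_field_derivative 1 / (vv z)\<^sup>2) (at z)" if "norm z < 1" for z
    unfolding g_def[abs_def] by (rule quotient_wronskian_deriv[OF d i v_nz[OF that] that])
  have inj: "inj_on g (ball 0 1)"
    using f fg by (auto simp: normalized_univalent_solution_def univalent_on_def inj_on_def)
  have hol: "g holomorphic_on ball 0 1" using dg by (rule holomorphic_on_ballI)
  have "{z. Some z \<in> to_sphere f ` ball 0 1} = g ` ball 0 1"
    using fg by (auto simp: image_iff)
  hence "spherical_area (to_sphere f ` ball 0 1) = set_lebesgue_integral lborel (g ` ball 0 1) (\<lambda>z. 4 / (1 + (norm z)\<^sup>2)\<^sup>2)"
    by (simp add: spherical_area_def)
  also have "\<dots> = set_lebesgue_integral lborel (ball 0 1) (\<lambda>z. (norm (deriv g z))\<^sup>2 * (4 / (1 + (norm (g z))\<^sup>2)\<^sup>2))"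
    by (rule set_integral_image_holomorphic[OF open_ball hol inj]) measurable
  also have "\<dots> = integral\<^sup>L disc (\<lambda>z. (norm (deriv g z))\<^sup>2 * (4 / (1 + (norm (g z))\<^sup>2)\<^sup>2))"
    by (rule integral_disc[symmetric])
  also have "\<dots> = integral\<^sup>L disc (I0 t)"
  proof (rule Bochner_Integration.integral_cong[OF refl])
    fix z assume "z \<in> space disc"
    hence z: "norm z < 1" by simp
    have "norm (vv z) \<noteq> 0" using v_nz[OF z] by simp
    hence "(1 / a\<^sup>2)\<^sup>2 * (4 / (1 + (b / a)\<^sup>2)\<^sup>2) = 4 / (a\<^sup>2 + b\<^sup>2)\<^sup>2" if "a = norm (vv z)" for a b :: real
    proof -
      have a: "a \<noteq> 0" using that \<open>norm (vv z) \<noteq> 0\<close> by simp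
      have "1 + (b / a)\<^sup>2 = (a\<^sup>2 + b\<^sup>2) / a\<^sup>2" using a by (simp add: power_divide add_divide_distrib)
      thus ?thesis using a by (simp add: power_divide)
    qed
    from this[OF refl, of "norm (uu z)"] 
    show "(norm (deriv g z))\<^sup>2 * (4 / (1 + (norm (g z))\<^sup>2)\<^sup>2) = I0 t z"
      unfolding DERIV_imp_deriv[OF dg[OF z]] I0_def N0_def uu_def[symmetric] vv_def[symmetric]
      by (simp add: g_def norm_divide norm_power power2_norm_eq_inner)
  qed
  finally show ?thesis .
qed

end

lemma DERIV_area:
  assumes "\<bar>t\<bar> < 1 / (96 * M)"
  shows "((\<lambda>t. integral\<^sup>L disc (I0 t)) has_real_derivative integral\<^sup>L disc (I1 t)) (at t)"
    and "((\<lambda>t. integral\<^sup>L disc (I1 t)) has_real_derivative integral\<^sup>L disc (I2 t)) (at t)"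
    and "integrable disc (I2 t)"
proof -
  let ?d = "1 / (96 * M)"
  have t: "- ?d < t" "t < ?d" using assms by auto
  have abs: "\<bar>s\<bar> < ?d" if "- ?d < s" "s < ?d" for s using that by simp
  have w: "integrable disc (\<lambda>z. C * wt (norm z) ^ 12)" for C
    using integrable_wt by simp
  have int: "integrable disc F" if "F \<in> borel_measurable disc" "\<And>z. norm z < 1 \<Longrightarrow> \<bar>F z\<bar> \<le> C * wt (norm z) ^ 12" for F C
    by (rule Bochner_Integration.integrable_bound[OF w[of C] that(1)]) 
       (use that(2) in \<open>auto intro!: AE_I2 order_trans[OF that(2)]\<close>)
  show "((\<lambda>t. integral\<^sup>L disc (I0 t)) has_real_derivative integral\<^sup>L disc (I1 t)) (at t)"
    by (rule has_real_derivative_integral(1)[OF t _ measurable_I(2) _ w])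
       (use int[OF measurable_I(1) I_bounds(1)[OF abs]] DERIV_I0[OF abs] I_bounds(2)[OF abs] in auto)
  show "((\<lambda>t. integral\<^sup>L disc (I1 t)) has_real_derivative integral\<^sup>L disc (I2 t)) (at t)"
    by (rule has_real_derivative_integral(1)[OF t _ measurable_I(3) _ w])
       (use int[OF measurable_I(2) I_bounds(2)[OF abs]] DERIV_I1[OF abs] I_bounds(3)[OF abs] in auto)
  show "integrable disc (I2 t)"
    by (rule int[OF measurable_I(3) I_bounds(3)[OF assms]])
qed

end

section \<open>The second variation\<close>

lemma continuous_on_radial_weight:
  fixes f :: "real \<Rightarrow> real"
  assumes f: "continuous_on {0..r} f"
  obtains C where "\<And>s. \<bar>indicator {0..r} s * f s\<bar> \<le> C"
proof -
  have "bounded (f ` {0..r})" by (intro compact_imp_bounded compact_continuous_image f) auto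
  then obtain C where "\<forall>x\<in>f ` {0..r}. norm x \<le> C" unfolding bounded_iff by blast
  hence C: "\<bar>f s\<bar> \<le> C" if "s \<in> {0..r}" for s using that by simp
  have "\<bar>indicator {0..r} s * f s\<bar> \<le> max C 0" for s
    using C[of s] by (cases "s \<in> {0..r}") auto
  thus ?thesis by (rule that)
qed

context
  fixes r :: real and f :: "real \<Rightarrow> real"
  assumes r: "0 \<le> r" "r < 1" and f: "continuous_on {0..r} f"
begin

lemma radial_weight_measurable: "(\<lambda>s. indicator {0..r} s * f s) \<in> borel_measurable borel"
  using borel_measurable_continuous_on_indicator[OF _ f] by simp

lemma radial_weight_integrable: "integrable disc (\<lambda>z. indicator {0..r} ((norm z)\<^sup>2) * f ((norm z)\<^sup>2))"
proof -
  interpret finite_measure disc by (rule finite_measure_disc)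
  obtain C where C: "\<And>s. \<bar>indicator {0..r} s * f s\<bar> \<le> C" using continuous_on_radial_weight[OF f] by blast
  have "(\<lambda>z::complex. indicator {0..r} ((norm z)\<^sup>2) * f ((norm z)\<^sup>2)) \<in> borel_measurable borel"
    using measurable_compose[OF _ radial_weight_measurable, of "\<lambda>z::complex. (norm z)\<^sup>2"] by measurable
  thus ?thesis
    using C by (intro integrable_const_bound[where B = C] AE_I2 borel_measurable_discI) auto
qed

lemma radial_weight_holomorphic:
  assumes H: "H holomorphic_on ball 0 1" "H 0 = 0"
  shows "integrable disc (\<lambda>z. indicator {0..r} ((norm z)\<^sup>2) * f ((norm z)\<^sup>2) * Re (H z))"
    and "integral\<^sup>L disc (\<lambda>z. indicator {0..r} ((norm z)\<^sup>2) * f ((norm z)\<^sup>2) * Re (H z)) = 0"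
proof -
  obtain C where C: "\<And>s. \<bar>indicator {0..r} s * f s\<bar> \<le> C" using continuous_on_radial_weight[OF f] by blast
  \<comment> \<open>The number \<open>r\<close> bounds s = |z|^2, so the corresponding radius is
    \<open>sqrt r\<close>.\<close>
  note * = integral_disc_radial_holomorphic[OF radial_weight_measurable C _ _ _ H, of "sqrt r"]
  show "integrable disc (\<lambda>z. indicator {0..r} ((norm z)\<^sup>2) * f ((norm z)\<^sup>2) * Re (H z))"
    by (rule *(1)) (use r in auto)
  show "integral\<^sup>L disc (\<lambda>z. indicator {0..r} ((norm z)\<^sup>2) * f ((norm z)\<^sup>2) * Re (H z)) = 0"
    by (rule *(2)) (use r in auto)
qed

lemma radial_weight_parseval:
  fixes b c :: "nat \<Rightarrow> complex"
  assumes g: "\<forall>z. norm z < 1 \<longrightarrow> (\<lambda>n. b n * z ^ n) sums g z"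
    and h: "\<forall>z. norm z < 1 \<longrightarrow> (\<lambda>n. c n * z ^ n) sums h z"
  shows "integrable disc (\<lambda>z. indicator {0..r} ((norm z)\<^sup>2) * f ((norm z)\<^sup>2) * Re (g z * cnj (h z)))"
    and "(\<lambda>n. Re (b n * cnj (c n)) * integral\<^sup>L disc (\<lambda>z. indicator {0..r} ((norm z)\<^sup>2) * f ((norm z)\<^sup>2) * ((norm z)\<^sup>2) ^ n)) sums
      integral\<^sup>L disc (\<lambda>z. indicator {0..r} ((norm z)\<^sup>2) * f ((norm z)\<^sup>2) * Re (g z * cnj (h z)))"
proof -
  obtain C where C: "\<And>s. \<bar>indicator {0..r} s * f s\<bar> \<le> C" using continuous_on_radial_weight[OF f] by blast
  define w where "w s = indicator {0..r} s * f s" for s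
  have w: "w \<in> borel_measurable borel" "\<And>s. \<bar>w s\<bar> \<le> C" "\<And>s. s > (sqrt r)\<^sup>2 \<Longrightarrow> w s = 0"
    using radial_weight_measurable C r by (auto simp: w_def[abs_def])
  have \<rho>: "0 \<le> sqrt r" "sqrt r < 1" using r by auto
  have int: "integrable disc (\<lambda>z. of_real (w ((norm z)\<^sup>2)) * g z * cnj (h z))"
    by (rule disc_parseval(1)[OF w(1,2) \<rho> w(3)]) (use g h in auto)
  have sums: "(\<lambda>n. b n * cnj (c n) * of_real (integral\<^sup>L disc (\<lambda>z. w ((norm z)\<^sup>2) * ((norm z)\<^sup>2) ^ n))) sums
      integral\<^sup>L disc (\<lambda>z. of_real (w ((norm z)\<^sup>2)) * g z * cnj (h z))"
    by (rule disc_parseval(2)[OF w(1,2) \<rho> w(3)]) (use g h in auto)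
  have Re: "Re (of_real (w s) * x * y) = w s * Re (x * y)" for s x y
    by (simp add: mult.assoc)
  show "integrable disc (\<lambda>z. indicator {0..r} ((norm z)\<^sup>2) * f ((norm z)\<^sup>2) * Re (g z * cnj (h z)))"
    using integrable_Re[OF int] unfolding Re by (simp add: w_def)
  have "(\<lambda>n. Re (b n * cnj (c n) * of_real (integral\<^sup>L disc (\<lambda>z. w ((norm z)\<^sup>2) * ((norm z)\<^sup>2) ^ n)))) sums
      integral\<^sup>L disc (\<lambda>z. Re (of_real (w ((norm z)\<^sup>2)) * g z * cnj (h z)))"
    using sums_Re[OF sums] unfolding integral_Re[OF int] .
  moreover have "Re (x * of_real y) = Re x * y" for x y by simp
  ultimately show "(\<lambda>n. Re (b n * cnj (c n)) * integral\<^sup>L disc (\<lambda>z. indicator {0..r} ((norm z)\<^sup>2) * f ((norm z)\<^sup>2) * ((norm z)\<^sup>2) ^ n)) sums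
      integral\<^sup>L disc (\<lambda>z. indicator {0..r} ((norm z)\<^sup>2) * f ((norm z)\<^sup>2) * Re (g z * cnj (h z)))"
    unfolding Re by (simp only: w_def)
qed

end

text \<open>To be read with \<open>X = V\<^sub>1\<close>, \<open>z Y = U\<^sub>1\<close>, \<open>v2 = V\<^sub>2\<close>, \<open>z g2 = U\<^sub>2\<close>: the integrand at \<open>t = 0\<close> is
  split into terms treated by Parseval's identity and terms whose integral vanishes.\<close>

lemma second_variation_pointwise:
  fixes z X Y v2 g2 :: complex
  defines "s \<equiv> (norm z)\<^sup>2"
  defines "d \<equiv> inverse ((1 + s) ^ 3)" and "e \<equiv> inverse ((1 + s) ^ 4)"
  shows "- 8 * (2 * (X \<bullet> X + 1 \<bullet> (2 * v2) + (z * Y) \<bullet> (z * Y) + z \<bullet> (2 * (z * g2)))) / ((1::complex) \<bullet> 1 + z \<bullet> z) ^ 3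
      + 24 * (2 * (1 \<bullet> X + z \<bullet> (z * Y)))\<^sup>2 / ((1::complex) \<bullet> 1 + z \<bullet> z) ^ 4
    = (48 * e - 16 * d) * Re (X * cnj X) + (48 * s\<^sup>2 * e - 16 * s * d) * Re (Y * cnj Y) + 96 * s * e * Re (X * cnj Y)
      + (- 32 * d) * Re v2 + (- 32 * s * d) * Re g2
      + 48 * e * Re (X * X) + 96 * s * e * Re (X * Y) + 48 * s\<^sup>2 * e * Re (Y * Y)"
proof -
  have i1: "1 \<bullet> w = Re w" for w :: complex by (simp add: inner_complex_def)
  have i2: "z \<bullet> (z * w) = s * Re w" for w
    by (simp add: inner_complex_def s_def cmod_power2) (simp add: algebra_simps power2_eq_square)
  have i3: "z \<bullet> (2 * (z * w)) = 2 * (s * Re w)" for w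
    using i2[of "2 * w"] by (simp add: mult.left_commute)
  have i4: "(z * w) \<bullet> (z * w) = s * (w \<bullet> w)" for w
    by (simp add: power2_norm_eq_inner[symmetric] norm_mult power_mult_distrib s_def)
  have i5: "z \<bullet> z = s" by (simp add: s_def power2_norm_eq_inner)
  have i6: "1 \<bullet> (1::complex) = 1" by (simp add: inner_complex_def)
  show ?thesis
    unfolding i6 i1 i2 i3 i4 i5 divide_inverse
    by (simp add: d_def[symmetric] e_def[symmetric] inner_complex_def power2_eq_square algebra_simps)
qed

section \<open>Taylor coefficients and the value of the second derivative\<close>

context schwarzian_pair
begin

context
  fixes a :: "nat \<Rightarrow> complex"
  assumes Q: "\<And>z. norm z < 1 \<Longrightarrow> (\<lambda>n. (of_nat (n + 2) ^ 3 - of_nat (n + 2)) * a (n + 2) * z ^ n) sums Q z"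
begin

text \<open>Integrating V_1'' = -Q/2 twice divides (n^3 - n) a_n by n (n - 1) and leaves n + 1. For
  U_1'' = -z Q/2 the degree is one higher, the divisor is (n + 1) n, and n - 1 is left.
  \<open>U1_coeff\<close> lists the coefficients of U_1 / z, so that both sequences are indexed like
  \<open>a\<close>.\<close>

definition "V1_coeff n = (if n < 2 then 0 else - (of_nat n + 1) / 2 * a n)"
definition "U1_coeff n = (if n < 2 then 0 else - (of_nat n - 1) / 2 * a n)"

lemma V1_sums:
  assumes z: "norm z < 1"
  shows "(\<lambda>n. V1_coeff n * z ^ n) sums V 1 z"
proof -
  define q where "q n = - 1 / 2 * ((of_nat (n + 2) ^ 3 - of_nat (n + 2)) * a (n + 2))" for n
  have q: "(\<lambda>n. q n * z ^ n) sums (- Q z / 2 * V 0 z)" if "norm z < 1" for z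
    using sums_mult[OF Q[OF that], of "- 1 / 2"] unfolding q_def init by (simp only: mult.assoc) simp
  have "(\<lambda>n. (if n < 2 then 0 else q (n - 2) / (of_nat n * (of_nat n - 1))) * z ^ n) sums V (Suc 0) z"
    by (rule ode_step_coefficients[OF v.DERIV_V v.DERIV_V' v.V_init q z])
  moreover have "(if n < 2 then 0 else q (n - 2) / (of_nat n * (of_nat n - 1))) = V1_coeff n" for n
  proof (cases "n < 2")
    case False
    define m :: complex where "m = of_nat n"
    have m: "m \<noteq> 0" "m - 1 \<noteq> 0" using False by (auto simp: m_def)
    have "- 1 / 2 * ((m ^ 3 - m) * a n) / (m * (m - 1)) = - (m + 1) / 2 * a n"
      using m by (simp add: divide_simps) (simp add: algebra_simps power3_eq_cube)
    moreover have "n - 2 + 2 = n" using False by simp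
    hence "q (n - 2) = - 1 / 2 * ((m ^ 3 - m) * a n)" by (simp only: q_def m_def)
    ultimately show ?thesis using False unfolding V1_coeff_def by (simp add: m_def)
  qed (simp add: V1_coeff_def)
  ultimately show ?thesis by simp
qed

lemma U1_sums:
  obtains Y where "\<And>z. norm z < 1 \<Longrightarrow> (\<lambda>n. U1_coeff n * z ^ n) sums Y z" "\<And>z. norm z < 1 \<Longrightarrow> U 1 z = z * Y z"
proof -
  \<comment> \<open>The factor \<open>U 0 z\<close> = z shifts the coefficients of \<open>Q\<close>
    by one place; the new constant term is 0.\<close>
  define q where "q n = (case n of 0 \<Rightarrow> 0 | Suc m \<Rightarrow> - 1 / 2 * ((of_nat (m + 2) ^ 3 - of_nat (m + 2)) * a (m + 2)))" for n
  have q: "(\<lambda>n. q n * z ^ n) sums (- Q z / 2 * U 0 z)" if "norm z < 1" for z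
  proof -
    have "(\<lambda>n. - 1 / 2 * z * ((of_nat (n + 2) ^ 3 - of_nat (n + 2)) * a (n + 2) * z ^ n)) sums (- 1 / 2 * z * Q z)"
      by (rule sums_mult[OF Q[OF that]])
    hence "(\<lambda>n. q (Suc n) * z ^ Suc n) sums (- Q z / 2 * U 0 z)"
      by (simp add: q_def init mult_ac)
    thus ?thesis by (subst (asm) sums_Suc_iff) (simp add: q_def)
  qed
  define c where "c n = (if n < 2 then 0 else q (n - 2) / (of_nat n * (of_nat n - 1)))" for n
  have "(\<lambda>n. c n * z ^ n) sums U (Suc 0) z" if "norm z < 1" for z
    unfolding c_def by (rule ode_step_coefficients[OF u.DERIV_V u.DERIV_V' u.V_init q that])
  moreover have "c 0 = 0" by (simp add: c_def)
  ultimately obtain Y where Y: "\<And>z. norm z < 1 \<Longrightarrow> (\<lambda>n. c (Suc n) * z ^ n) sums Y z" 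
      "\<And>z. norm z < 1 \<Longrightarrow> U (Suc 0) z = z * Y z"
    using sums_divide_by_z by blast
  have "c (Suc n) = U1_coeff n" for n
  proof (cases "n < 2")
    case True
    hence "n = 0 \<or> n = 1" by auto
    thus ?thesis by (auto simp: c_def q_def U1_coeff_def)
  next
    case False
    then obtain k where k: "n = Suc (Suc k)" by (metis less_2_cases_iff not0_implies_Suc One_nat_def)
    define m :: complex where "m = of_nat n"
    have "m + 1 = of_nat (Suc n)" by (simp add: m_def)
    hence m: "m \<noteq> 0" "m + 1 \<noteq> 0" by (simp_all only: m_def k of_nat_neq_0 not_False_eq_True)
    have "- 1 / 2 * ((m ^ 3 - m) * a n) / ((m + 1) * m) = - (m - 1) / 2 * a n"
      using m by (simp add: divide_simps) (simp add: algebra_simps power3_eq_cube)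
    moreover have "q (Suc n - 2) = - 1 / 2 * ((m ^ 3 - m) * a n)" by (simp add: q_def m_def k)
    moreover have "c (Suc n) = q (Suc n - 2) / ((m + 1) * m)"
      using False by (simp add: c_def m_def add.commute)
    moreover have "U1_coeff n = - (m - 1) / 2 * a n" using False by (simp add: U1_coeff_def m_def)
    ultimately show ?thesis by (simp only:)
  qed
  with Y show ?thesis using that[of Y] by simp
qed

text \<open>U_2 vanishes to second order at 0, so the quotient still vanishes there, as
  \<open>radial_weight_holomorphic\<close> requires.\<close>

lemma U2_quotient:
  obtains g where "g holomorphic_on ball 0 1" "g 0 = 0" "\<And>z. norm z < 1 \<Longrightarrow> U 2 z = z * g z"
proof -
  have "U 2 holomorphic_on ball 0 1" using u.DERIV_V by (rule holomorphic_on_ballI)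
  then obtain c where c: "\<And>z. norm z < 1 \<Longrightarrow> (\<lambda>n. c n * z ^ n) sums U 2 z" "c 0 = U 2 0" "c 1 = deriv (U 2) 0"
    using holomorphic_sums_disc by blast
  have c0: "c 0 = 0" "c 1 = 0"
    using c(2,3) u.V_init[of 1] DERIV_imp_deriv[OF u.DERIV_V[of 0 2]] by (simp_all add: numeral_2_eq_2)
  obtain g where g: "\<And>z. norm z < 1 \<Longrightarrow> (\<lambda>n. c (Suc n) * z ^ n) sums g z" "\<And>z. norm z < 1 \<Longrightarrow> U 2 z = z * g z"
    using sums_divide_by_z[OF c(1) c0(1)] by blast
  have "g holomorphic_on ball 0 1"
    by (rule power_series_holomorphic[of 0 1 "\<lambda>n. c (Suc n)"]) (use g(1) in auto)
  moreover have "g 0 = 0" 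
    using g(1)[of 0] powser_sums_zero[of "\<lambda>n. c (Suc n)"] c0(2) by (auto simp: sums_iff)
  ultimately show ?thesis using g(2) by (rule that)
qed

text \<open>Three terms of the integrand are handled by Parseval's identity, the other five
  integrate to 0. Both factors of the summand are set to 0 for n < 2, because
  \<open>area_weight_bounds\<close> is stated for n >= 2 and the limit passage needs bounds for
  every n.\<close>

lemma truncated_second_variation:
  assumes r: "0 \<le> r" "r < 1"
  shows "(\<lambda>n. (if n < 2 then 0 else pi * (norm (a n))\<^sup>2) * (if n < 2 then 0 else area_weight n r)) sums
    integral\<^sup>L disc (\<lambda>z. indicator {0..r} ((norm z)\<^sup>2) * I2 0 z)"
proof -
  obtain Y where Y: "\<And>z. norm z < 1 \<Longrightarrow> (\<lambda>n. U1_coeff n * z ^ n) sums Y z" "\<And>z. norm z < 1 \<Longrightarrow> U 1 z = z * Y z"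
    using U1_sums by blast
  obtain g2 where g2: "g2 holomorphic_on ball 0 1" "g2 0 = 0" "\<And>z. norm z < 1 \<Longrightarrow> U 2 z = z * g2 z"
    using U2_quotient by blast
  define X where "X = V 1"
  have X': "\<forall>z. norm z < 1 \<longrightarrow> (\<lambda>n. V1_coeff n * z ^ n) sums X z" unfolding X_def using V1_sums by blast
  have Y': "\<forall>z. norm z < 1 \<longrightarrow> (\<lambda>n. U1_coeff n * z ^ n) sums Y z" using Y(1) by blast
  have hX: "X holomorphic_on ball 0 1" unfolding X_def using v.DERIV_V by (rule holomorphic_on_ballI)
  have hV2: "V 2 holomorphic_on ball 0 1" using v.DERIV_V by (rule holomorphic_on_ballI)
  have hY: "Y holomorphic_on ball 0 1"
    by (rule power_series_holomorphic[of 0 1 U1_coeff]) (use Y(1) in auto)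
  have zero: "X 0 = 0" "V 2 0 = 0" "Y 0 = 0"
    using v.V_init[of 0] v.V_init[of 1] Y(1)[of 0] powser_sums_zero[of U1_coeff]
    by (auto simp: X_def numeral_2_eq_2 sums_iff U1_coeff_def)
  define d e where "d s = inverse ((1 + s) ^ 3)" and "e s = inverse ((1 + s) ^ 4)" for s :: real
  define R where "R f z = indicator {0..r} ((norm z)\<^sup>2) * f ((norm z)\<^sup>2)" for f :: "real \<Rightarrow> real" and z :: complex
  define e1 e2 e3 where "e1 s = 48 * e s - 16 * d s" and "e2 s = 48 * s\<^sup>2 * e s - 16 * s * d s"
    and "e3 s = 96 * s * e s" for s
  have cd: "continuous_on {0..r} d" "continuous_on {0..r} e"
    unfolding d_def[abs_def] e_def[abs_def] by (auto intro!: continuous_intros)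
  have ce: "continuous_on {0..r} e1" "continuous_on {0..r} e2" "continuous_on {0..r} e3"
    unfolding e1_def[abs_def] e2_def[abs_def] e3_def[abs_def] by (intro continuous_intros cd)+
  have ch: "continuous_on {0..r} (\<lambda>s. - 32 * d s)" "continuous_on {0..r} (\<lambda>s. - 32 * s * d s)"
    "continuous_on {0..r} (\<lambda>s. 48 * e s)" "continuous_on {0..r} (\<lambda>s. 96 * s * e s)" 
    "continuous_on {0..r} (\<lambda>s. 48 * s\<^sup>2 * e s)"
    by (intro continuous_intros cd)+
  have eq: "indicator {0..r} ((norm z)\<^sup>2) * I2 0 z = 
      R e1 z * Re (X z * cnj (X z)) + R e2 z * Re (Y z * cnj (Y z)) + R e3 z * Re (X z * cnj (Y z))
      + (R (\<lambda>s. - 32 * d s) z * Re (V 2 z) + R (\<lambda>s. - 32 * s * d s) z * Re (g2 z)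
      + R (\<lambda>s. 48 * e s) z * Re (X z * X z) + R (\<lambda>s. 96 * s * e s) z * Re (X z * Y z)
      + R (\<lambda>s. 48 * s\<^sup>2 * e s) z * Re (Y z * Y z))" if z: "norm z < 1" for z
    unfolding I2_def N0_def N1_def N2_def of_real_0 v.sol_t0 u.sol_t0 init Y(2)[OF z] g2(3)[OF z] X_def[symmetric]
      second_variation_pointwise R_def e1_def e2_def e3_def d_def e_def by (simp only: ring_distribs mult_ac)
  note P1 = radial_weight_parseval[OF r ce(1) X' X', folded R_def]
  note P2 = radial_weight_parseval[OF r ce(2) Y' Y', folded R_def]
  note P3 = radial_weight_parseval[OF r ce(3) X' Y', folded R_def]
  have hol: "(\<lambda>z. X z * X z) holomorphic_on ball 0 1" "(\<lambda>z. X z * Y z) holomorphic_on ball 0 1"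
    "(\<lambda>z. Y z * Y z) holomorphic_on ball 0 1" by (intro holomorphic_intros hX hY)+
  have "X 0 * X 0 = 0" "X 0 * Y 0 = 0" "Y 0 * Y 0 = 0" by (simp_all add: zero)
  note Z1 = radial_weight_holomorphic[OF r ch(1) hV2 zero(2)]
    and Z2 = radial_weight_holomorphic[OF r ch(2) g2(1,2)]
    and Z3 = radial_weight_holomorphic[OF r ch(3) hol(1) this(1)]
    and Z4 = radial_weight_holomorphic[OF r ch(4) hol(2) this(2)]
    and Z5 = radial_weight_holomorphic[OF r ch(5) hol(3) this(3)]
  have "integral\<^sup>L disc (\<lambda>z. indicator {0..r} ((norm z)\<^sup>2) * I2 0 z) =
      integral\<^sup>L disc (\<lambda>z. R e1 z * Re (X z * cnj (X z)) + R e2 z * Re (Y z * cnj (Y z)) + R e3 z * Re (X z * cnj (Y z))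
      + (R (\<lambda>s. - 32 * d s) z * Re (V 2 z) + R (\<lambda>s. - 32 * s * d s) z * Re (g2 z)
      + R (\<lambda>s. 48 * e s) z * Re (X z * X z) + R (\<lambda>s. 96 * s * e s) z * Re (X z * Y z)
      + R (\<lambda>s. 48 * s\<^sup>2 * e s) z * Re (Y z * Y z)))"
    by (rule Bochner_Integration.integral_cong[OF refl]) (use eq in simp)
  also have "\<dots> = integral\<^sup>L disc (\<lambda>z. R e1 z * Re (X z * cnj (X z))) 
      + integral\<^sup>L disc (\<lambda>z. R e2 z * Re (Y z * cnj (Y z))) + integral\<^sup>L disc (\<lambda>z. R e3 z * Re (X z * cnj (Y z)))
      + (0 + 0 + 0 + 0 + 0)"
  proof -
    have "integral\<^sup>L disc (\<lambda>z. f1 z + f2 z + f3 z + (f4 z + f5 z + f6 z + f7 z + f8 z)) =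
        integral\<^sup>L disc f1 + integral\<^sup>L disc f2 + integral\<^sup>L disc f3 + 
        (integral\<^sup>L disc f4 + integral\<^sup>L disc f5 + integral\<^sup>L disc f6 + integral\<^sup>L disc f7 + integral\<^sup>L disc f8)"
      if "integrable disc f1" "integrable disc f2" "integrable disc f3" "integrable disc f4" "integrable disc f5"
        "integrable disc f6" "integrable disc f7" "integrable disc f8" for f1 f2 f3 f4 f5 f6 f7 f8 :: "complex \<Rightarrow> real"
      using that by simp
    from this[OF P1(1) P2(1) P3(1) Z1(1) Z2(1) Z3(1) Z4(1) Z5(1)] show ?thesis
      unfolding R_def Z1(2) Z2(2) Z3(2) Z4(2) Z5(2) .
  qed
  finally have I: "integral\<^sup>L disc (\<lambda>z. indicator {0..r} ((norm z)\<^sup>2) * I2 0 z) =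
      integral\<^sup>L disc (\<lambda>z. R e1 z * Re (X z * cnj (X z))) 
      + integral\<^sup>L disc (\<lambda>z. R e2 z * Re (Y z * cnj (Y z))) + integral\<^sup>L disc (\<lambda>z. R e3 z * Re (X z * cnj (Y z)))" by simp
  define J where "J f n = integral\<^sup>L disc (\<lambda>z. R f z * ((norm z)\<^sup>2) ^ n)" for f n
  have S: "(\<lambda>n. Re (V1_coeff n * cnj (V1_coeff n)) * J e1 n + Re (U1_coeff n * cnj (U1_coeff n)) * J e2 n + Re (V1_coeff n * cnj (U1_coeff n)) * J e3 n) sums
      integral\<^sup>L disc (\<lambda>z. indicator {0..r} ((norm z)\<^sup>2) * I2 0 z)"
    unfolding I J_def by (intro sums_add P1(2) P2(2) P3(2))
  have "Re (V1_coeff n * cnj (V1_coeff n)) * J e1 n + Re (U1_coeff n * cnj (U1_coeff n)) * J e2 n + Re (V1_coeff n * cnj (U1_coeff n)) * J e3 n =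
      (if n < 2 then 0 else pi * (norm (a n))\<^sup>2) * (if n < 2 then 0 else area_weight n r)" for n
  proof (cases "n < 2")
    case False
    define m where "m = real n"
    define A where "A = (norm (a n))\<^sup>2"
    have xn: "V1_coeff n = of_real (- (m + 1) / 2) * a n" and yn: "U1_coeff n = of_real (- (m - 1) / 2) * a n"
      using False by (simp_all add: V1_coeff_def U1_coeff_def m_def)
    have Re: "Re (of_real p * a n * cnj (of_real q * a n)) = p * q * A" for p q
      by (simp add: A_def cmod_power2) (simp add: power2_eq_square algebra_simps)
    have int: "integrable disc (\<lambda>z. R f z * ((norm z)\<^sup>2) ^ n)" if f: "continuous_on {0..r} f" for f
    proof -
      have "continuous_on {0..r} (\<lambda>s. f s * s ^ n)" by (intro continuous_intros f)
      from radial_weight_integrable[OF r this] show ?thesis by (simp add: R_def mult.assoc)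
    qed
    \<comment> \<open>The coefficients contribute (n + 1)^2 / 4, (n - 1)^2 / 4 and (n^2 - 1) / 4
      times |a n|^2. So weighted, the three radial densities combine to the derivative of
      \<open>area_weight n\<close>.\<close>
    define h where "h s = 8 * ((m + 1)\<^sup>2 + (2 * m\<^sup>2 - 4) * s + (m - 1)\<^sup>2 * s\<^sup>2) / (1 + s) ^ 4 * s ^ n" for s
    have h: "(m + 1)\<^sup>2 * (e1 s * s ^ n) + (m - 1)\<^sup>2 * (e2 s * s ^ n) + (m + 1) * (m - 1) * (e3 s * s ^ n) = 4 * h s"
      if "0 \<le> s" for s
    proof -
      have ds: "d s = (1 + s) * e s" using that by (simp add: d_def e_def eval_nat_numeral)
      show ?thesis
        unfolding h_def e1_def e2_def e3_def ds divide_inverse e_def[symmetric]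
        by (simp add: power2_eq_square algebra_simps)
    qed
    have "(m + 1)\<^sup>2 * J e1 n + (m - 1)\<^sup>2 * J e2 n + (m + 1) * (m - 1) * J e3 n =
      integral\<^sup>L disc (\<lambda>z. (m + 1)\<^sup>2 * (R e1 z * ((norm z)\<^sup>2) ^ n) + (m - 1)\<^sup>2 * (R e2 z * ((norm z)\<^sup>2) ^ n)
        + (m + 1) * (m - 1) * (R e3 z * ((norm z)\<^sup>2) ^ n))"
      unfolding J_def using int[OF ce(1)] int[OF ce(2)] int[OF ce(3)] by simp
    also have "\<dots> = integral\<^sup>L disc (\<lambda>z. 4 * (indicator {0..r} ((norm z)\<^sup>2) * h ((norm z)\<^sup>2)))"
    proof (rule Bochner_Integration.integral_cong[OF refl])
      fix z :: complex
      show "(m + 1)\<^sup>2 * (R e1 z * ((norm z)\<^sup>2) ^ n) + (m - 1)\<^sup>2 * (R e2 z * ((norm z)\<^sup>2) ^ n)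
        + (m + 1) * (m - 1) * (R e3 z * ((norm z)\<^sup>2) ^ n) = 4 * (indicator {0..r} ((norm z)\<^sup>2) * h ((norm z)\<^sup>2))"
        using h[of "(norm z)\<^sup>2"] by (cases "(norm z)\<^sup>2 \<in> {0..r}") (auto simp: R_def)
    qed
    also have "\<dots> = 4 * integral\<^sup>L disc (\<lambda>z. indicator {0..r} ((norm z)\<^sup>2) * h ((norm z)\<^sup>2))" by simp
    also have "integral\<^sup>L disc (\<lambda>z. indicator {0..r} ((norm z)\<^sup>2) * h ((norm z)\<^sup>2)) = pi * (area_weight n r - area_weight n 0)"
    proof (rule integral_disc_radial_FTC[OF r])
      show "(area_weight n has_real_derivative h s) (at s)" if "0 \<le> s" for s
        unfolding h_def m_def by (rule DERIV_area_weight[OF that])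
      show "continuous_on {0..r} h" unfolding h_def by (intro continuous_intros) auto
    qed
    also have "area_weight n 0 = 0" by (simp add: area_weight_def)
    finally have J: "(m + 1)\<^sup>2 * J e1 n + (m - 1)\<^sup>2 * J e2 n + (m + 1) * (m - 1) * J e3 n = 4 * (pi * area_weight n r)" 
      by simp
    have "Re (V1_coeff n * cnj (V1_coeff n)) * J e1 n + Re (U1_coeff n * cnj (U1_coeff n)) * J e2 n + Re (V1_coeff n * cnj (U1_coeff n)) * J e3 n
      = A / 4 * ((m + 1)\<^sup>2 * J e1 n + (m - 1)\<^sup>2 * J e2 n + (m + 1) * (m - 1) * J e3 n)"
      unfolding xn yn Re by (simp add: field_simps power2_eq_square)
    thus ?thesis using False unfolding J by (simp add: A_def)
  qed (simp add: V1_coeff_def U1_coeff_def)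
  with S show ?thesis by (simp only:)
qed

text \<open>The cut-off r = k / (k + 1) tends to 1. On the integral side |I2 0| dominates; on the
  series side \<open>area_weight n\<close> tends to its value 2 n at s = 1, which is the coefficient
  in the final formula up to pi.\<close>

lemma second_variation:
  "(\<lambda>n. (if n < 2 then 0 else pi * (norm (a n))\<^sup>2) * (if n < 2 then 0 else 2 * real n)) sums integral\<^sup>L disc (I2 0)"
proof (rule sums_from_limits)
  define r where "r k = real k / real (Suc k)" for k
  have r: "0 \<le> r k" "r k < 1" for k by (auto simp: r_def)
  have r_lim: "r \<longlonglongrightarrow> 1" unfolding r_def[abs_def] by (rule LIMSEQ_n_over_Suc_n)
  show "0 \<le> (if n < 2 then 0 else area_weight n (r k))" "(if n < 2 then 0 else area_weight n (r k)) \<le> (if n < 2 then 0 else 2 * real n)" for n k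
    using area_weight_bounds[of "r k" n] r[of k] by auto
  show "(\<lambda>k. if n < 2 then 0 else area_weight n (r k)) \<longlonglongrightarrow> (if n < 2 then 0 else 2 * real n)" for n
  proof -
    have "isCont (area_weight n) 1" by (rule DERIV_isCont[OF DERIV_area_weight]) simp
    hence "(\<lambda>k. area_weight n (r k)) \<longlonglongrightarrow> area_weight n 1" using r_lim by (rule isCont_tendsto_compose)
    moreover have "area_weight n 1 = 2 * real n" by (simp add: area_weight_def)
    ultimately show ?thesis by simp
  qed
  show "(\<lambda>n. (if n < 2 then 0 else pi * (norm (a n))\<^sup>2) * (if n < 2 then 0 else area_weight n (r k))) sums
    integral\<^sup>L disc (\<lambda>z. indicator {0..r k} ((norm z)\<^sup>2) * I2 0 z)" for k
    by (rule truncated_second_variation[OF r])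
  have int: "integrable disc (I2 0)" using DERIV_area(3)[of 0] v.M_pos by simp
  show "(\<lambda>k. integral\<^sup>L disc (\<lambda>z. indicator {0..r k} ((norm z)\<^sup>2) * I2 0 z)) \<longlonglongrightarrow> integral\<^sup>L disc (I2 0)"
  proof (rule integral_dominated_convergence[where w = "\<lambda>z. \<bar>I2 0 z\<bar>"])
    have "(\<lambda>z. indicator {0..r k} ((norm z)\<^sup>2)) \<in> borel_measurable disc" for k
      by (intro borel_measurable_discI) measurable
    thus "(\<lambda>z. indicator {0..r k} ((norm z)\<^sup>2) * I2 0 z) \<in> borel_measurable disc" for k
      using measurable_I(3) by (intro borel_measurable_times) auto
    show "AE z in disc. (\<lambda>k. indicator {0..r k} ((norm z)\<^sup>2) * I2 0 z) \<longlonglongrightarrow> I2 0 z"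
    proof (rule AE_I2)
      fix z assume "z \<in> space disc"
      hence "(norm z)\<^sup>2 < 1" by (simp add: power_less_one_iff abs_square_less_1)
      hence "eventually (\<lambda>k. (norm z)\<^sup>2 < r k) sequentially" using r_lim by (rule order_tendstoD(1)[rotated])
      hence "eventually (\<lambda>k. indicator {0..r k} ((norm z)\<^sup>2) * I2 0 z = I2 0 z) sequentially"
        by eventually_elim auto
      thus "(\<lambda>k. indicator {0..r k} ((norm z)\<^sup>2) * I2 0 z) \<longlonglongrightarrow> I2 0 z" by (rule tendsto_eventually)
    qed
  qed (use int measurable_I(3) in \<open>auto simp: indicator_def\<close>)
qed auto

end

end

theorem theorem3p4:
  fixes Q :: "complex \<Rightarrow> complex" and a :: "nat \<Rightarrow> complex"
    and f :: "real \<Rightarrow> complex \<Rightarrow> complex"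
  assumes "Q \<in> A_infty"
    and "\<And>z. z \<in> ball 0 1 \<Longrightarrow>
      ((\<lambda>n. (of_nat n ^ 3 - of_nat n) * a n * z ^ (n - 2)) has_sum Q z) {2..}"
    and "\<forall>\<^sub>F t in nhds 0. normalized_univalent_solution (\<lambda>z. of_real t * Q z) (f t)"
  shows "(\<lambda>n. real n * (norm (a n))\<^sup>2) summable_on {2..} \<and>
    has_second_real_derivative (\<lambda>t. spherical_area (to_sphere (f t) ` ball 0 1))
      (2 * pi * (\<Sum>\<^sub>\<infinity>n\<in>{2..}. real n * (norm (a n))\<^sup>2)) 0"
proof -
  have hol: "Q holomorphic_on ball 0 1" using assms(1) by (simp add: A_infty_def)
  obtain M0 where "\<forall>x\<in>(\<lambda>z. norm (Q z * of_real ((1 - (norm z)\<^sup>2)\<^sup>2))) ` ball 0 1. x \<le> M0"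
    using assms(1) unfolding A_infty_def bdd_above_def by blast
  hence M0: "\<And>z. z \<in> ball 0 1 \<Longrightarrow> norm (Q z * of_real ((1 - (norm z)\<^sup>2)\<^sup>2)) \<le> M0" by blast
  \<comment> \<open>The maximum with 1 keeps \<open>M\<close> positive, so that 1/(96 M) is a
    genuine radius.\<close>
  define M where "M = max M0 1"
  have M: "M > 0" "M0 \<le> M" by (auto simp: M_def)
  \<comment> \<open>As |z|^2 <= |z|, the weight (1 - |z|^2)^2 may be replaced by the smaller (1 -
    |z|)^2, which matches the Euler equation of \<open>wt\<close>.\<close>
  have bound: "norm (Q z) \<le> M / (1 - norm z)\<^sup>2" if z: "norm z < 1" for z
  proof -
    have "(norm z)\<^sup>2 \<le> norm z" using z by (simp add: power2_eq_square mult_left_le)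
    hence "(1 - norm z)\<^sup>2 \<le> (1 - (norm z)\<^sup>2)\<^sup>2" using z by (intro power_mono) auto
    hence "norm (Q z) * (1 - norm z)\<^sup>2 \<le> norm (Q z) * (1 - (norm z)\<^sup>2)\<^sup>2" by (intro mult_left_mono) auto
    also have "\<dots> = norm (Q z * of_real ((1 - (norm z)\<^sup>2)\<^sup>2))"
      by (simp only: norm_mult norm_of_real) simp
    also have "\<dots> \<le> M" using M0[of z] z M by simp
    finally show ?thesis using z by (simp add: le_divide_eq)
  qed
  obtain V V' where V: "V 0 = (\<lambda>_. 1)" "V' 0 = (\<lambda>_. 0)"
    "\<And>k z. norm z < 1 \<Longrightarrow> (V k has_field_derivative V' k z) (at z)"
    "\<And>k z. norm z < 1 \<Longrightarrow> (V' (Suc k) has_field_derivative (- Q z / 2 * V k z)) (at z)"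
    "\<And>k. V (Suc k) 0 = 0" "\<And>k. V' (Suc k) 0 = 0"
    by (rule ode_coefficients_exist[OF hol, of "\<lambda>_. 1" "\<lambda>_. 0"]) auto
  obtain U U' where U: "U 0 = (\<lambda>z. z)" "U' 0 = (\<lambda>_. 1)"
    "\<And>k z. norm z < 1 \<Longrightarrow> (U k has_field_derivative U' k z) (at z)"
    "\<And>k z. norm z < 1 \<Longrightarrow> (U' (Suc k) has_field_derivative (- Q z / 2 * U k z)) (at z)"
    "\<And>k. U (Suc k) 0 = 0" "\<And>k. U' (Suc k) 0 = 0"
    by (rule ode_coefficients_exist[OF hol, of "\<lambda>z. z" "\<lambda>_. 1"]) auto
  interpret schwarzian_pair Q M V V' U U'
    by unfold_locales (use hol M(1) bound V U in auto)
  have "(\<lambda>n. (of_nat (n + 2) ^ 3 - of_nat (n + 2)) * a (n + 2) * z ^ n) sums Q z" if "norm z < 1" for z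
  proof -
    have "{2..} = range (\<lambda>n::nat. n + 2)" by (auto simp: image_iff) presburger
    hence "((\<lambda>n. (of_nat n ^ 3 - of_nat n) * a n * z ^ (n - 2)) has_sum Q z) (range (\<lambda>n. n + 2))"
      using assms(2)[of z] that by simp
    hence "((\<lambda>n. (of_nat (n + 2) ^ 3 - of_nat (n + 2)) * a (n + 2) * z ^ n) has_sum Q z) UNIV"
      by (subst (asm) has_sum_reindex) (auto simp: o_def inj_on_def)
    thus ?thesis by (rule has_sum_imp_sums)
  qed
  from second_variation[of a, OF this]
  have sums: "(\<lambda>n. if n < 2 then 0 else 2 * pi * (real n * (norm (a n))\<^sup>2)) sums integral\<^sup>L disc (I2 0)"
    by (rule back_subst[where P = "\<lambda>h. h sums _"]) (auto simp: mult_ac)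
  hence "((\<lambda>n. if n < 2 then 0 else 2 * pi * (real n * (norm (a n))\<^sup>2)) has_sum integral\<^sup>L disc (I2 0)) UNIV"
    \<comment> \<open>All terms are nonnegative, so convergence of the ordered series is
      unconditional.\<close>
    by (intro norm_summable_imp_has_sum) (auto simp: sums_iff cong: if_cong)
  hence "((\<lambda>n. 2 * pi * (real n * (norm (a n))\<^sup>2)) has_sum integral\<^sup>L disc (I2 0)) {2..}"
    by (subst (asm) has_sum_cong_neutral[where T = "{2..}" and g = "\<lambda>n. 2 * pi * (real n * (norm (a n))\<^sup>2)"]) auto
  from has_sum_cmult_right[OF this, of "1 / (2 * pi)"]
  have hs: "((\<lambda>n. real n * (norm (a n))\<^sup>2) has_sum (integral\<^sup>L disc (I2 0) / (2 * pi))) {2..}" by simp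
  define \<delta> where "\<delta> = 1 / (96 * M)"
  have \<delta>: "\<delta> > 0" using M by (simp add: \<delta>_def)
  have small: "eventually (\<lambda>t. \<bar>t\<bar> < \<delta>) (nhds (0::real))"
    using \<delta> by (auto simp: eventually_nhds_metric dist_real_def)
  have "eventually (\<lambda>t. spherical_area (to_sphere (f t) ` ball 0 1) = integral\<^sup>L disc (I0 t)) (nhds 0)"
    using small assms(3) by eventually_elim (simp add: area_formula \<delta>_def)
  \<comment> \<open>A derivative at t depends on values near t, so the area formula is needed on a
    neighbourhood of each t close to 0.\<close>
  hence ev: "eventually (\<lambda>t. eventually (\<lambda>t. spherical_area (to_sphere (f t) ` ball 0 1) = integral\<^sup>L disc (I0 t)) (nhds t)) (nhds 0)"
    by (simp add: eventually_eventually)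
  have "has_second_real_derivative (\<lambda>t. spherical_area (to_sphere (f t) ` ball 0 1)) (integral\<^sup>L disc (I2 0)) 0"
    unfolding has_second_real_derivative_def
  proof (intro exI conjI)
    show "\<forall>\<^sub>F t in nhds 0. ((\<lambda>t. spherical_area (to_sphere (f t) ` ball 0 1)) has_real_derivative integral\<^sup>L disc (I1 t)) (at t)"
      using small ev
    proof eventually_elim
      case (elim t)
      have "((\<lambda>t. integral\<^sup>L disc (I0 t)) has_real_derivative integral\<^sup>L disc (I1 t)) (at t)"
        by (rule DERIV_area(1)) (use elim(1) in \<open>simp add: \<delta>_def\<close>)
      thus ?case using DERIV_cong_ev[OF refl elim(2) refl] by blast
    qed
    show "((\<lambda>t. integral\<^sup>L disc (I1 t)) has_real_derivative integral\<^sup>L disc (I2 0)) (at 0)"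
      by (rule DERIV_area(2)) (use M in simp)
  qed
  thus ?thesis using hs by (auto simp: infsumI has_sum_imp_summable)
qed

end
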